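(* Let $n\ge2$, $\sigma\in(0,1)$, and let $g\in[g_{\mathbb{S}^n}]$. Then for any $p\ge2$ and any $v\in C^\infty(\mathbb{S}^n)$, $$\int_{\mathbb{S}^n}|v|^{p-2}v\,P_\sigma^g(v)\,dV_g\ \ge\ \frac{4(p-1)}{p^2}\int_{\mathbb{S}^n}|v|^{\frac p2}P_\sigma^g(|v|^{\frac p2})\,dV_g+\frac{(p-2)^2}{p^2}\int_{\mathbb{S}^n}R_\sigma^g\,|v|^p\,dV_g$$ and $$\int_{\mathbb{S}^n}|v|^{p-2}v\,(P_\sigma^g-R_\sigma^g)(v)\,dV_g\ \ge\ 0.$$
   Context: $(\mathbb{S}^n,g_{\mathbb{S}^n})$ is the unit sphere in $\mathbb{R}^{n+1}$ with its round metric, and $[g_{\mathbb{S}^n}]=\{\rho g_{\mathbb{S}^n}:0<\rho\in C^\infty(\mathbb{S}^n)\}$ is its conformal class. $P_\sigma$ is the operator on $\mathbb{S}^n$ determined by $P_\sigma(Y^{(k)})=\frac{\Gamma(k+\frac n2+\sigma)}{\Gamma(k+\frac n2-\sigma)}Y^{(k)}$ for every spherical harmonic $Y^{(k)}$ of degree $k\ge0$. For $g=u^{\frac{4}{n-2\sigma}}g_{\mathbb{S}^n}$ with $0<u\in C^\infty(\mathbb{S}^n)$: $P_\sigma^g(\varphi)=u^{-\frac{n+2\sigma}{n-2\sigma}}P_\sigma(u\varphi)$, $R_\sigma^g=P_\sigma^g(1)$, $dV_g=u^{\frac{2n}{n-2\sigma}}dV_{g_{\mathbb{S}^n}}$. If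 $w=|v|^{p/2}$ is not smooth, $\int wP_\sigma^g(w)\,dV_g$ is understood as the quadratic form $\int (uw)P_\sigma(uw)\,dV_{g_{\mathbb{S}^n}}$ of $P_\sigma$ on the fractional Sobolev space $H^\sigma(\mathbb{S}^n)$. *)

theory Defs
  imports "HOL-Analysis.Analysis"
begin

text \<open>
  The unit sphere of dimension n is \<^term>\<open>sphere 0 1\<close> in a Euclidean space of dimension n + 1.
  A function on the sphere is given by a function on the whole space, of which only the values on
  the sphere matter.
\<close>

section \<open>Smooth functions on the sphere\<close>

primrec Ck_on :: "nat \<Rightarrow> ('a::euclidean_space \<Rightarrow> real) \<Rightarrow> 'a set \<Rightarrow> bool" where
  "Ck_on 0 f U \<longleftrightarrow> continuous_on U f"
| "Ck_on (Suc k) f U \<longleftrightarrow>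
     (\<forall>x\<in>U. f differentiable (at x)) \<and> (\<forall>d. Ck_on k (\<lambda>x. frechet_derivative f (at x) d) U)"

definition smooth_on_sphere :: "('a::euclidean_space \<Rightarrow> real) \<Rightarrow> bool" where
  "smooth_on_sphere f \<longleftrightarrow>
     (\<exists>U F. open U \<and> sphere 0 1 \<subseteq> U \<and> (\<forall>k. Ck_on k F U) \<and> (\<forall>x\<in>sphere 0 1. F x = f x))"

section \<open>The volume measure of the round metric\<close>

text \<open>
  By polar coordinates, the volume of a Borel subset A of the sphere is n + 1 times the Lebesgue
  measure of the cone of all r x with x in A and 0 < r < 1.
\<close>

definition sphere_measure :: "'a::euclidean_space measure" where
  "sphere_measure =
     scale_measure (of_nat DIM('a))
       (distr (restrict_space lborel (ball 0 1 - {0})) (restrict_space borel (sphere 0 1)) sgn)"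

section \<open>Spherical harmonics\<close>

definition laplacian :: "('a::euclidean_space \<Rightarrow> real) \<Rightarrow> 'a \<Rightarrow> real" where
  "laplacian f x =
     (\<Sum>b\<in>Basis. frechet_derivative (\<lambda>y. frechet_derivative f (at y) b) (at x) b)"

text \<open>
  A spherical harmonic of degree k is the restriction to the sphere of a harmonic polynomial that
  is homogeneous of degree k; by homogeneity it can be identified with that polynomial.
\<close>

definition spherical_harmonics :: "nat \<Rightarrow> ('a::euclidean_space \<Rightarrow> real) set" where
  "spherical_harmonics k =
     {h. real_polynomial_function h \<and> (\<forall>t x. h (t *\<^sub>R x) = t ^ k * h x) \<and> (\<forall>x. laplacian h x = 0)}"

text \<open>The degree k component of f: its \<open>L\<^sup>2\<close>-orthogonal projection to the spherical harmonics.\<close>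

definition harmonic_component :: "nat \<Rightarrow> ('a::euclidean_space \<Rightarrow> real) \<Rightarrow> 'a \<Rightarrow> real" where
  "harmonic_component k f =
     (THE h. h \<in> spherical_harmonics k \<and>
        (\<forall>z\<in>spherical_harmonics k. (LINT x|sphere_measure. (f x - h x) * z x) = 0))"

section \<open>The intertwining operator and its quadratic form\<close>

text \<open>Here and below, n is the dimension of the sphere, that is \<open>DIM('a) = n + 1\<close>.\<close>

definition P_eigenvalue :: "nat \<Rightarrow> real \<Rightarrow> nat \<Rightarrow> real" where
  "P_eigenvalue n \<sigma> k = Gamma (real k + real n / 2 + \<sigma>) / Gamma (real k + real n / 2 - \<sigma>)"

text \<open>
  For smooth f the expansion of f into spherical harmonics may be multiplied termwise by the
  eigenvalues, which grow polynomially; the resulting series converges absolutely and uniformly.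
\<close>

definition P_sphere :: "nat \<Rightarrow> real \<Rightarrow> ('a::euclidean_space \<Rightarrow> real) \<Rightarrow> 'a \<Rightarrow> real" where
  "P_sphere n \<sigma> f x = (\<Sum>k. P_eigenvalue n \<sigma> k * harmonic_component k f x)"

text \<open>
  The extension of the integral of \<open>f * P_sphere n \<sigma> f\<close> from smooth f to the Sobolev space
  \<open>H\<^sup>\<sigma>\<close>. The eigenvalues grow like \<open>k powr (2 * \<sigma>)\<close>, so an \<open>L\<^sup>2\<close> function f belongs to \<open>H\<^sup>\<sigma>\<close> exactly
  when this series of nonnegative terms converges. In particular it converges for Lipschitz f
  and \<open>0 < \<sigma> < 1\<close>.
\<close>

definition P_form :: "nat \<Rightarrow> real \<Rightarrow> ('a::euclidean_space \<Rightarrow> real) \<Rightarrow> real" where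
  "P_form n \<sigma> f =
     (\<Sum>k. P_eigenvalue n \<sigma> k * (LINT x|sphere_measure. (harmonic_component k f x)\<^sup>2))"

section \<open>The conformal class of the round metric\<close>

text \<open>
  A metric on the sphere takes a point and two tangent vectors there. So that metrics can be
  compared as functions, they are set to 0 for all other arguments.
\<close>

type_synonym 'a metric_tensor = "'a \<Rightarrow> 'a \<Rightarrow> 'a \<Rightarrow> real"

definition round_metric :: "'a::euclidean_space metric_tensor" where
  "round_metric x X Y = (if x \<in> sphere 0 1 \<and> x \<bullet> X = 0 \<and> x \<bullet> Y = 0 then X \<bullet> Y else 0)"

definition conformal_class :: "'a::euclidean_space metric_tensor set" where
  "conformal_class =
     {(\<lambda>x X Y. \<rho> x * round_metric x X Y) | \<rho>. smooth_on_sphere \<rho> \<and> (\<forall>x\<in>sphere 0 1. 0 < \<rho> x)}"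

text \<open>
  The function u with \<open>g = u powr (4 / (n - 2 * \<sigma>)) * round_metric\<close>. Its values on the sphere are
  determined by g.
\<close>

definition conformal_factor ::
    "nat \<Rightarrow> real \<Rightarrow> 'a::euclidean_space metric_tensor \<Rightarrow> 'a \<Rightarrow> real" where
  "conformal_factor n \<sigma> g =
     (SOME u. smooth_on_sphere u \<and> (\<forall>x\<in>sphere 0 1. 0 < u x) \<and>
        g = (\<lambda>x X Y. u x powr (4 / (real n - 2 * \<sigma>)) * round_metric x X Y))"

definition P_conf ::
    "nat \<Rightarrow> real \<Rightarrow> 'a::euclidean_space metric_tensor \<Rightarrow> ('a \<Rightarrow> real) \<Rightarrow> 'a \<Rightarrow> real" where
  "P_conf n \<sigma> g \<phi> x =
     conformal_factor n \<sigma> g x powr (- ((real n + 2 * \<sigma>) / (real n - 2 * \<sigma>))) *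
     P_sphere n \<sigma> (\<lambda>y. conformal_factor n \<sigma> g y * \<phi> y) x"

definition R_conf :: "nat \<Rightarrow> real \<Rightarrow> 'a::euclidean_space metric_tensor \<Rightarrow> 'a \<Rightarrow> real" where
  "R_conf n \<sigma> g = P_conf n \<sigma> g (\<lambda>_. 1)"

definition vol_conf :: "nat \<Rightarrow> real \<Rightarrow> 'a::euclidean_space metric_tensor \<Rightarrow> 'a measure" where
  "vol_conf n \<sigma> g =
     density sphere_measure
       (\<lambda>x. ennreal (conformal_factor n \<sigma> g x powr (2 * real n / (real n - 2 * \<sigma>))))"

text \<open>The integral of \<open>w * P_conf n \<sigma> g w\<close> with respect to \<open>vol_conf n \<sigma> g\<close>, as a quadratic form.\<close>

definition P_conf_form ::
    "nat \<Rightarrow> real \<Rightarrow> 'a::euclidean_space metric_tensor \<Rightarrow> ('a \<Rightarrow> real) \<Rightarrow> real" where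
  "P_conf_form n \<sigma> g w = P_form n \<sigma> (\<lambda>x. conformal_factor n \<sigma> g x * w x)"

end

theory Submission
  imports Defs "HOL-Real_Asymp.Real_Asymp"
begin

text \<open>
  Off the diagonal, the negative of \<open>P_sphere n \<sigma>\<close> is an integral operator with a positive multiple of
  the kernel \<open>dist x y powr (- n - 2 * \<sigma>)\<close>, so both inequalities reduce to pointwise ones for pairs
  of values of v (Stroock--Varopoulos). To avoid the singular kernel, put \<open>l = (n - 1) / 2\<close> and
  consider for \<open>0 < r < 1\<close> the positive kernels \<open>(1 + r\<^sup>2 - 2 * r * (x \<bullet> y)) powr (- l - 2)\<close>. They act
  on the spherical harmonics of degree k as multiples \<open>kmult l k r\<close> of the identity, and for the
  positive weight \<open>kweight l \<sigma>\<close> the integral over r of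
  \<open>(kmult l 0 r - kmult l k r) * kweight l \<sigma> r\<close> is a constant times the difference of the
  eigenvalues of degree k and 0. For each r the inequality holds by positivity of the kernel;
  integrating over r gives it for the partial sums of the form of \<open>\<bar>v\<bar> powr (p / 2)\<close>, which also
  shows that this form is finite.

  The multipliers come from the generating function of the Gegenbauer polynomials. All facts about
  spherical harmonics are derived from the Poisson kernel, which is an approximate identity, and
  from integration by parts along the rotation fields \<open>rot a b\<close>.
\<close>

section \<open>Smooth functions\<close>

text \<open>Why the exponent is - l - 2: the Poisson kernel, of exponent - l - 1, has the
  multipliers r^k. Against a positive weight the integral of 1 - r^k grows at most linearly in k,
  whereas the eigenvalues grow like k^(2 \<sigma>), so that kernel cannot serve beyond \<sigma> =
  1/2. The numerators of \<open>kmult l k r\<close> agree up to first order in 1 - r for all k, so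
  differences of multipliers gain a second power of 1 - r, which is enough for every \<sigma> < 1.
  The weight comes from the Beta function: up to a constant the eigenvalue is formally the divergent
  integral B(k + n/2 + \<sigma>, - 2 \<sigma>), and subtracting the term of degree 0 makes it
  converge. What this subtraction takes away is restored on the diagonal: because 4 (p - 1) / p^2 +
  (p - 2)^2 / p^2 = 1, the two-point inequality is an equality for x = y. Hence the terms with
  \<open>kmult l 0 r\<close> cancel, and the lowest eigenvalue can be added back at the end.\<close>

definition dd :: "'a::euclidean_space \<Rightarrow> ('a \<Rightarrow> real) \<Rightarrow> 'a \<Rightarrow> real" where
  "dd d f x = frechet_derivative f (at x) d"

definition smooth_on :: "('a::euclidean_space \<Rightarrow> real) \<Rightarrow> 'a set \<Rightarrow> bool" where
  "smooth_on f U \<longleftrightarrow> (\<forall>k. Ck_on k f U)"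

lemma Ck_on_Suc_imp: "Ck_on (Suc k) f U \<Longrightarrow> Ck_on k f U"
proof (induction k arbitrary: f)
  case 0
  then show ?case
    by (auto intro!: continuous_at_imp_continuous_on differentiable_imp_continuous_within)
next
  case (Suc k)
  have "Ck_on k (\<lambda>x. frechet_derivative f (at x) d) U" for d
    using Suc.IH Suc.prems by auto
  with Suc.prems show ?case by simp
qed

lemma frechet_derivative_cong_open:
  assumes "open U" "x \<in> U" "\<And>y. y \<in> U \<Longrightarrow> f y = g y"
  shows "frechet_derivative f (at x) = frechet_derivative g (at x)"
proof -
  have "(f has_derivative D) (at x) \<longleftrightarrow> (g has_derivative D) (at x)" for D
    using assms has_derivative_transform_within_open[of f D x UNIV U g]
      has_derivative_transform_within_open[of g D x UNIV U f] by auto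
  then show ?thesis by (simp add: frechet_derivative_def)
qed

lemma differentiable_cong_open:
  assumes "open U" "x \<in> U" "\<And>y. y \<in> U \<Longrightarrow> f y = g y" "f differentiable (at x)"
  shows "g differentiable (at x)"
  using assms has_derivative_transform_within_open[of f _ x UNIV U g]
  unfolding differentiable_def by metis

text \<open>The derivative rules give \<open>frechet_derivative\<close> of a sum, product or power
  only at points of U. Openness of U makes derivatives at its points depend on the values in U
  alone, so such pointwise formulas may be substituted under \<open>Ck_on\<close>.\<close>

lemma Ck_on_cong:
  assumes "open U" "\<And>x. x \<in> U \<Longrightarrow> f x = g x" "Ck_on k f U"
  shows "Ck_on k g U"
  using assms(2,3)
proof (induction k arbitrary: f g)
  case 0
  then show ?case using continuous_on_cong[of U U f g] by simp
next
  case (Suc k)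
  have "Ck_on k (\<lambda>x. frechet_derivative g (at x) d) U" for d
  proof (rule Suc.IH)
    show "frechet_derivative f (at x) d = frechet_derivative g (at x) d" if "x \<in> U" for x
      using frechet_derivative_cong_open[OF assms(1) that, of f g] Suc.prems(1) by simp
    show "Ck_on k (\<lambda>x. frechet_derivative f (at x) d) U" using Suc.prems(2) by simp
  qed
  moreover have "g differentiable (at x)" if "x \<in> U" for x
    using differentiable_cong_open[OF assms(1) that, of f g] Suc.prems that by simp
  ultimately show ?case by simp
qed

lemma Ck_on_subset: "Ck_on k f U \<Longrightarrow> V \<subseteq> U \<Longrightarrow> Ck_on k f V"
  by (induction k arbitrary: f) (auto intro: continuous_on_subset)

lemma Ck_on_const: "Ck_on k (\<lambda>x. c) U"
proof (induction k arbitrary: c)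
  case (Suc k)
  then show ?case by (simp add: frechet_derivative_const)
qed simp

lemma dd_eq: "(f has_derivative f') (at x) \<Longrightarrow> dd d f x = f' d"
  unfolding dd_def by (metis frechet_derivative_at)

lemma has_derivative_dd: "f differentiable (at x) \<Longrightarrow> (f has_derivative (\<lambda>d. dd d f x)) (at x)"
  unfolding dd_def by (simp add: frechet_derivative_works[symmetric])

lemma Ck_on_linear:
  assumes "bounded_linear f"
  shows "Ck_on k f U"
proof (cases k)
  case 0
  then show ?thesis using assms by (simp add: linear_continuous_on)
next
  case (Suc j)
  have "frechet_derivative f (at x) = f" for x
    using assms bounded_linear_imp_has_derivative frechet_derivative_at by metis
  then show ?thesis using Suc assms Ck_on_const
    by (auto simp: bounded_linear_imp_differentiable)
qed

lemma Ck_on_add: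
  assumes "open U" "Ck_on k f U" "Ck_on k g U"
  shows "Ck_on k (\<lambda>x. f x + g x) U"
  using assms(2,3)
proof (induction k arbitrary: f g)
  case 0
  then show ?case by (simp add: continuous_on_add)
next
  case (Suc k)
  have "Ck_on k (\<lambda>x. frechet_derivative (\<lambda>x. f x + g x) (at x) d) U" for d
  proof (rule Ck_on_cong[OF assms(1)])
    show "frechet_derivative f (at x) d + frechet_derivative g (at x) d =
        frechet_derivative (\<lambda>x. f x + g x) (at x) d" if "x \<in> U" for x
      using Suc.prems that frechet_derivative_works has_derivative_add[of f _ "at x" g]
      by (metis (no_types, lifting) Ck_on.simps(2) frechet_derivative_at)
  qed (use Suc in auto)
  with Suc.prems show ?case by simp
qed

lemma Ck_on_mult:
  assumes "open U" "Ck_on k f U" "Ck_on k g U"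
  shows "Ck_on k (\<lambda>x. f x * g x) U"
  using assms(2,3)
proof (induction k arbitrary: f g)
  case 0
  then show ?case by (simp add: continuous_on_mult)
next
  case (Suc k)
  have "Ck_on k (\<lambda>x. frechet_derivative (\<lambda>x. f x * g x) (at x) d) U" for d
  proof (rule Ck_on_cong[OF assms(1)])
    show "f x * frechet_derivative g (at x) d + frechet_derivative f (at x) d * g x =
        frechet_derivative (\<lambda>x. f x * g x) (at x) d" if "x \<in> U" for x
      using Suc.prems that frechet_derivative_works has_derivative_mult[of f _ x UNIV g]
      by (metis (no_types, lifting) Ck_on.simps(2) frechet_derivative_at)
    show "Ck_on k (\<lambda>x. f x * frechet_derivative g (at x) d + frechet_derivative f (at x) d * g x) U"
      using Suc Ck_on_Suc_imp[OF Suc.prems(1)] Ck_on_Suc_imp[OF Suc.prems(2)]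
      by (intro Ck_on_add assms(1)) auto
  qed
  moreover have "\<forall>x\<in>U. (\<lambda>x. f x * g x) differentiable (at x)"
    using Suc.prems by (auto intro!: differentiable_mult)
  ultimately show ?case by simp
qed

lemma smooth_on_const [simp]: "smooth_on (\<lambda>x. c) U"
  by (simp add: smooth_on_def Ck_on_const)

lemma smooth_on_add: "open U \<Longrightarrow> smooth_on f U \<Longrightarrow> smooth_on g U \<Longrightarrow> smooth_on (\<lambda>x. f x + g x) U"
  by (simp add: smooth_on_def Ck_on_add)

lemma smooth_on_mult: "open U \<Longrightarrow> smooth_on f U \<Longrightarrow> smooth_on g U \<Longrightarrow> smooth_on (\<lambda>x. f x * g x) U"
  by (simp add: smooth_on_def Ck_on_mult)

lemma smooth_on_diff:
  assumes "open U" "smooth_on f U" "smooth_on g U"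
  shows "smooth_on (\<lambda>x. f x - g x) U"
  using smooth_on_add[OF assms(1,2) smooth_on_mult[OF assms(1) smooth_on_const[of "-1"] assms(3)]]
  by simp

lemma smooth_on_linear: "bounded_linear f \<Longrightarrow> smooth_on f U"
  by (simp add: smooth_on_def Ck_on_linear)

lemma smooth_on_inner_right [simp]: "smooth_on (\<lambda>x. x \<bullet> a) U"
  by (simp add: smooth_on_linear bounded_linear_inner_left)

lemma smooth_on_sum:
  "open U \<Longrightarrow> (\<And>i. i \<in> I \<Longrightarrow> smooth_on (f i) U) \<Longrightarrow> smooth_on (\<lambda>x. \<Sum>i\<in>I. f i x) U"
  by (induction I rule: infinite_finite_induct) (auto intro: smooth_on_add)

lemma smooth_on_dd: "smooth_on f U \<Longrightarrow> smooth_on (dd d f) U"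
  unfolding smooth_on_def dd_def by (metis Ck_on.simps(2))

lemma smooth_on_differentiable: "smooth_on f U \<Longrightarrow> x \<in> U \<Longrightarrow> f differentiable (at x)"
  unfolding smooth_on_def by (metis Ck_on.simps(2))

lemma smooth_on_continuous: "smooth_on f U \<Longrightarrow> continuous_on U f"
  unfolding smooth_on_def by (metis Ck_on.simps(1))

lemma smooth_on_subset: "smooth_on f U \<Longrightarrow> V \<subseteq> U \<Longrightarrow> smooth_on f V"
  unfolding smooth_on_def using Ck_on_subset by blast

lemma smooth_on_has_derivative:
  "smooth_on f U \<Longrightarrow> x \<in> U \<Longrightarrow> (f has_derivative (\<lambda>d. dd d f x)) (at x)"
  by (simp add: has_derivative_dd smooth_on_differentiable)

lemma dd_cong_open:
  "open U \<Longrightarrow> x \<in> U \<Longrightarrow> (\<And>y. y \<in> U \<Longrightarrow> f y = g y) \<Longrightarrow> dd d f x = dd d g x"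
  unfolding dd_def using frechet_derivative_cong_open by metis

lemma dd_const [simp]: "dd d (\<lambda>x. c) x = 0"
  by (simp add: dd_def frechet_derivative_const)

lemma dd_inner_right [simp]: "dd d (\<lambda>x. x \<bullet> a) x = d \<bullet> a"
  by (rule dd_eq) (auto intro!: derivative_eq_intros)

lemma dd_add:
  "f differentiable (at x) \<Longrightarrow> g differentiable (at x) \<Longrightarrow>
   dd d (\<lambda>x. f x + g x) x = dd d f x + dd d g x"
  by (rule dd_eq) (intro has_derivative_add has_derivative_dd)

lemma dd_diff:
  "f differentiable (at x) \<Longrightarrow> g differentiable (at x) \<Longrightarrow>
   dd d (\<lambda>x. f x - g x) x = dd d f x - dd d g x"
  by (rule dd_eq) (intro has_derivative_diff has_derivative_dd)

lemma dd_mult: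
  "f differentiable (at x) \<Longrightarrow> g differentiable (at x) \<Longrightarrow>
   dd d (\<lambda>x. f x * g x) x = f x * dd d g x + dd d f x * g x"
  by (rule dd_eq) (intro has_derivative_mult has_derivative_dd)

lemma dd_sum:
  "(\<And>i. i \<in> I \<Longrightarrow> f i differentiable (at x)) \<Longrightarrow>
   dd d (\<lambda>x. \<Sum>i\<in>I. f i x) x = (\<Sum>i\<in>I. dd d (f i) x)"
  by (rule dd_eq) (intro has_derivative_sum has_derivative_dd)

lemma dd_expand:
  assumes "f differentiable (at x)"
  shows "dd d f x = (\<Sum>b\<in>Basis. (d \<bullet> b) * dd b f x)"
proof -
  have "linear (\<lambda>d. dd d f x)"
    using has_derivative_dd[OF assms] has_derivative_linear by blast
  then have "dd (\<Sum>b\<in>Basis. (d \<bullet> b) *\<^sub>R b) f x = (\<Sum>b\<in>Basis. (d \<bullet> b) * dd b f x)"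
    by (simp add: linear_sum[of "\<lambda>d. dd d f x"] linear_cmul[of "\<lambda>d. dd d f x"])
  then show ?thesis by (simp add: euclidean_representation)
qed

text \<open>The exponent varies in the induction because the derivative of a power carries the
  exponent c - 1.\<close>

lemma smooth_on_powr:
  assumes U: "open U" and f: "smooth_on f U" and pos: "\<And>x. x \<in> U \<Longrightarrow> 0 < f x"
  shows "smooth_on (\<lambda>x. f x powr c) U"
proof -
  have "Ck_on k (\<lambda>x. f x powr c) U" for k
  proof (induction k arbitrary: c)
    case 0
    then show ?case using smooth_on_continuous[OF f] pos
      by (auto intro!: continuous_on_powr continuous_on_const simp: less_imp_neq[symmetric] dest: less_imp_neq)
  next
    case (Suc k)
    have D: "((\<lambda>x. f x powr c) has_derivative (\<lambda>d. c * f x powr (c - 1) * dd d f x)) (at x)"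
      if "x \<in> U" for x
    proof -
      have "((\<lambda>y. y powr c) has_derivative (\<lambda>h. (c * f x powr (c - 1)) * h)) (at (f x))"
        using has_real_derivative_powr[OF pos[OF that], of c]
        by (simp add: has_field_derivative_def)
      from has_derivative_compose[OF smooth_on_has_derivative[OF f that] this]
      show ?thesis by simp
    qed
    have "Ck_on k (\<lambda>x. frechet_derivative (\<lambda>x. f x powr c) (at x) d) U" for d
    proof (rule Ck_on_cong[OF U])
      show "c * f x powr (c - 1) * dd d f x = frechet_derivative (\<lambda>x. f x powr c) (at x) d"
        if "x \<in> U" for x
        using dd_eq[OF D[OF that], of d] by (simp add: dd_def)
      have "Ck_on k (dd d f) U" using smooth_on_dd[OF f] by (simp add: smooth_on_def)
      then show "Ck_on k (\<lambda>x. c * f x powr (c - 1) * dd d f x) U"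
        by (intro Ck_on_mult U Ck_on_const Suc)
    qed
    then show ?case using D by (auto simp: differentiable_def)
  qed
  then show ?thesis by (simp add: smooth_on_def)
qed

lemma smooth_on_polynomial: "real_polynomial_function f \<Longrightarrow> smooth_on f UNIV"
  by (induction rule: real_polynomial_function.induct)
     (auto intro: smooth_on_linear smooth_on_add smooth_on_mult)

lemma smooth_on_sphereE:
  assumes "smooth_on_sphere f"
  obtains U F where "open U" "sphere 0 1 \<subseteq> U" "smooth_on F U" "\<And>x. x \<in> sphere 0 1 \<Longrightarrow> F x = f x"
  using assms unfolding smooth_on_sphere_def smooth_on_def by blast

lemma smooth_on_sphereI:
  assumes "open U" "sphere 0 1 \<subseteq> U" "smooth_on F U" "\<And>x. x \<in> sphere 0 1 \<Longrightarrow> F x = f x"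
  shows "smooth_on_sphere f"
  using assms unfolding smooth_on_sphere_def smooth_on_def by blast

lemma smooth_on_sphere_mult:
  assumes "smooth_on_sphere f" "smooth_on_sphere g"
  shows "smooth_on_sphere (\<lambda>x. f x * g x)"
proof -
  obtain U F where F: "open U" "sphere 0 1 \<subseteq> U" "smooth_on F U" "\<And>x. x \<in> sphere 0 1 \<Longrightarrow> F x = f x"
    using smooth_on_sphereE[OF assms(1)] by blast
  obtain V G where G: "open V" "sphere 0 1 \<subseteq> V" "smooth_on G V" "\<And>x. x \<in> sphere 0 1 \<Longrightarrow> G x = g x"
    using smooth_on_sphereE[OF assms(2)] by blast
  have "smooth_on (\<lambda>x. F x * G x) (U \<inter> V)"
    using F(1,3) G(1,3) by (intro smooth_on_mult) (auto intro: smooth_on_subset)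
  then show ?thesis using F G
    by (intro smooth_on_sphereI[of "U \<inter> V" "\<lambda>x. F x * G x"]) auto
qed

text \<open>The extension F may fail to be positive away from the sphere. Its domain is cut down to
  the points where F is positive, an open set by continuity that still contains the sphere.\<close>

lemma smooth_on_sphere_powr:
  assumes "smooth_on_sphere f" "\<And>x. x \<in> sphere 0 1 \<Longrightarrow> 0 < f x"
  shows "smooth_on_sphere (\<lambda>x. f x powr c)"
proof -
  obtain U F where F: "open U" "sphere 0 1 \<subseteq> U" "smooth_on F U" "\<And>x. x \<in> sphere 0 1 \<Longrightarrow> F x = f x"
    using smooth_on_sphereE[OF assms(1)] by blast
  have op: "open {x \<in> U. 0 < F x}"
    using continuous_open_preimage[OF smooth_on_continuous[OF F(3)] F(1) open_greaterThan[of 0]]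
    by (simp add: vimage_def Int_def)
  have "smooth_on (\<lambda>x. F x powr c) {x \<in> U. 0 < F x}"
    by (rule smooth_on_powr[OF op]) (auto intro: smooth_on_subset[OF F(3)])
  then show ?thesis using F op assms(2)
    by (intro smooth_on_sphereI[of "{x \<in> U. 0 < F x}" "\<lambda>x. F x powr c"]) auto
qed

lemma smooth_on_sphere_continuous: "smooth_on_sphere f \<Longrightarrow> continuous_on (sphere 0 1) f"
  by (metis smooth_on_sphereE smooth_on_continuous continuous_on_subset continuous_on_cong)

section \<open>Integration over the sphere\<close>

text \<open>Makes the factor in \<open>sphere_measure\<close> accessible to the integration rules
  for densities.\<close>

lemma scale_measure_eq_density: "scale_measure c M = density M (\<lambda>_. c)"
  by (rule measure_eqI) (auto simp: emeasure_density_const)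

lemma space_sphere_measure [simp]: "space sphere_measure = sphere 0 1"
  by (simp add: sphere_measure_def space_scale_measure space_restrict_space)

lemma sets_sphere_measure [measurable_cong]:
  "sets sphere_measure = sets (restrict_space borel (sphere 0 1))"
  by (simp add: sphere_measure_def)

lemma sgn_measurable_sphere:
  "(sgn :: 'a::euclidean_space \<Rightarrow> 'a) \<in> restrict_space lborel (ball 0 1 - {0}) \<rightarrow>\<^sub>M restrict_space borel (sphere 0 1)"
proof (rule measurable_restrict_space2)
  show "sgn \<in> space (restrict_space lborel (ball (0::'a) 1 - {0})) \<rightarrow> sphere 0 1"
    by (auto simp: space_restrict_space norm_sgn)
  have "(\<lambda>x::'a. x /\<^sub>R norm x) \<in> borel_measurable borel" by measurable
  then show "(sgn :: 'a \<Rightarrow> 'a) \<in> borel_measurable (restrict_space lborel (ball 0 1 - {0}))"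
    by (simp add: sgn_div_norm[abs_def] measurable_restrict_space1)
qed

lemma integral_sphere_measure:
  fixes f :: "'a::euclidean_space \<Rightarrow> real"
  assumes "f \<in> borel_measurable sphere_measure"
  shows "(LINT x|sphere_measure. f x) =
    real DIM('a) * (LINT x|lborel. indicator (ball 0 1 - {0}) x * f (sgn x))"
proof -
  let ?N = "distr (restrict_space lborel (ball 0 1 - {0})) (restrict_space borel (sphere 0 1)) (sgn :: 'a \<Rightarrow> 'a)"
  have f: "f \<in> borel_measurable (restrict_space borel (sphere 0 1))"
    using assms by (simp add: measurable_cong_sets[OF sets_sphere_measure refl])
  have "(LINT x|sphere_measure. f x) = (LINT x|?N. real DIM('a) * f x)"
    unfolding sphere_measure_def scale_measure_eq_density
    using f by (subst integral_real_density[symmetric]) (auto simp: ennreal_of_nat_eq_real_of_nat)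
  also have "\<dots> = real DIM('a) * (LINT x|?N. f x)" by simp
  also have "(LINT x|?N. f x) = (LINT x|restrict_space lborel (ball 0 1 - {0}). f (sgn x))"
    by (rule integral_distr[OF sgn_measurable_sphere f])
  also have "\<dots> = (LINT x|lborel. indicator (ball 0 1 - {0}) x * f (sgn x))"
    by (subst integral_restrict_space) auto
  finally show ?thesis .
qed

lemma emeasure_sphere_measure:
  "emeasure sphere_measure (sphere (0::'a::euclidean_space) 1) =
    ennreal (real DIM('a)) * emeasure lborel (ball (0::'a) 1 - {0})"
proof -
  have "sgn -` sphere 0 1 \<inter> space (restrict_space lborel (ball (0::'a) 1 - {0})) = ball 0 1 - {0}"
    by (auto simp: space_restrict_space norm_sgn)
  moreover have "sphere (0::'a) 1 \<in> sets (restrict_space borel (sphere 0 1))"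
    using sets.top[of "restrict_space borel (sphere (0::'a) 1)"] by (simp add: space_restrict_space)
  ultimately have "emeasure (distr (restrict_space lborel (ball 0 1 - {0})) (restrict_space borel (sphere 0 1)) sgn)
      (sphere (0::'a) 1) = emeasure (restrict_space lborel (ball (0::'a) 1 - {0})) (ball 0 1 - {0})"
    by (simp add: emeasure_distr[OF sgn_measurable_sphere])
  then show ?thesis unfolding sphere_measure_def
    by (simp add: emeasure_restrict_space ennreal_of_nat_eq_real_of_nat)
qed

interpretation sphere_measure: finite_measure "sphere_measure :: 'a::euclidean_space measure"
proof
  have "emeasure lborel (ball (0::'a) 1 - {0}) \<le> emeasure lborel (ball (0::'a) 1)"
    by (rule emeasure_mono) auto
  also have "\<dots> < \<infinity>" by (rule emeasure_lborel_ball_finite)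
  finally show "emeasure sphere_measure (space (sphere_measure :: 'a measure)) \<noteq> \<infinity>"
    by (simp add: emeasure_sphere_measure ennreal_mult_eq_top_iff)
qed

definition sphere_area :: "'a::euclidean_space itself \<Rightarrow> real" where
  "sphere_area _ = measure sphere_measure (sphere (0::'a) 1)"

lemma sphere_area_pos: "0 < sphere_area TYPE('a::euclidean_space)"
proof -
  have "emeasure lborel (ball (0::'a) 1 - {0}) = emeasure lborel (ball (0::'a) 1)"
    by (rule emeasure_Diff_null_set) auto
  moreover have "emeasure lborel (ball (0::'a) 1) \<noteq> 0"
    using content_ball_pos[of 1 "0::'a"] by (auto simp: measure_def)
  ultimately have "emeasure sphere_measure (sphere (0::'a) 1) \<noteq> 0"
    by (simp add: emeasure_sphere_measure)
  then have "measure sphere_measure (sphere (0::'a) 1) \<noteq> 0"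
    by (simp add: sphere_measure.emeasure_eq_measure)
  then show ?thesis unfolding sphere_area_def by (simp add: less_le)
qed

lemma borel_measurable_sphere:
  fixes f :: "'a::euclidean_space \<Rightarrow> real"
  assumes "continuous_on (sphere 0 1) f"
  shows "f \<in> borel_measurable sphere_measure"
  using borel_measurable_continuous_on_restrict[OF assms]
  by (simp add: measurable_cong_sets[OF sets_sphere_measure refl])

lemma continuous_on_sphere_bounded:
  fixes f :: "'a::euclidean_space \<Rightarrow> real"
  assumes "continuous_on (sphere 0 1) f"
  obtains B where "0 < B" "\<And>x. norm x = 1 \<Longrightarrow> \<bar>f x\<bar> \<le> B"
proof -
  have "bounded (f ` sphere 0 1)"
    using assms compact_continuous_image compact_imp_bounded compact_sphere by blast
  then obtain B where "0 < B" "\<forall>y\<in>f ` sphere 0 1. norm y \<le> B"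
    unfolding bounded_pos by blast
  then show ?thesis by (intro that[of B]) auto
qed

lemma integrable_sphere:
  fixes f :: "'a::euclidean_space \<Rightarrow> real"
  assumes "continuous_on (sphere 0 1) f"
  shows "integrable sphere_measure f"
proof -
  obtain B where "0 < B" "\<And>x. norm x = 1 \<Longrightarrow> \<bar>f x\<bar> \<le> B"
    using continuous_on_sphere_bounded[OF assms] by blast
  then show ?thesis
    by (intro sphere_measure.integrable_const_bound[where B = B] borel_measurable_sphere assms AE_I2) auto
qed

lemma integral_sphere_cong:
  "(\<And>x. norm x = 1 \<Longrightarrow> f x = g x) \<Longrightarrow> (LINT x|sphere_measure. f x) = (LINT x|sphere_measure. g x)"
  by (rule Bochner_Integration.integral_cong) auto

section \<open>Integration by parts along rotations\<close>

text \<open>By translation invariance of Lebesgue measure every difference quotient of H has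
  integral 0. The quotients are dominated through the mean value theorem and converge to the
  derivative.\<close>

lemma integral_dd_eq_0:
  fixes H :: "'a::euclidean_space \<Rightarrow> real"
  assumes diff: "\<And>x. H differentiable (at x)" and cont: "continuous_on UNIV (dd d H)"
    and supp: "\<And>x. R \<le> norm x \<Longrightarrow> H x = 0" and "0 \<le> R"
  shows "integrable lborel (dd d H)" "(LINT x|lborel. dd d H x) = 0"
proof -
  \<comment> \<open>If the norm of x exceeds R + \<open>norm d\<close>, both points of every
    quotient lie outside the support. Otherwise the intermediate point of the mean value theorem is
    at most another \<open>norm d\<close> away, hence the factor 2.\<close>
  let ?K = "cball (0::'a) (R + 2 * norm d)"
  let ?q = "\<lambda>n x. (H (x + d /\<^sub>R Suc n) - H x) * real (Suc n)"
  have contH: "continuous_on A H" for A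
    using diff by (auto intro!: continuous_at_imp_continuous_on differentiable_imp_continuous_within)
  have Hm: "H \<in> borel_measurable borel" using contH by (rule borel_measurable_continuous_onI)
  have intH: "integrable lborel H"
  proof -
    have "integrable lborel (\<lambda>x. indicator (cball 0 R) x *\<^sub>R H x)"
      by (rule borel_integrable_compact) (auto intro: contH)
    moreover have "(\<lambda>x. indicator (cball 0 R) x *\<^sub>R H x) = H"
      using supp by (auto simp: indicator_def fun_eq_iff)
    ultimately show ?thesis by simp
  qed
  have shift: "integrable lborel (\<lambda>x. H (x + c))" "(LINT x|lborel. H (x + c)) = (LINT x|lborel. H x)" for c
  proof -
    have m: "(+) c \<in> borel_measurable lborel" by measurable
    show "integrable lborel (\<lambda>x. H (x + c))"
      using integrable_distr[of "(+) c" lborel borel H] intH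
      by (simp add: lborel_distr_plus add.commute)
    have "(LINT x|lborel. H x) = (LINT x|distr lborel borel ((+) c). H x)"
      by (simp add: lborel_distr_plus)
    also have "\<dots> = (LINT x|lborel. H (c + x))"
      by (rule integral_distr) (use Hm in auto)
    finally show "(LINT x|lborel. H (x + c)) = (LINT x|lborel. H x)" by (simp add: add.commute)
  qed
  obtain M where M: "0 < M" "\<And>x. x \<in> ?K \<Longrightarrow> \<bar>dd d H x\<bar> \<le> M"
  proof -
    have "bounded (dd d H ` ?K)"
      by (intro compact_imp_bounded compact_continuous_image continuous_on_subset[OF cont]) auto
    then show thesis using that unfolding bounded_pos by auto
  qed
  have bound: "norm (?q n x) \<le> M * indicator ?K x" for n x
  proof (cases "norm x \<le> R + norm d")
    case True
    let ?e = "1 / real (Suc n)"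
    have e: "0 < ?e" "?e \<le> 1" by auto
    have "\<exists>s\<in>{0<..<?e}. H (x + ?e *\<^sub>R d) - H (x + 0 *\<^sub>R d) = dd (?e *\<^sub>R d) H (x + s *\<^sub>R d)"
    proof -
      have "((\<lambda>s. H (x + s *\<^sub>R d)) has_derivative (\<lambda>h. dd (h *\<^sub>R d) H (x + s *\<^sub>R d))) (at s within {0..?e})" for s
        by (rule has_derivative_compose[OF _ has_derivative_dd[OF diff]])
           (auto intro!: derivative_eq_intros)
      from mvt_simple[OF e(1) this] show ?thesis by auto
    qed
    then obtain s where s: "0 < s" "s < ?e" "H (x + ?e *\<^sub>R d) - H x = dd (?e *\<^sub>R d) H (x + s *\<^sub>R d)"
      by auto
    have lin: "dd (?e *\<^sub>R d) H y = ?e * dd d H y" for y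
      using linear_cmul[OF has_derivative_linear[OF has_derivative_dd[OF diff]]] by simp
    have "norm (x + s *\<^sub>R d) \<le> norm x + s * norm d"
      using norm_triangle_ineq[of x "s *\<^sub>R d"] s by simp
    also have "\<dots> \<le> R + norm d + 1 * norm d"
      using True less_le_trans[OF s(2) e(2)] by (intro add_mono mult_right_mono) auto
    finally have "\<bar>dd d H (x + s *\<^sub>R d)\<bar> \<le> M" by (intro M) auto
    moreover have "?q n x = dd d H (x + s *\<^sub>R d)"
      using s(3) unfolding lin by (simp add: divide_inverse del: of_nat_Suc)
    moreover have "norm x \<le> R + 2 * norm d" using True norm_ge_zero[of d] by linarith
    ultimately show ?thesis by simp
  next
    case False
    have "norm x \<le> norm (x + d /\<^sub>R Suc n) + norm (d /\<^sub>R Suc n)"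
      using norm_triangle_ineq4[of "x + d /\<^sub>R Suc n" "d /\<^sub>R Suc n"] by simp
    moreover have "norm (d /\<^sub>R Suc n) \<le> norm d"
      by (simp add: divide_simps mult_left_le[of _ "norm d"] distrib_left)
    ultimately have "R \<le> norm (x + d /\<^sub>R Suc n)" using False by linarith
    moreover have "R \<le> norm x" using False norm_ge_zero[of d] by linarith
    ultimately show ?thesis using supp M(1) by simp
  qed
  have lim: "(\<lambda>n. ?q n x) \<longlonglongrightarrow> dd d H x" for x
  proof -
    have "((\<lambda>s. H (x + s *\<^sub>R d)) has_derivative (\<lambda>h. dd (h *\<^sub>R d) H (x + 0 *\<^sub>R d))) (at 0)"
      by (rule has_derivative_compose[OF _ has_derivative_dd[OF diff]])
         (auto intro!: derivative_eq_intros)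
    moreover have "dd (h *\<^sub>R d) H x = dd d H x * h" for h
      using linear_cmul[OF has_derivative_linear[OF has_derivative_dd[OF diff]]] by simp
    ultimately have "DERIV (\<lambda>s. H (x + s *\<^sub>R d)) 0 :> dd d H x"
      by (simp add: has_field_derivative_def)
    then have "((\<lambda>s. (H (x + s *\<^sub>R d) - H x) / s) \<longlongrightarrow> dd d H x) (at 0)"
      by (simp add: DERIV_def)
    moreover have "filterlim (\<lambda>n. inverse (real (Suc n))) (at 0) sequentially"
      unfolding filterlim_at by (intro conjI LIMSEQ_inverse_real_of_nat always_eventually) auto
    ultimately have "(\<lambda>n. (H (x + inverse (real (Suc n)) *\<^sub>R d) - H x) / inverse (real (Suc n))) \<longlonglongrightarrow> dd d H x"
      by (rule filterlim_compose)
    then show ?thesis by (simp add: divide_inverse del: of_nat_Suc)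
  qed
  have q0: "(LINT x|lborel. ?q n x) = 0" for n
    using shift intH by simp
  have w: "integrable lborel (\<lambda>x. M * indicator ?K x)"
    by (intro integrable_mult_right integrable_real_indicator) (use emeasure_lborel_cball_finite in auto)
  have m: "dd d H \<in> borel_measurable lborel"
    using borel_measurable_continuous_onI[OF cont] by simp
  have mq: "?q n \<in> borel_measurable lborel" for n
    using Hm by measurable
  show "integrable lborel (dd d H)"
    by (rule integrable_dominated_convergence[where s="?q", OF m mq w]) (intro AE_I2 lim bound)+
  have "(\<lambda>n. LINT x|lborel. ?q n x) \<longlonglongrightarrow> (LINT x|lborel. dd d H x)"
    by (rule integral_dominated_convergence[where s="?q", OF m mq w]) (intro AE_I2 lim bound)+
  then show "(LINT x|lborel. dd d H x) = 0"
    unfolding q0 by (simp add: LIMSEQ_const_iff)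
qed

text \<open>The derivative along the infinitesimal rotation in the plane of a and b, known as an
  angular momentum operator.\<close>

definition rot :: "'a::euclidean_space \<Rightarrow> 'a \<Rightarrow> ('a \<Rightarrow> real) \<Rightarrow> 'a \<Rightarrow> real" where
  "rot a b f x = (x \<bullet> a) * dd b f x - (x \<bullet> b) * dd a f x"

lemma smooth_on_rot: "open U \<Longrightarrow> smooth_on f U \<Longrightarrow> smooth_on (rot a b f) U"
  unfolding rot_def[abs_def] by (intro smooth_on_diff smooth_on_mult smooth_on_dd smooth_on_inner_right)

lemma has_derivative_sgn:
  fixes x :: "'a::euclidean_space"
  assumes "x \<noteq> 0"
  shows "(sgn has_derivative (\<lambda>d. d /\<^sub>R norm x - ((x \<bullet> d) / norm x ^ 3) *\<^sub>R x)) (at x)"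
proof -
  have n: "(norm has_derivative (\<lambda>d. d \<bullet> sgn x)) (at x)"
    using assms by (rule has_derivative_norm)
  have "((\<lambda>x. inverse (norm x)) has_derivative
      (\<lambda>d. - (inverse (norm x) * (d \<bullet> sgn x) * inverse (norm x)))) (at x)"
    by (rule Deriv.has_derivative_inverse[OF _ n]) (use assms in auto)
  from has_derivative_scaleR[OF this has_derivative_ident]
  have "((\<lambda>x. x /\<^sub>R norm x) has_derivative
     (\<lambda>d. inverse (norm x) *\<^sub>R d + (- (inverse (norm x) * (d \<bullet> sgn x) * inverse (norm x))) *\<^sub>R x)) (at x)" .
  moreover have "inverse (norm x) * (d \<bullet> sgn x) * inverse (norm x) = (x \<bullet> d) / norm x ^ 3" for d
    by (simp add: sgn_div_norm inner_commute divide_simps power3_eq_cube)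
  ultimately have "((\<lambda>x. x /\<^sub>R norm x) has_derivative
     (\<lambda>d. inverse (norm x) *\<^sub>R d + (- ((x \<bullet> d) / norm x ^ 3)) *\<^sub>R x)) (at x)"
    by simp
  moreover have "(\<lambda>d. inverse (norm x) *\<^sub>R d + (- ((x \<bullet> d) / norm x ^ 3)) *\<^sub>R x) =
      (\<lambda>d. d /\<^sub>R norm x - ((x \<bullet> d) / norm x ^ 3) *\<^sub>R x)"
    by simp
  moreover have "(\<lambda>x::'a. x /\<^sub>R norm x) = sgn"
    by (simp add: sgn_div_norm fun_eq_iff)
  ultimately show ?thesis by simp
qed

lemma continuous_on_sgn_ne: "continuous_on (- {0}) (sgn :: 'a::euclidean_space \<Rightarrow> 'a)"
  by (auto intro!: continuous_at_imp_continuous_on has_derivative_continuous has_derivative_sgn)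


text \<open>Squaring the positive part makes it continuously differentiable, which is the regularity
  required of the radial cutoffs.\<close>

lemma DERIV_max_0_square: "DERIV (\<lambda>z::real. (max 0 z)\<^sup>2) z :> 2 * max 0 z"
proof -
  consider "z < 0" | "z > 0" | "z = 0" by linarith
  then show ?thesis
  proof cases
    case 1
    have "DERIV (\<lambda>z::real. 0) z :> 0" by simp
    moreover have "\<forall>\<^sub>F y in nhds z. 0 = (max 0 y)\<^sup>2"
      using eventually_nhds_in_open[of "{..<0}" z] 1 by (auto elim!: eventually_mono)
    ultimately show ?thesis using 1 by (subst (asm) DERIV_cong_ev[OF refl _ refl]) auto
  next
    case 2
    have "DERIV (\<lambda>z::real. z\<^sup>2) z :> 2 * z" by (auto intro!: derivative_eq_intros)
    moreover have "\<forall>\<^sub>F y in nhds z. y\<^sup>2 = (max 0 y)\<^sup>2"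
      using eventually_nhds_in_open[of "{0<..}" z] 2 by (auto elim!: eventually_mono)
    ultimately show ?thesis using 2 by (subst (asm) DERIV_cong_ev[OF refl _ refl]) auto
  next
    case 3
    have "((\<lambda>h. (max 0 h)\<^sup>2 / h) \<longlongrightarrow> (0::real)) (at 0)"
    proof (rule Lim_null_comparison)
      show "\<forall>\<^sub>F h in at 0. norm ((max 0 h)\<^sup>2 / h) \<le> \<bar>h::real\<bar>"
        by (intro always_eventually) (auto simp: max_def power2_eq_square)
      show "((\<lambda>h. \<bar>h::real\<bar>) \<longlongrightarrow> 0) (at 0)" by (intro tendsto_eq_intros | simp)+
    qed
    then show ?thesis using 3 by (simp add: DERIV_def)
  qed
qed

lemma dd_sgn_compose:
  fixes F :: "'a::euclidean_space \<Rightarrow> real"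
  assumes U: "smooth_on F U" "sphere 0 1 \<subseteq> U" and x: "x \<noteq> 0"
  shows "(\<lambda>x. F (sgn x)) differentiable (at x)"
    "dd d (\<lambda>x. F (sgn x)) x = dd (d /\<^sub>R norm x - ((x \<bullet> d) / norm x ^ 3) *\<^sub>R x) F (sgn x)"
proof -
  have "sgn x \<in> U" using U(2) x by (auto simp: norm_sgn)
  then have "((\<lambda>x. F (sgn x)) has_derivative
      (\<lambda>d. dd (d /\<^sub>R norm x - ((x \<bullet> d) / norm x ^ 3) *\<^sub>R x) F (sgn x))) (at x)"
    using has_derivative_compose[OF has_derivative_sgn[OF x] smooth_on_has_derivative[OF U(1)]] by blast
  then show "(\<lambda>x. F (sgn x)) differentiable (at x)"
    "dd d (\<lambda>x. F (sgn x)) x = dd (d /\<^sub>R norm x - ((x \<bullet> d) / norm x ^ 3) *\<^sub>R x) F (sgn x)"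
    by (auto simp: differentiable_def dd_eq)
qed

lemma continuous_on_dd_sgn_compose:
  fixes F :: "'a::euclidean_space \<Rightarrow> real"
  assumes U: "smooth_on F U" "sphere 0 1 \<subseteq> U"
  shows "continuous_on (- {0}) (\<lambda>x. F (sgn x))" "continuous_on (- {0}) (dd d (\<lambda>x. F (sgn x)))"
proof -
  have img: "sgn ` (- {0::'a}) \<subseteq> U"
  proof -
    have "sgn ` (- {0::'a}) \<subseteq> sphere 0 1" by (auto simp: norm_sgn split: if_splits)
    with U(2) show ?thesis by blast
  qed
  have comp: "continuous_on (- {0}) (\<lambda>x. G (sgn x))" if "smooth_on G U" for G :: "'a \<Rightarrow> real"
    by (rule continuous_on_compose2[OF smooth_on_continuous[OF that] continuous_on_sgn_ne img])
  show "continuous_on (- {0}) (\<lambda>x. F (sgn x))" by (rule comp[OF U(1)])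
  have "continuous_on (- {0}) (\<lambda>x. \<Sum>b\<in>Basis.
      ((d /\<^sub>R norm x - ((x \<bullet> d) / norm x ^ 3) *\<^sub>R x) \<bullet> b) * dd b F (sgn x))"
    by (intro continuous_intros comp smooth_on_dd U(1)) auto
  moreover have "dd d (\<lambda>x. F (sgn x)) x = (\<Sum>b\<in>Basis.
      ((d /\<^sub>R norm x - ((x \<bullet> d) / norm x ^ 3) *\<^sub>R x) \<bullet> b) * dd b F (sgn x))" if "x \<noteq> 0" for x
  proof -
    have "sgn x \<in> U" using img that by blast
    then show ?thesis
      using dd_sgn_compose(2)[OF U that] dd_expand[OF smooth_on_differentiable[OF U(1)]] by simp
  qed
  moreover have "continuous_on (- {0}) (dd d (\<lambda>x. F (sgn x))) \<longleftrightarrow> continuous_on (- {0}) (\<lambda>x. \<Sum>b\<in>Basis.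
      ((d /\<^sub>R norm x - ((x \<bullet> d) / norm x ^ 3) *\<^sub>R x) \<bullet> b) * dd b F (sgn x))"
    by (rule continuous_on_cong[OF refl]) (use calculation(2) in auto)
  ultimately show "continuous_on (- {0}) (dd d (\<lambda>x. F (sgn x)))" by blast
qed

text \<open>The derivative of \<open>sgn\<close> removes the radial part of a direction and divides
  by \<open>norm x\<close>. The radial corrections cancel in the antisymmetric combination, and the
  factor 1 / \<open>norm x\<close> turns the coefficients x \<bullet> a and x \<bullet> b into those
  at \<open>sgn x\<close>.\<close>

lemma rot_sgn_compose:
  fixes F :: "'a::euclidean_space \<Rightarrow> real"
  assumes U: "smooth_on F U" "sphere 0 1 \<subseteq> U" and x: "x \<noteq> 0"
  shows "rot a b (\<lambda>x. F (sgn x)) x = rot a b F (sgn x)"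
proof -
  have y: "sgn x \<in> U" using U(2) x by (auto simp: norm_sgn)
  have lin: "linear (\<lambda>d. dd d F (sgn x))"
    using smooth_on_has_derivative[OF U(1) y] has_derivative_linear by blast
  have e: "dd (d /\<^sub>R norm x - c *\<^sub>R x) F (sgn x) = dd d F (sgn x) / norm x - c * dd x F (sgn x)" for d c
    using linear_diff[OF lin] linear_cmul[OF lin] by (simp add: divide_inverse mult.commute)
  show ?thesis
    using x by (simp add: rot_def dd_sgn_compose(2)[OF U x] e) (simp add: sgn_div_norm field_simps)
qed

text \<open>
  The field \<open>rot a b\<close> is tangential, so it commutes with radial cutoffs and, being divergence free,
  integrates to 0 over the space. Letting the cutoffs increase to the indicator of the unit ball
  gives the same over the sphere.
\<close>

lemma integral_radial_rot_eq_0: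
  fixes F :: "'a::euclidean_space \<Rightarrow> real" and \<zeta> \<zeta>' :: "real \<Rightarrow> real"
  assumes U: "smooth_on F U" "sphere 0 1 \<subseteq> U" and ab: "a \<in> Basis" "b \<in> Basis" "a \<noteq> b"
    and \<zeta>: "\<And>s. DERIV \<zeta> s :> \<zeta>' s" "continuous_on UNIV \<zeta>'"
    and \<alpha>: "0 < \<alpha>" "\<And>s. s \<le> \<alpha> \<Longrightarrow> \<zeta> s = 0" "\<And>s. 1 \<le> s \<Longrightarrow> \<zeta> s = 0"
  shows "(LINT x|lborel. \<zeta> (x \<bullet> x) * rot a b F (sgn x)) = 0"
proof -
  let ?g = "\<lambda>x. F (sgn x)"
  define H where "H c x = (x \<bullet> c) * (\<zeta> (x \<bullet> x) * F (sgn x))" for c x :: 'a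
  have \<zeta>d: "((\<lambda>x. \<zeta> (x \<bullet> x)) has_derivative (\<lambda>d. \<zeta>' (x \<bullet> x) * (2 * (x \<bullet> d)))) (at x)" for x :: 'a
  proof -
    have "((\<lambda>x. x \<bullet> x) has_derivative (\<lambda>d. 2 * (x \<bullet> d))) (at x)"
      by (auto intro!: derivative_eq_intros simp: inner_commute)
    from has_derivative_compose[OF this, of \<zeta> "\<lambda>h. \<zeta>' (x \<bullet> x) * h"] show ?thesis
      using \<zeta>(1) by (simp add: has_field_derivative_def)
  qed
  have Hd: "H c differentiable (at x)" "dd d (H c) x =
      (x \<bullet> c) * (\<zeta> (x \<bullet> x) * dd d ?g x + \<zeta>' (x \<bullet> x) * (2 * (x \<bullet> d)) * ?g x) + (d \<bullet> c) * (\<zeta> (x \<bullet> x) * ?g x)"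
    if "x \<noteq> 0" for c d x
  proof -
    have "(H c has_derivative (\<lambda>d. (x \<bullet> c) * (\<zeta> (x \<bullet> x) * dd d ?g x + \<zeta>' (x \<bullet> x) * (2 * (x \<bullet> d)) * ?g x)
        + (d \<bullet> c) * (\<zeta> (x \<bullet> x) * ?g x))) (at x)"
      unfolding H_def
      by (intro has_derivative_mult has_derivative_inner_left has_derivative_ident \<zeta>d has_derivative_dd
          dd_sgn_compose[OF U that])
    then show "H c differentiable (at x)" "dd d (H c) x =
      (x \<bullet> c) * (\<zeta> (x \<bullet> x) * dd d ?g x + \<zeta>' (x \<bullet> x) * (2 * (x \<bullet> d)) * ?g x) + (d \<bullet> c) * (\<zeta> (x \<bullet> x) * ?g x)"
      by (auto simp: differentiable_def dd_eq)
  qed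
  \<comment> \<open>The cutoff vanishes on this neighbourhood of the origin, so the singularity of
    \<open>sgn\<close> at 0 does not affect the differentiability of H.\<close>
  let ?V = "{x::'a. x \<bullet> x < \<alpha>}"
  have V: "open ?V" by (intro open_Collect_less continuous_intros)
  have HV: "0 = H c x" if "x \<in> ?V" for c x using that \<alpha>(2) by (simp add: H_def)
  have Hdiff: "H c differentiable (at x)" for c x
  proof (cases "x = 0")
    case True
    then show ?thesis
      using differentiable_cong_open[OF V, of x "\<lambda>_. 0" "H c"] HV \<alpha>(1) by simp
  qed (rule Hd)
  have ddV: "0 = dd d (H c) x" if "x \<in> ?V" for c d x
    using dd_cong_open[OF V that, of "\<lambda>_. 0" "H c" d] HV by simp
  have Hcont: "continuous_on UNIV (dd d (H c))" for c d
  proof -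
    have "continuous_on ?V (dd d (H c))"
      using ddV continuous_on_cong[OF refl, of ?V "\<lambda>_. 0" "dd d (H c)"] by auto
    moreover have "continuous_on (- {0}) (dd d (H c))"
    proof -
      have z: "continuous_on (-{0}) (\<lambda>x::'a. \<zeta> (x \<bullet> x))"
        by (rule has_derivative_continuous_on[OF has_derivative_at_withinI[OF \<zeta>d]])
      have z': "continuous_on (-{0}) (\<lambda>x::'a. \<zeta>' (x \<bullet> x))"
        by (rule continuous_on_compose2[OF \<zeta>(2)]) (auto intro!: continuous_intros)
      have "continuous_on (-{0}) (\<lambda>x. (x \<bullet> c) * (\<zeta> (x \<bullet> x) * dd d ?g x + \<zeta>' (x \<bullet> x) * (2 * (x \<bullet> d)) * ?g x)
          + (d \<bullet> c) * (\<zeta> (x \<bullet> x) * ?g x))"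
        by (intro continuous_on_add continuous_on_mult continuous_on_inner continuous_on_const
            continuous_on_id z z' continuous_on_dd_sgn_compose[OF U])
      moreover have "continuous_on (-{0}) (dd d (H c)) \<longleftrightarrow> continuous_on (-{0})
          (\<lambda>x. (x \<bullet> c) * (\<zeta> (x \<bullet> x) * dd d ?g x + \<zeta>' (x \<bullet> x) * (2 * (x \<bullet> d)) * ?g x)
            + (d \<bullet> c) * (\<zeta> (x \<bullet> x) * ?g x))"
        by (rule continuous_on_cong[OF refl]) (use Hd(2) in auto)
      ultimately show ?thesis by blast
    qed
    moreover have "UNIV = ?V \<union> - {0}" using \<alpha>(1) by auto
    ultimately show ?thesis using continuous_on_open_Un[OF V, of "-{0}"] by auto
  qed
  have Hsupp: "H c x = 0" if "1 \<le> norm x" for c x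
  proof -
    have "1 \<le> x \<bullet> x" using that by (simp add: power2_norm_eq_inner[symmetric])
    then show ?thesis using \<alpha>(3) by (simp add: H_def)
  qed
  have eq: "\<zeta> (x \<bullet> x) * rot a b F (sgn x) = dd b (H a) x - dd a (H b) x" for x
  proof (cases "x = 0")
    case True
    then show ?thesis using ddV[of x b a] ddV[of x a b] \<alpha> by simp
  next
    case False
    have "a \<bullet> b = 0" using ab inner_not_same_Basis by blast
    have "\<zeta> (x \<bullet> x) * rot a b F (sgn x) = \<zeta> (x \<bullet> x) * rot a b ?g x"
      by (simp only: rot_sgn_compose[OF U False])
    also have "\<dots> = dd b (H a) x - dd a (H b) x"
      using False \<open>a \<bullet> b = 0\<close> by (simp add: Hd(2) rot_def inner_commute algebra_simps)
    finally show ?thesis .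
  qed
  show ?thesis
    unfolding eq using integral_dd_eq_0[OF Hdiff Hcont Hsupp] by simp
qed

text \<open>The argument s stands for x \<bullet> x. With w the positive part of (s - 1/(j+2)) (1 -
  s), the square of w lies in (0, 1] strictly between the two zeros, so 1 - (1 - w^2)^j is
  continuously differentiable, supported in the open unit ball away from the origin, and close to 1
  for large j. The summand 2 keeps the inner zero below 1 also for j = 0.\<close>

definition cutoff :: "nat \<Rightarrow> real \<Rightarrow> real" where
  "cutoff j s = 1 - (1 - (max 0 ((s - 1 / real (j + 2)) * (1 - s)))\<^sup>2) ^ j"

lemma cutoff_eq_0: "s \<le> 1 / real (j + 2) \<Longrightarrow> cutoff j s = 0" "1 \<le> s \<Longrightarrow> cutoff j s = 0"
proof -
  assume "s \<le> 1 / real (j + 2)"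
  moreover have "1 / real (j + 2) \<le> 1" by simp
  ultimately have "(s - 1 / real (j + 2)) * (1 - s) \<le> 0" by (intro mult_nonpos_nonneg) linarith+
  then show "cutoff j s = 0" unfolding cutoff_def by (subst max_absorb1) auto
next
  assume "1 \<le> s"
  moreover have "1 / real (j + 2) \<le> 1" by simp
  ultimately have "(s - 1 / real (j + 2)) * (1 - s) \<le> 0" by (intro mult_nonneg_nonpos) linarith+
  then show "cutoff j s = 0" unfolding cutoff_def by (subst max_absorb1) auto
qed

lemma cutoff_bounds: "0 \<le> cutoff j s" "cutoff j s \<le> 1"
proof -
  have "0 \<le> cutoff j s \<and> cutoff j s \<le> 1"
  proof (cases "1 / real (j + 2) \<le> s \<and> s \<le> 1")
    case True
    have "0 < 1 / real (j + 2)" by simp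
    with True have s: "0 \<le> s - 1 / real (j + 2)" "s - 1 / real (j + 2) \<le> 1" "0 \<le> 1 - s" "1 - s \<le> 1"
      by linarith+
    then have "(s - 1 / real (j + 2)) * (1 - s) \<le> 1 * 1" by (intro mult_mono) auto
    moreover have "0 \<le> (s - 1 / real (j + 2)) * (1 - s)"
      using True by (intro mult_nonneg_nonneg) auto
    ultimately have "(max 0 ((s - 1 / real (j + 2)) * (1 - s)))\<^sup>2 \<le> 1"
      by (auto simp: abs_square_le_1)
    then show ?thesis unfolding cutoff_def by (auto intro!: power_le_one)
  next
    case False
    then show ?thesis using cutoff_eq_0[of s j] by force
  qed
  then show "0 \<le> cutoff j s" "cutoff j s \<le> 1" by auto
qed

text \<open>As soon as 1/(j+2) < s/2, the base 1 - w^2 is at most 1 - c with a positive c that does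
  not depend on j, so its j-th power tends to 0.\<close>

lemma cutoff_tendsto:
  assumes "0 < s" "s < 1"
  shows "(\<lambda>j. cutoff j s) \<longlonglongrightarrow> 1"
proof -
  define c where "c = (s / 2 * (1 - s))\<^sup>2"
  have c0: "0 < s / 2 * (1 - s)" using assms by simp
  have "s / 2 * (1 - s) \<le> 1 * 1" using assms by (intro mult_mono) auto
  then have c: "0 < c" "c \<le> 1" using c0 by (auto simp: c_def abs_square_le_1)
  have "(\<lambda>j. 1 - cutoff j s) \<longlonglongrightarrow> 0"
  proof (rule tendsto_sandwich[of "\<lambda>_. 0" _ _ "\<lambda>j. (1 - c) ^ j"])
    show "\<forall>\<^sub>F j in sequentially. 0 \<le> 1 - cutoff j s" using cutoff_bounds by simp
    have "(\<lambda>j. 1 / real (j + 2)) \<longlonglongrightarrow> 0" by real_asymp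
    then have "\<forall>\<^sub>F j in sequentially. 1 / real (j + 2) < s / 2"
      using assms by (intro order_tendstoD) auto
    then show "\<forall>\<^sub>F j in sequentially. 1 - cutoff j s \<le> (1 - c) ^ j"
    proof eventually_elim
      case (elim j)
      let ?w = "(s - 1 / real (j + 2)) * (1 - s)"
      have w: "s / 2 * (1 - s) \<le> ?w" using elim assms by (intro mult_right_mono) auto
      have "0 < 1 / real (j + 2)" by simp
      with elim assms have "0 \<le> s - 1 / real (j + 2)" "s - 1 / real (j + 2) \<le> 1" "0 \<le> 1 - s" "1 - s \<le> 1"
        by linarith+
      then have "?w \<le> 1 * 1" by (intro mult_mono) auto
      moreover have "0 \<le> ?w" using w c0 by linarith
      ultimately have "?w\<^sup>2 \<le> 1\<^sup>2" by (intro power_mono) linarith+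
      then have "?w\<^sup>2 \<le> 1" by simp
      moreover have "c \<le> ?w\<^sup>2" unfolding c_def using w c0 by (intro power_mono) auto
      moreover have "max 0 ?w = ?w" using w c0 by (intro max_absorb2) linarith
      ultimately show ?case unfolding cutoff_def by (simp only:) (auto intro!: power_mono)
    qed
    show "(\<lambda>j. (1 - c) ^ j) \<longlonglongrightarrow> 0" using c by (intro LIMSEQ_power_zero) auto
  qed auto
  from tendsto_diff[OF tendsto_const[of 1] this] show ?thesis by simp
qed

lemma DERIV_cutoff: "\<exists>\<zeta>'. (\<forall>s. DERIV (cutoff j) s :> \<zeta>' s) \<and> continuous_on UNIV \<zeta>'"
proof -
  let ?w = "\<lambda>s. (s - 1 / real (j + 2)) * (1 - s)"
  have d: "DERIV (\<lambda>s. (max 0 (?w s))\<^sup>2) s :> 2 * max 0 (?w s) * (1 + 1 / real (j + 2) - 2 * s)" for s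
  proof -
    have "DERIV ?w s :> 1 + 1 / real (j + 2) - 2 * s"
      by (auto intro!: derivative_eq_intros simp del: of_nat_add)
    from DERIV_chain2[OF DERIV_max_0_square this] show ?thesis .
  qed
  have "DERIV (cutoff j) s :> real j * (1 - (max 0 (?w s))\<^sup>2) ^ (j - 1) *
      (2 * max 0 (?w s) * (1 + 1 / real (j + 2) - 2 * s))" for s
    unfolding cutoff_def[abs_def]
    by (rule derivative_eq_intros refl d)+ (simp del: of_nat_add)
  moreover have "continuous_on UNIV (\<lambda>s. real j * (1 - (max 0 (?w s))\<^sup>2) ^ (j - 1) *
      (2 * max 0 (?w s) * (1 + 1 / real (j + 2) - 2 * s)))"
    by (intro continuous_intros) 
  ultimately show ?thesis by (intro exI conjI allI)
qed

lemma integral_rot_eq_0: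
  fixes F :: "'a::euclidean_space \<Rightarrow> real"
  assumes op: "open U" and U: "smooth_on F U" "sphere 0 1 \<subseteq> U" and ab: "a \<in> Basis" "b \<in> Basis"
  shows "(LINT x|sphere_measure. rot a b F x) = 0"
proof (cases "a = b")
  case True
  then show ?thesis by (simp add: rot_def)
next
  case False
  have cont: "continuous_on (sphere 0 1) (rot a b F)"
    using smooth_on_continuous[OF smooth_on_rot[OF op U(1)]] U(2) continuous_on_subset by blast
  obtain B where B: "0 < B" "\<And>x. norm x = 1 \<Longrightarrow> \<bar>rot a b F x\<bar> \<le> B"
    using continuous_on_sphere_bounded[OF cont] by blast
  have zero: "(LINT x|lborel. cutoff j (x \<bullet> x) * rot a b F (sgn x)) = 0" for j
  proof -
    obtain \<zeta>' where z: "\<And>s. DERIV (cutoff j) s :> \<zeta>' s" "continuous_on UNIV \<zeta>'"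
      using DERIV_cutoff by blast
    have p: "0 < 1 / real (j + 2)" by simp
    show ?thesis by (rule integral_radial_rot_eq_0[OF U ab False z p cutoff_eq_0])
  qed
  have m: "(\<lambda>x. indicator (ball 0 1 - {0}) x * rot a b F (sgn x)) \<in> borel_measurable borel"
  proof -
    have "continuous_on (-{0}) (\<lambda>x. rot a b F (sgn x))"
      by (rule continuous_on_compose2[OF cont continuous_on_sgn_ne]) (auto simp: norm_sgn split: if_splits)
    then have "(\<lambda>x. indicator (-{0}) x *\<^sub>R rot a b F (sgn x)) \<in> borel_measurable borel"
      by (intro borel_measurable_continuous_on_indicator) auto
    then have "(\<lambda>x. indicator (ball 0 1) x * (indicator (-{0}) x *\<^sub>R rot a b F (sgn x))) \<in> borel_measurable borel"
      by (intro borel_measurable_times borel_measurable_indicator) auto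
    moreover have "(\<lambda>x. indicator (ball 0 1) x * (indicator (-{0}) x *\<^sub>R rot a b F (sgn x))) =
        (\<lambda>x. indicator (ball 0 1 - {0}) x * rot a b F (sgn x))"
      by (simp add: indicator_def fun_eq_iff)
    ultimately show ?thesis by simp
  qed
  \<comment> \<open>The cutoff vanishes at the origin and outside the ball, so the indicator may be
    inserted. This yields both the measurability and the integrable majorant.\<close>
  have ind: "cutoff j (x \<bullet> x) * rot a b F (sgn x) =
      cutoff j (x \<bullet> x) * (indicator (ball 0 1 - {0}) x * rot a b F (sgn x))" for j x
  proof (cases "x \<in> ball 0 1 - {0}")
    case False
    then have "x \<bullet> x = 0 \<or> 1 \<le> x \<bullet> x"
      by (auto simp: power2_norm_eq_inner[symmetric])
    then show ?thesis using cutoff_eq_0[of "x \<bullet> x" j] by fastforce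
  qed simp
  have cm: "(\<lambda>x::'a. cutoff j (x \<bullet> x)) \<in> borel_measurable borel" for j
    unfolding cutoff_def by measurable
  have w: "integrable lborel (\<lambda>x. B * indicator (ball (0::'a) 1) x)"
    by (intro integrable_mult_right integrable_real_indicator) (use emeasure_lborel_ball_finite in auto)
  have "(\<lambda>j. LINT x|lborel. cutoff j (x \<bullet> x) * rot a b F (sgn x)) \<longlonglongrightarrow>
      (LINT x|lborel. indicator (ball 0 1 - {0}) x * rot a b F (sgn x))"
  proof (rule integral_dominated_convergence[OF _ _ w])
    show "(\<lambda>x. indicator (ball 0 1 - {0}) x * rot a b F (sgn x)) \<in> borel_measurable lborel" using m by simp
    show "(\<lambda>x. cutoff j (x \<bullet> x) * rot a b F (sgn x)) \<in> borel_measurable lborel" for j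
      unfolding ind using m cm[of j] by simp
    show "AE x in lborel. (\<lambda>j. cutoff j (x \<bullet> x) * rot a b F (sgn x)) \<longlonglongrightarrow>
        indicator (ball 0 1 - {0}) x * rot a b F (sgn x)"
    proof (rule AE_I2)
      fix x :: 'a
      show "(\<lambda>j. cutoff j (x \<bullet> x) * rot a b F (sgn x)) \<longlonglongrightarrow> indicator (ball 0 1 - {0}) x * rot a b F (sgn x)"
      proof (cases "x \<in> ball 0 1 - {0}")
        case True
        then have "0 < x \<bullet> x" "x \<bullet> x < 1"
          by (auto simp: power2_norm_eq_inner[symmetric] power_less_one_iff abs_square_less_1)
        from tendsto_mult_right[OF cutoff_tendsto[OF this], of "rot a b F (sgn x)"] True
        show ?thesis by simp
      next
        case False
        then show ?thesis unfolding ind by simp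
      qed
    qed
    show "AE x in lborel. norm (cutoff j (x \<bullet> x) * rot a b F (sgn x)) \<le> B * indicator (ball 0 1) x" for j
    proof (rule AE_I2)
      fix x :: 'a
      show "norm (cutoff j (x \<bullet> x) * rot a b F (sgn x)) \<le> B * indicator (ball 0 1) x"
      proof (cases "x \<in> ball 0 1 - {0}")
        case True
        have "\<bar>cutoff j (x \<bullet> x)\<bar> * \<bar>rot a b F (sgn x)\<bar> \<le> 1 * B"
          using cutoff_bounds[of j "x \<bullet> x"] True by (intro mult_mono B) (auto simp: norm_sgn)
        then show ?thesis using True by (simp add: abs_mult)
      next
        case False
        then show ?thesis unfolding ind using B(1) by (simp add: indicator_def)
      qed
    qed
  qed
  then have "(LINT x|lborel. indicator (ball 0 1 - {0}) x * rot a b F (sgn x)) = 0"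
    unfolding zero by (simp add: LIMSEQ_const_iff)
  then show ?thesis by (simp add: integral_sphere_measure[OF borel_measurable_sphere[OF cont]])
qed

lemma integral_rot_by_parts:
  fixes F :: "'a::euclidean_space \<Rightarrow> real"
  assumes U: "open U" "sphere 0 1 \<subseteq> U" "smooth_on F U" "smooth_on G U" and ab: "a \<in> Basis" "b \<in> Basis"
  shows "(LINT x|sphere_measure. rot a b F x * G x) = - (LINT x|sphere_measure. F x * rot a b G x)"
proof -
  have c: "continuous_on (sphere 0 1) h" if "smooth_on h U" for h :: "'a \<Rightarrow> real"
    using smooth_on_continuous[OF that] U(2) continuous_on_subset by blast
  have "rot a b (\<lambda>x. F x * G x) x = rot a b F x * G x + F x * rot a b G x" if "norm x = 1" for x
  proof -
    have "x \<in> U" using that U(2) by auto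
    then show ?thesis using U
      by (simp add: rot_def dd_mult smooth_on_differentiable algebra_simps)
  qed
  then have "(LINT x|sphere_measure. rot a b F x * G x + F x * rot a b G x) =
      (LINT x|sphere_measure. rot a b (\<lambda>x. F x * G x) x)"
    by (intro integral_sphere_cong) auto
  also have "\<dots> = 0"
    by (rule integral_rot_eq_0[OF U(1) smooth_on_mult[OF U(1,3,4)] U(2) ab])
  finally show ?thesis
    using U by (subst (asm) Bochner_Integration.integral_add)
      (auto intro!: integrable_sphere c smooth_on_mult smooth_on_rot)
qed

text \<open>On the sphere this is twice the Laplace--Beltrami operator: the sum runs over ordered
  pairs and so counts every coordinate plane twice.\<close>

definition slap :: "('a::euclidean_space \<Rightarrow> real) \<Rightarrow> 'a \<Rightarrow> real" where
  "slap f x = (\<Sum>a\<in>Basis. \<Sum>b\<in>Basis. rot a b (rot a b f) x)"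

lemma smooth_on_slap: "open U \<Longrightarrow> smooth_on f U \<Longrightarrow> smooth_on (slap f) U"
  unfolding slap_def[abs_def] by (intro smooth_on_sum smooth_on_rot)

lemma integral_slap_symmetric:
  fixes F :: "'a::euclidean_space \<Rightarrow> real"
  assumes U: "open U" "sphere 0 1 \<subseteq> U" "smooth_on F U" "smooth_on G U"
  shows "(LINT x|sphere_measure. slap F x * G x) = (LINT x|sphere_measure. F x * slap G x)"
proof -
  have c: "continuous_on (sphere 0 1) h" if "smooth_on h U" for h :: "'a \<Rightarrow> real"
    using smooth_on_continuous[OF that] U(2) continuous_on_subset by blast
  have i: "integrable sphere_measure (\<lambda>x. f x * g x)" if "smooth_on f U" "smooth_on g U" for f g :: "'a \<Rightarrow> real"
    by (intro integrable_sphere continuous_on_mult c that)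
  have "(LINT x|sphere_measure. rot a b (rot a b F) x * G x) =
      (LINT x|sphere_measure. F x * rot a b (rot a b G) x)" if "a \<in> Basis" "b \<in> Basis" for a b
    using integral_rot_by_parts[OF U(1,2) smooth_on_rot[OF U(1,3)] U(4) that]
      integral_rot_by_parts[OF U(1,2,3) smooth_on_rot[OF U(1,4)] that] by simp
  then show ?thesis
    by (simp add: slap_def sum_distrib_left sum_distrib_right i U smooth_on_rot)
qed

section \<open>Spherical harmonics and zonal kernels\<close>

lemma laplacian_eq_dd: "laplacian f x = (\<Sum>b\<in>Basis. dd b (dd b f) x)"
  by (simp add: laplacian_def dd_def[abs_def])

lemma smooth_on_UNIV_differentiable [simp]: "smooth_on f UNIV \<Longrightarrow> f differentiable (at x)"
  by (simp add: smooth_on_differentiable)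

lemma smooth_on_norm_square [simp]: "smooth_on (\<lambda>x::'a::euclidean_space. x \<bullet> x) UNIV"
proof -
  have "smooth_on (\<lambda>x::'a. \<Sum>b\<in>Basis. (x \<bullet> b) * (x \<bullet> b)) UNIV"
    by (intro smooth_on_sum smooth_on_mult) auto
  then show ?thesis by (simp add: euclidean_inner[symmetric])
qed

lemma dd_norm_square [simp]: "dd d (\<lambda>x. x \<bullet> x) x = 2 * (x \<bullet> d)"
  by (rule dd_eq) (auto intro!: derivative_eq_intros simp: inner_commute)

lemma dd_inner_mult:
  "smooth_on f UNIV \<Longrightarrow> dd d (\<lambda>x. (x \<bullet> y) * f x) = (\<lambda>x. (x \<bullet> y) * dd d f x + (d \<bullet> y) * f x)"
  by (rule ext) (simp add: dd_mult)

lemma dd_norm_square_mult: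
  "smooth_on f UNIV \<Longrightarrow> dd d (\<lambda>x. (x \<bullet> x) * f x) = (\<lambda>x. (x \<bullet> x) * dd d f x + (x \<bullet> d) * (2 * f x))"
  by (rule ext) (simp add: dd_mult)

lemma dd_const_mult: "f differentiable (at x) \<Longrightarrow> dd d (\<lambda>x. c * f x) x = c * dd d f x"
  by (simp add: dd_mult)

lemma smooth_on_const_mult: "open U \<Longrightarrow> smooth_on f U \<Longrightarrow> smooth_on (\<lambda>x. c * f x) U"
  by (intro smooth_on_mult smooth_on_const)

lemma laplacian_add:
  assumes "smooth_on f UNIV" "smooth_on g UNIV"
  shows "laplacian (\<lambda>x. f x + g x) x = laplacian f x + laplacian g x"
proof -
  have "dd b (\<lambda>x. f x + g x) = (\<lambda>x. dd b f x + dd b g x)" for b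
    using assms by (auto simp: dd_add)
  then show ?thesis using assms by (simp add: laplacian_eq_dd dd_add smooth_on_dd sum.distrib)
qed

lemma laplacian_const_mult:
  assumes "smooth_on f UNIV"
  shows "laplacian (\<lambda>x. c * f x) x = c * laplacian f x"
proof -
  have "dd b (\<lambda>x. c * f x) = (\<lambda>x. c * dd b f x)" for b
    using assms by (auto simp: dd_const_mult)
  then show ?thesis using assms by (simp add: laplacian_eq_dd dd_const_mult smooth_on_dd sum_distrib_left)
qed

lemma laplacian_diff:
  assumes "smooth_on f UNIV" "smooth_on g UNIV"
  shows "laplacian (\<lambda>x. f x - g x) x = laplacian f x - laplacian g x"
  using laplacian_add[OF assms(1) smooth_on_const_mult[OF open_UNIV assms(2), of "-1"]]
    laplacian_const_mult[OF assms(2), of "-1"] by simp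

text \<open>This and the next lemma compute the Laplacians of the two terms in the recurrence of
  \<open>gegen\<close>.\<close>

lemma laplacian_inner_mult:
  assumes "smooth_on f UNIV"
  shows "laplacian (\<lambda>x. (x \<bullet> y) * f x) x = 2 * dd y f x + (x \<bullet> y) * laplacian f x"
proof -
  have "dd b (dd b (\<lambda>x. (x \<bullet> y) * f x)) x = 2 * ((y \<bullet> b) * dd b f x) + (x \<bullet> y) * dd b (dd b f) x" for b
    using assms smooth_on_dd[OF assms]
    by (simp add: dd_inner_mult dd_add dd_const_mult smooth_on_mult inner_commute)
  then show ?thesis using assms
    by (simp add: laplacian_eq_dd sum.distrib sum_distrib_left[symmetric] dd_expand[of f x y])
qed

lemma laplacian_norm_square_mult:
  fixes f :: "'a::euclidean_space \<Rightarrow> real"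
  assumes "smooth_on f UNIV"
  shows "laplacian (\<lambda>x. (x \<bullet> x) * f x) x = 2 * DIM('a) * f x + 4 * dd x f x + (x \<bullet> x) * laplacian f x"
proof -
  have "dd b (dd b (\<lambda>x. (x \<bullet> x) * f x)) x = 2 * f x + 4 * ((x \<bullet> b) * dd b f x) + (x \<bullet> x) * dd b (dd b f) x"
    if "b \<in> Basis" for b
    using assms smooth_on_dd[OF assms] that
    by (simp add: dd_norm_square_mult dd_add dd_const_mult smooth_on_mult dd_mult)
  then show ?thesis using assms
    by (simp add: laplacian_eq_dd sum.distrib sum_distrib_left[symmetric] dd_expand[of f x x])
qed

lemma euler_homogeneous:
  fixes f :: "'a::euclidean_space \<Rightarrow> real"
  assumes "f differentiable (at x)" "\<And>t x. f (t *\<^sub>R x) = t ^ k * f x"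
  shows "dd x f x = real k * f x"
proof -
  have "((\<lambda>t. f (t *\<^sub>R x)) has_derivative (\<lambda>h. dd (h *\<^sub>R x) f (1 *\<^sub>R x))) (at (1::real))"
    by (rule has_derivative_compose[OF _ has_derivative_dd]) (use assms in \<open>auto intro!: derivative_eq_intros\<close>)
  moreover have "dd (h *\<^sub>R x) f x = dd x f x * h" for h
    using linear_cmul[OF has_derivative_linear[OF has_derivative_dd[OF assms(1)]]] by simp
  ultimately have "DERIV (\<lambda>t. f (t *\<^sub>R x)) 1 :> dd x f x"
    by (simp add: has_field_derivative_def)
  moreover have "DERIV (\<lambda>t. t ^ k * f x) 1 :> real k * f x"
    by (auto intro!: derivative_eq_intros)
  ultimately show ?thesis using assms(2) DERIV_unique by simp
qed

lemma spherical_harmonicsD: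
  assumes "h \<in> spherical_harmonics k"
  shows "real_polynomial_function h" "h (t *\<^sub>R x) = t ^ k * h x" "laplacian h x = 0" "smooth_on h UNIV"
  using assms smooth_on_polynomial unfolding spherical_harmonics_def by auto

text \<open>Expanding the double rotations gives twice the Laplacian of h, which is 0, twice the
  mixed second-order terms, and first-order terms that Euler's identity evaluates. With N the
  dimension of the space the total factor is 2 k - 2 N k - 2 k (k - 1).\<close>

lemma slap_spherical_harmonic:
  fixes h :: "'a::euclidean_space \<Rightarrow> real"
  assumes h: "h \<in> spherical_harmonics k" and x: "norm x = 1"
  shows "slap h x = - 2 * real k * (real k + real DIM('a) - 2) * h x"
proof -
  note s = spherical_harmonicsD(4)[OF h]
  have sd: "smooth_on (dd a h) UNIV" for a by (rule smooth_on_dd[OF s])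
  have rr: "rot a b (rot a b h) x =
      (x \<bullet> a) * (x \<bullet> a) * dd b (dd b h) x + (x \<bullet> b) * (x \<bullet> b) * dd a (dd a h) x
      + (a \<bullet> b) * (x \<bullet> a) * dd b h x + (a \<bullet> b) * (x \<bullet> b) * dd a h x
      - (x \<bullet> a) * dd a h x - (x \<bullet> b) * dd b h x
      - (x \<bullet> a) * (x \<bullet> b) * dd b (dd a h) x - (x \<bullet> b) * (x \<bullet> a) * dd a (dd b h) x"
    if "a \<in> Basis" "b \<in> Basis" for a b
  proof -
    have "dd c (rot a b h) x = (x \<bullet> a) * dd c (dd b h) x + (c \<bullet> a) * dd b h x
        - ((x \<bullet> b) * dd c (dd a h) x + (c \<bullet> b) * dd a h x)" for c
      using sd unfolding rot_def[abs_def] by (simp add: dd_diff dd_mult smooth_on_mult)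
    note d = this
    have "b \<bullet> b = 1" "a \<bullet> a = 1" "b \<bullet> a = a \<bullet> b" using that by (auto simp: inner_commute)
    then show ?thesis unfolding rot_def[of a b "rot a b h"] d by (simp only:) (simp add: algebra_simps)
  qed
  have E1: "(\<Sum>a\<in>Basis. (y \<bullet> a) * dd a h y) = real k * h y" for y
    using euler_homogeneous[of h y k] spherical_harmonicsD[OF h] dd_expand[of h y y] by simp
  \<comment> \<open>Euler's identity is differentiated once more along x; the product rule leaves an
    additional first-order sum, which is again given by \<open>E1\<close>.\<close>
  have E2: "(\<Sum>a\<in>Basis. \<Sum>b\<in>Basis. (x \<bullet> a) * (x \<bullet> b) * dd a (dd b h) x) = real k * (real k - 1) * h x"
  proof -
    have "(\<Sum>a\<in>Basis. (x \<bullet> a) * dd a (\<lambda>y. \<Sum>b\<in>Basis. (y \<bullet> b) * dd b h y) x) = real k * (real k * h x)"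
      unfolding E1 using s by (simp add: dd_const_mult sum_distrib_left[symmetric] mult.left_commute E1)
    moreover have "(x \<bullet> a) * dd a (\<lambda>y. \<Sum>b\<in>Basis. (y \<bullet> b) * dd b h y) x =
        (\<Sum>b\<in>Basis. (x \<bullet> a) * (x \<bullet> b) * dd a (dd b h) x) + (x \<bullet> a) * dd a h x" if "a \<in> Basis" for a
    proof -
      have "dd a (\<lambda>y. \<Sum>b\<in>Basis. (y \<bullet> b) * dd b h y) x =
          (\<Sum>b\<in>Basis. (x \<bullet> b) * dd a (dd b h) x + (a \<bullet> b) * dd b h x)"
        using sd by (simp add: dd_sum smooth_on_mult dd_mult)
      also have "\<dots> = (\<Sum>b\<in>Basis. (x \<bullet> b) * dd a (dd b h) x) + dd a h x"
        using s by (simp add: sum.distrib dd_expand[of h x a])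
      finally show ?thesis by (simp add: distrib_left sum_distrib_left mult.assoc)
    qed
    ultimately have "(\<Sum>a\<in>Basis. \<Sum>b\<in>Basis. (x \<bullet> a) * (x \<bullet> b) * dd a (dd b h) x) + real k * h x
        = real k * (real k * h x)"
      using E1[of x] by (simp add: sum.distrib)
    then show ?thesis by (simp add: algebra_simps)
  qed
  have nx: "(\<Sum>a\<in>Basis. (x \<bullet> a) * (x \<bullet> a)) = 1"
    using x by (simp add: euclidean_inner[symmetric] power2_norm_eq_inner[symmetric])
  have lap: "(\<Sum>b\<in>Basis. dd b (dd b h) x) = 0"
    using spherical_harmonicsD(3)[OF h] by (simp add: laplacian_eq_dd)
  have delta: "(\<Sum>b\<in>Basis. (a \<bullet> b) * f b) = f a" if "a \<in> Basis" for a and f :: "'a \<Rightarrow> real"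
  proof -
    have "(\<Sum>b\<in>Basis. (a \<bullet> b) * f b) = (\<Sum>b\<in>Basis. if b = a then f a else 0)"
      using that by (intro sum.cong) (auto simp: inner_not_same_Basis)
    then show ?thesis using that by simp
  qed
  have "slap h x =
      (\<Sum>a\<in>Basis. \<Sum>b\<in>Basis. (x \<bullet> a) * (x \<bullet> a) * dd b (dd b h) x)
      + (\<Sum>a\<in>Basis. \<Sum>b\<in>Basis. (x \<bullet> b) * (x \<bullet> b) * dd a (dd a h) x)
      + (\<Sum>a\<in>Basis. \<Sum>b\<in>Basis. (a \<bullet> b) * ((x \<bullet> a) * dd b h x))
      + (\<Sum>a\<in>Basis. \<Sum>b\<in>Basis. (a \<bullet> b) * ((x \<bullet> b) * dd a h x))
      - (\<Sum>a\<in>Basis. \<Sum>b\<in>(Basis::'a set). (x \<bullet> a) * dd a h x)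
      - (\<Sum>a\<in>(Basis::'a set). \<Sum>b\<in>Basis. (x \<bullet> b) * dd b h x)
      - (\<Sum>a\<in>Basis. \<Sum>b\<in>Basis. (x \<bullet> a) * (x \<bullet> b) * dd b (dd a h) x)
      - (\<Sum>a\<in>Basis. \<Sum>b\<in>Basis. (x \<bullet> a) * (x \<bullet> b) * dd a (dd b h) x)"
    unfolding slap_def by (simp add: rr sum.distrib sum_subtractf mult.assoc mult.left_commute)
  also have "(\<Sum>a\<in>Basis. \<Sum>b\<in>Basis. (x \<bullet> a) * (x \<bullet> b) * dd b (dd a h) x)
      = (\<Sum>a\<in>Basis. \<Sum>b\<in>Basis. (x \<bullet> a) * (x \<bullet> b) * dd a (dd b h) x)"
    by (subst sum.swap) (simp add: mult.commute)
  also have "(\<Sum>a\<in>Basis. \<Sum>b\<in>Basis. (x \<bullet> a) * (x \<bullet> a) * dd b (dd b h) x) = 0"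
    by (simp add: sum_distrib_left[symmetric] lap)
  also have "(\<Sum>a\<in>Basis. \<Sum>b\<in>Basis. (x \<bullet> b) * (x \<bullet> b) * dd a (dd a h) x) = 0"
    by (simp add: sum_distrib_right[symmetric] nx lap)
  also have "(\<Sum>a\<in>Basis. \<Sum>b\<in>Basis. (a \<bullet> b) * ((x \<bullet> a) * dd b h x)) = real k * h x"
    by (simp add: delta E1)
  also have "(\<Sum>a\<in>Basis. \<Sum>b\<in>Basis. (a \<bullet> b) * ((x \<bullet> b) * dd a h x)) = real k * h x"
    by (simp add: delta E1)
  also have "(\<Sum>a\<in>Basis. \<Sum>b\<in>(Basis::'a set). (x \<bullet> a) * dd a h x) = real DIM('a) * (real k * h x)"
    by (simp add: sum_distrib_left[symmetric] E1)
  also have "(\<Sum>a\<in>(Basis::'a set). \<Sum>b\<in>Basis. (x \<bullet> b) * dd b h x) = real DIM('a) * (real k * h x)"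
    by (simp add: E1)
  finally show ?thesis unfolding E2 by (simp add: algebra_simps)
qed

text \<open>Both functions are eigenfunctions of the symmetric operator \<open>slap\<close>. The
  difference of the eigenvalues factors as 2 (j - k) (j + k + N - 2) up to sign, N being the
  dimension of the space, and the last factor is positive since j + k \<ge> 1 and N \<ge> 2.\<close>

lemma spherical_harmonics_orthogonal:
  fixes f g :: "'a::euclidean_space \<Rightarrow> real"
  assumes f: "f \<in> spherical_harmonics j" and g: "g \<in> spherical_harmonics k" and jk: "j \<noteq> k"
    and N: "2 \<le> DIM('a)"
  shows "(LINT x|sphere_measure. f x * g x) = 0"
proof -
  let ?c = "\<lambda>k. 2 * real k * (real k + real DIM('a) - 2)"
  have "(LINT x|sphere_measure. slap f x * g x) = (LINT x|sphere_measure. f x * slap g x)"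
    using spherical_harmonicsD(4) f g by (intro integral_slap_symmetric[of UNIV]) auto
  moreover have "(LINT x|sphere_measure. slap f x * g x) = (LINT x|sphere_measure. (- ?c j) * (f x * g x))"
    by (rule integral_sphere_cong) (simp add: slap_spherical_harmonic[OF f])
  moreover have "(LINT x|sphere_measure. f x * slap g x) = (LINT x|sphere_measure. (- ?c k) * (f x * g x))"
    by (rule integral_sphere_cong) (simp add: slap_spherical_harmonic[OF g])
  ultimately have "?c j * (LINT x|sphere_measure. f x * g x) = ?c k * (LINT x|sphere_measure. f x * g x)"
    by simp
  then have e: "(?c j - ?c k) * (LINT x|sphere_measure. f x * g x) = 0"
    by (simp add: left_diff_distrib)
  have "?c j - ?c k = 2 * (real j - real k) * (real j + real k + real DIM('a) - 2)"
    by (simp add: algebra_simps)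
  moreover have "real j + real k + real DIM('a) - 2 > 0" using N jk by auto
  ultimately have "?c j - ?c k \<noteq> 0" using jk by simp
  with e show ?thesis by simp
qed

section \<open>Gegenbauer polynomials and zonal harmonics\<close>

text \<open>The Gegenbauer polynomial of degree k and index l in the cosine of the angle between x
  and y, multiplied by the k-th powers of both norms. The factors x \<bullet> x and y \<bullet> y in
  the usual three-term recurrence make it a polynomial that is homogeneous of degree k in each
  argument.\<close>

fun gegen :: "real \<Rightarrow> nat \<Rightarrow> 'a::euclidean_space \<Rightarrow> 'a \<Rightarrow> real" where
  "gegen l 0 x y = 1"
| "gegen l (Suc 0) x y = 2 * l * (x \<bullet> y)"
| "gegen l (Suc (Suc k)) x y =
    (2 * (real k + 1 + l) * ((x \<bullet> y) * gegen l (Suc k) x y)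
      - (real k + 2 * l) * (y \<bullet> y) * ((x \<bullet> x) * gegen l k x y)) / (real k + 2)"

lemma gegen_commute: "gegen l k x y = gegen l k y x"
  by (induction l k x y rule: gegen.induct) (simp_all add: inner_commute)

lemma gegen_scaleR: "gegen l k (t *\<^sub>R x) y = t ^ k * gegen l k x y"
  by (induction l k x y rule: gegen.induct) (simp_all add: field_simps power2_eq_square)

lemma polynomial_inner: "real_polynomial_function (\<lambda>x::'a::euclidean_space. x \<bullet> y)"
  by (rule real_polynomial_function.intros(1)) (rule bounded_linear_inner_left)

lemma polynomial_norm_square: "real_polynomial_function (\<lambda>x::'a::euclidean_space. x \<bullet> x)"
proof -
  have "real_polynomial_function (\<lambda>x::'a. \<Sum>b\<in>Basis. (x \<bullet> b) * (x \<bullet> b))"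
    by (intro real_polynomial_function_sum real_polynomial_function.intros(4) polynomial_inner) auto
  then show ?thesis by (simp add: euclidean_inner[symmetric])
qed

lemma polynomial_gegen: "real_polynomial_function (\<lambda>x. gegen l k x y)"
  by (induction l k y y rule: gegen.induct)
     (auto intro!: real_polynomial_function.intros(4) real_polynomial_function.intros(2)
       real_polynomial_function_diff real_polynomial_function_divide polynomial_inner polynomial_norm_square)

lemma smooth_gegen [simp]: "smooth_on (\<lambda>x. gegen l k x y) UNIV"
  by (rule smooth_on_polynomial[OF polynomial_gegen])

text \<open>Differentiating in the direction of the second argument lowers the degree by one.
  Together with Euler's identity this evaluates the first-order terms that arise when the Laplacian
  is applied to the recurrence.\<close>

lemma dd_gegen:
  "dd y (\<lambda>x. gegen l k x y) x =
    (case k of 0 \<Rightarrow> 0 | Suc j \<Rightarrow> (real j + 2 * l) * (y \<bullet> y) * gegen l j x y)"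
proof (induction l k x y rule: gegen.induct)
  case (3 l k x y)
  let ?G = "\<lambda>k x. gegen l k x y"
  have "dd y (?G (Suc (Suc k))) x =
    dd y (\<lambda>x. (2 * (real k + 1 + l) / (real k + 2)) * ((x \<bullet> y) * ?G (Suc k) x)
      - ((real k + 2 * l) * (y \<bullet> y) / (real k + 2)) * ((x \<bullet> x) * ?G k x)) x"
    by (simp add: diff_divide_distrib)
  also have "\<dots> = (2 * (real k + 1 + l) / (real k + 2)) * ((x \<bullet> y) * dd y (?G (Suc k)) x + (y \<bullet> y) * ?G (Suc k) x)
      - ((real k + 2 * l) * (y \<bullet> y) / (real k + 2)) * ((x \<bullet> x) * dd y (?G k) x + (x \<bullet> y) * (2 * ?G k x))"
    by (subst dd_diff, (rule smooth_on_UNIV_differentiable, intro smooth_on_mult; simp)+,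
        subst dd_const_mult, (rule smooth_on_UNIV_differentiable, intro smooth_on_mult; simp),
        subst dd_const_mult, (rule smooth_on_UNIV_differentiable, intro smooth_on_mult; simp))
       (simp only: dd_inner_mult dd_norm_square_mult smooth_gegen)
  also have "\<dots> = (real (Suc k) + 2 * l) * (y \<bullet> y) * ?G (Suc k) x"
  proof (cases k)
    case 0
    then show ?thesis using 3 by (simp add: field_simps)
  next
    case (Suc j)
    \<comment> \<open>The recurrence one degree lower, cleared of its denominator: it absorbs the
      terms in degrees k and k - 1 that the induction hypothesis produces.\<close>
    have G: "?G (Suc k) x * (real k + 1) = (2 * (real k + l) * ((x \<bullet> y) * ?G k x)
      - (real j + 2 * l) * (y \<bullet> y) * ((x \<bullet> x) * ?G j x))"
      by (simp add: Suc field_simps)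
    show ?thesis
      unfolding Suc
    proof -
      define A where "A = ?G (Suc k) x"
      define B where "B = ?G k x"
      define C where "C = ?G j x"
      define t where "t = x \<bullet> y"
      define q where "q = x \<bullet> x"
      define s where "s = y \<bullet> y"
      have k: "real k = real j + 1" using Suc by simp
      have G': "A * (real j + 2) = 2 * (real j + 1 + l) * (t * B) - (real j + 2 * l) * s * (q * C)"
        using G unfolding A_def B_def C_def t_def q_def s_def k by (simp add: add.assoc)
      have "2 * (real j + 2 + l) * (t * ((real j + 1 + 2 * l) * s * B) + s * A)
          - (real j + 1 + 2 * l) * s * (q * ((real j + 2 * l) * s * C) + t * (2 * B))
          = (real j + 2 + 2 * l) * s * A * (real j + 3) "
      proof -
        have "2 * (real j + 2 + l) * (t * ((real j + 1 + 2 * l) * s * B) + s * A)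
          - (real j + 1 + 2 * l) * s * (q * ((real j + 2 * l) * s * C) + t * (2 * B))
          = 2 * (real j + 2 + l) * s * A + (real j + 1 + 2 * l) * s *
             (2 * (real j + 1 + l) * (t * B) - (real j + 2 * l) * s * (q * C))"
          by (simp add: algebra_simps)
        also have "\<dots> = 2 * (real j + 2 + l) * s * A + (real j + 1 + 2 * l) * s * (A * (real j + 2))"
          by (simp only: G')
        also have "\<dots> = (real j + 2 + 2 * l) * s * A * (real j + 3)" by (simp add: algebra_simps)
        finally show ?thesis .
      qed
      then have "(2 * (real j + 2 + l) * (t * ((real j + 1 + 2 * l) * s * B) + s * A)
          - (real j + 1 + 2 * l) * s * (q * ((real j + 2 * l) * s * C) + t * (2 * B))) / (real j + 3)
          = (real j + 2 + 2 * l) * s * A"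
        by (simp add: field_simps)
      moreover have "dd y (?G k) x = (real j + 2 * l) * s * C" "dd y (?G (Suc k)) x = (real k + 2 * l) * s * B"
        using 3 Suc by (simp_all add: s_def B_def C_def)
      ultimately show "(2 * (real (Suc j) + 1 + l) / (real (Suc j) + 2)) * ((x \<bullet> y) * dd y (?G (Suc (Suc j))) x + (y \<bullet> y) * ?G (Suc (Suc j)) x)
      - ((real (Suc j) + 2 * l) * (y \<bullet> y) / (real (Suc j) + 2)) * ((x \<bullet> x) * dd y (?G (Suc j)) x + (x \<bullet> y) * (2 * ?G (Suc j) x))
       = (real (Suc (Suc j)) + 2 * l) * (y \<bullet> y) * ?G (Suc (Suc j)) x"
        unfolding Suc[symmetric] A_def[symmetric] B_def[symmetric] t_def[symmetric] q_def[symmetric] s_def[symmetric]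
        by (simp add: k diff_divide_distrib add.assoc add.commute)
    qed
  qed
  finally show ?case by simp
qed (simp_all add: dd_const_mult)

text \<open>By induction only first-order terms survive in the Laplacian of the recurrence. They are
  multiples of the polynomial of degree k, with coefficients 4 (k + 1 + l) and 2 N + 4 k apart from
  a common factor, and these agree exactly when the dimension N is 2 l + 2.\<close>

lemma laplacian_gegen:
  assumes "real DIM('a) = 2 * l + 2"
  shows "laplacian (\<lambda>x::'a::euclidean_space. gegen l k x y) x = 0"
  using assms
proof (induction l k x y rule: gegen.induct)
  case (1 l x y)
  then show ?case by (simp add: laplacian_eq_dd dd_const[abs_def])
next
  case (2 l x y)
  have "dd b (\<lambda>x. 2 * l * (x \<bullet> y)) = (\<lambda>x. 2 * l * (b \<bullet> y))" for b :: 'a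
    by (rule ext) (simp add: dd_const_mult)
  then show ?case by (simp add: laplacian_eq_dd)
next
  case (3 l k x y)
  let ?G = "\<lambda>k x. gegen l k x y"
  have "laplacian (?G (Suc (Suc k))) x =
    laplacian (\<lambda>x. (2 * (real k + 1 + l) / (real k + 2)) * ((x \<bullet> y) * ?G (Suc k) x)
      - ((real k + 2 * l) * (y \<bullet> y) / (real k + 2)) * ((x \<bullet> x) * ?G k x)) x"
    by (simp add: diff_divide_distrib)
  also have "\<dots> = (2 * (real k + 1 + l) / (real k + 2)) * (2 * dd y (?G (Suc k)) x)
      - ((real k + 2 * l) * (y \<bullet> y) / (real k + 2)) * (2 * DIM('a) * ?G k x + 4 * dd x (?G k) x)"
  proof -
    have s: "smooth_on (\<lambda>x. (x \<bullet> y) * ?G (Suc k) x) UNIV" "smooth_on (\<lambda>x. (x \<bullet> x) * ?G k x) UNIV"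
      by (intro smooth_on_mult; simp)+
    have z: "laplacian (?G (Suc k)) x = 0" "laplacian (?G k) x = 0" using 3 by simp_all
    show ?thesis
      unfolding laplacian_diff[OF s[THEN smooth_on_const_mult[OF open_UNIV]]] s[THEN laplacian_const_mult]
        laplacian_inner_mult[OF smooth_gegen] laplacian_norm_square_mult[OF smooth_gegen] z by simp
  qed
  also have "dd x (?G k) x = real k * ?G k x"
    by (rule euler_homogeneous) (simp_all add: gegen_scaleR)
  also have "dd y (?G (Suc k)) x = (real k + 2 * l) * (y \<bullet> y) * ?G k x"
    by (simp add: dd_gegen)
  also have "2 * (real k + 1 + l) / (real k + 2) * (2 * ((real k + 2 * l) * (y \<bullet> y) * ?G k x))
      - (real k + 2 * l) * (y \<bullet> y) / (real k + 2) * (2 * DIM('a) * ?G k x + 4 * (real k * ?G k x)) = 0"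
    using 3(3) by (simp add: divide_simps) (simp add: algebra_simps)
  finally show ?case .
qed

text \<open>The factor (k + l) / l turns the Gegenbauer polynomial into the reproducing kernel of
  the harmonics of degree k for the normalised surface measure. It arises from applying 1 + (r / l)
  d/dr to the generating function, as in \<open>poisson_sums\<close>.\<close>

definition zonal :: "real \<Rightarrow> nat \<Rightarrow> 'a::euclidean_space \<Rightarrow> 'a \<Rightarrow> real" where
  "zonal l k x y = (real k + l) / l * gegen l k x y"

lemma zonal_commute: "zonal l k x y = zonal l k y x"
  by (simp add: zonal_def gegen_commute)

lemma zonal_spherical_harmonic:
  assumes "real DIM('a) = 2 * l + 2"
  shows "(\<lambda>x::'a::euclidean_space. zonal l k x y) \<in> spherical_harmonics k"
proof -
  have "laplacian (\<lambda>x::'a. (real k + l) / l * gegen l k x y) x = 0" for x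
    by (subst laplacian_const_mult) (simp_all add: laplacian_gegen[OF assms])
  then show ?thesis unfolding spherical_harmonics_def zonal_def
    by (auto intro!: real_polynomial_function.intros(4) real_polynomial_function.intros(2) polynomial_gegen
      simp: gegen_scaleR)
qed


lemma polynomial_continuous_on:
  "real_polynomial_function (f :: 'a::euclidean_space \<Rightarrow> real) \<Longrightarrow> continuous_on A f"
  by (simp add: continuous_on_polymonial_function real_polynomial_function_eq)

text \<open>For these kernels, Fubini and differentiation under the integral reduce to finite sums.\<close>

inductive separable :: "('a::euclidean_space \<Rightarrow> 'a \<Rightarrow> real) \<Rightarrow> bool" where
  separable_0: "separable (\<lambda>x y. 0)"
| separable_step: "separable K \<Longrightarrow> real_polynomial_function P \<Longrightarrow> real_polynomial_function Q \<Longrightarrow>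
    separable (\<lambda>x y. P x * Q y + K x y)"

lemma separable_add: "separable K \<Longrightarrow> separable L \<Longrightarrow> separable (\<lambda>x y. K x y + L x y)"
proof (induction rule: separable.induct)
  case (separable_step K P Q)
  then have "separable (\<lambda>x y. P x * Q y + (K x y + L x y))" by (intro separable.intros)
  then show ?case by (simp add: add.assoc)
qed simp

lemma separable_mult:
  assumes "separable K" "real_polynomial_function p" "real_polynomial_function q"
  shows "separable (\<lambda>x y. p x * q y * K x y)"
  using assms
proof (induction rule: separable.induct)
  case (separable_step K P Q)
  then have "separable (\<lambda>x y. (p x * P x) * (q y * Q y) + p x * q y * K x y)"
    by (intro separable.separable_step[where P = "\<lambda>x. p x * P x" and Q = "\<lambda>y. q y * Q y"]
        real_polynomial_function.intros(4))
  then show ?case by (simp add: algebra_simps)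
qed (simp add: separable.intros)

lemma separable_sum: "(\<And>i. i \<in> I \<Longrightarrow> separable (K i)) \<Longrightarrow> separable (\<lambda>x y. \<Sum>i\<in>I. K i x y)"
  by (induction I rule: infinite_finite_induct) (auto intro: separable_add separable_0)

text \<open>The inner product is the finite sum of the products (x \<bullet> b) (y \<bullet> b) over
  the basis, so each step of the recurrence preserves separability.\<close>

lemma separable_gegen: "separable (gegen l k :: 'a::euclidean_space \<Rightarrow> 'a \<Rightarrow> real)"
proof (induction k rule: less_induct)
  case (less k)
  have c: "real_polynomial_function (\<lambda>x::'a. c)" for c by (rule real_polynomial_function.intros(2))
  have one: "separable (\<lambda>x y::'a. 1)"
    using separable_step[OF separable_0 c[of 1] c[of 1]] by simp
  have inn: "separable (\<lambda>x y. (x \<bullet> y) * K x y)" if "separable K" for K :: "'a \<Rightarrow> 'a \<Rightarrow> real"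
  proof -
    have "separable (\<lambda>x y. \<Sum>b\<in>Basis. (x \<bullet> b) * (y \<bullet> b) * K x y)"
      by (intro separable_sum separable_mult that polynomial_inner)
    then show ?thesis by (simp add: sum_distrib_right[symmetric] euclidean_inner[symmetric])
  qed
  consider "k = 0" | "k = Suc 0" | j where "k = Suc (Suc j)" by (metis not0_implies_Suc)
  then show ?case
  proof cases
    case 1
    then have "gegen l k = (\<lambda>x y::'a. 1)" by (intro ext) simp
    then show ?thesis using one by simp
  next
    case 2
    then have "gegen l k = (\<lambda>x y::'a. 2 * l * 1 * ((x \<bullet> y) * 1))" by (intro ext) simp
    then show ?thesis using separable_mult[OF inn[OF one] c[of "2 * l"] c[of 1]] by simp
  next
    case 3
    have "separable (\<lambda>x y::'a. (2 * (real j + 1 + l) / (real j + 2)) * 1 * ((x \<bullet> y) * gegen l (Suc j) x y)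
        + (x \<bullet> x) * ((- (real j + 2 * l) / (real j + 2)) * (y \<bullet> y)) * gegen l j x y)"
      using 3 by (intro separable_add separable_mult inn less c polynomial_norm_square
          real_polynomial_function.intros(4)) auto
    moreover have "gegen l k = (\<lambda>x y::'a. (2 * (real j + 1 + l) / (real j + 2)) * 1 * ((x \<bullet> y) * gegen l (Suc j) x y)
        + (x \<bullet> x) * ((- (real j + 2 * l) / (real j + 2)) * (y \<bullet> y)) * gegen l j x y)"
      unfolding 3 by (intro ext) (simp add: divide_simps, simp add: algebra_simps)
    ultimately show ?thesis by simp
  qed
qed

lemma separable_zonal: "separable (zonal l k :: 'a::euclidean_space \<Rightarrow> 'a \<Rightarrow> real)"
  using separable_mult[OF separable_gegen real_polynomial_function.intros(2)[of "(real k + l) / l"]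
      real_polynomial_function.intros(2)[of 1]]
  by (simp add: zonal_def[abs_def])

lemma separable_polynomial:
  assumes "separable K"
  shows "real_polynomial_function (K x)" "real_polynomial_function (\<lambda>x. K x y)"
proof -
  have "(\<forall>x. real_polynomial_function (K x)) \<and> (\<forall>y. real_polynomial_function (\<lambda>x. K x y))"
    using assms
    by induction (auto intro!: real_polynomial_function.intros(2-4))
  then show "real_polynomial_function (K x)" "real_polynomial_function (\<lambda>x. K x y)" by auto
qed

lemma separable_integral:
  fixes K :: "'a::euclidean_space \<Rightarrow> 'a \<Rightarrow> real"
  assumes "separable K" and f: "continuous_on (sphere 0 1) f"
  shows "real_polynomial_function (\<lambda>x. LINT y|sphere_measure. K x y * f y)"
    and "integrable sphere_measure (\<lambda>y. laplacian (\<lambda>x. K x y) x * f y)"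
    and "laplacian (\<lambda>x. LINT y|sphere_measure. K x y * f y) x =
      (LINT y|sphere_measure. laplacian (\<lambda>x. K x y) x * f y)"
proof -
  have i: "integrable sphere_measure (\<lambda>y. q y * f y)" if "real_polynomial_function q" for q
    by (intro integrable_sphere continuous_on_mult f polynomial_continuous_on that)
  have "real_polynomial_function (\<lambda>x. LINT y|sphere_measure. K x y * f y) \<and>
    (\<forall>x. integrable sphere_measure (\<lambda>y. laplacian (\<lambda>x. K x y) x * f y)) \<and>
    (\<forall>x. laplacian (\<lambda>x. LINT y|sphere_measure. K x y * f y) x =
      (LINT y|sphere_measure. laplacian (\<lambda>x. K x y) x * f y))"
    using assms(1)
  proof induction
    case separable_0
    then show ?case by (simp add: real_polynomial_function.intros(2) laplacian_eq_dd dd_const[abs_def])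
  next
    case (separable_step K P Q)
    have e: "(\<lambda>x. LINT y|sphere_measure. (P x * Q y + K x y) * f y) =
        (\<lambda>x. (LINT y|sphere_measure. Q y * f y) * P x + (LINT y|sphere_measure. K x y * f y))"
    proof
      fix x
      have "(LINT y|sphere_measure. (P x * Q y + K x y) * f y) =
          (LINT y|sphere_measure. P x * (Q y * f y) + K x y * f y)"
        by (simp add: algebra_simps)
      also have "\<dots> = P x * (LINT y|sphere_measure. Q y * f y) + (LINT y|sphere_measure. K x y * f y)"
        by (subst Bochner_Integration.integral_add)
           (auto intro!: i separable_step(3) separable_polynomial(1)[OF separable_step(1)] integrable_mult_right)
      finally show "(LINT y|sphere_measure. (P x * Q y + K x y) * f y) =
        (LINT y|sphere_measure. Q y * f y) * P x + (LINT y|sphere_measure. K x y * f y)" by simp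
    qed
    have sP: "smooth_on P UNIV" by (rule smooth_on_polynomial[OF separable_step(2)])
    have sK: "smooth_on (\<lambda>x. K x y) UNIV" for y
      by (rule smooth_on_polynomial[OF separable_polynomial(2)[OF separable_step(1)]])
    have l: "laplacian (\<lambda>x. P x * Q y + K x y) x = Q y * laplacian P x + laplacian (\<lambda>x. K x y) x" for x y
      using laplacian_add[OF smooth_on_const_mult[OF open_UNIV sP, of "Q y"] sK]
        laplacian_const_mult[OF sP, of "Q y"] by (simp add: mult.commute)
    have e2: "(Q y * laplacian P x + laplacian (\<lambda>x. K x y) x) * f y =
        laplacian P x * (Q y * f y) + laplacian (\<lambda>x. K x y) x * f y" for x y
      by (simp add: algebra_simps)
    have sI: "smooth_on (\<lambda>x. LINT y|sphere_measure. K x y * f y) UNIV"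
      using separable_step.IH smooth_on_polynomial by blast
    show ?case
      unfolding e l e2
    proof (intro conjI allI)
      show "real_polynomial_function (\<lambda>x. (LINT y|sphere_measure. Q y * f y) * P x + (LINT y|sphere_measure. K x y * f y))"
        using separable_step by (intro real_polynomial_function.intros(2-4)) auto
      show "integrable sphere_measure (\<lambda>y. laplacian P x * (Q y * f y) + laplacian (\<lambda>x. K x y) x * f y)" for x
        using separable_step.IH i[OF separable_step(3)] by auto
      show "laplacian (\<lambda>x. (LINT y|sphere_measure. Q y * f y) * P x + (LINT y|sphere_measure. K x y * f y)) x =
          (LINT y|sphere_measure. laplacian P x * (Q y * f y) + laplacian (\<lambda>x. K x y) x * f y)" for x
        using separable_step i[OF separable_step(3)]
        by (subst laplacian_add[OF smooth_on_const_mult[OF open_UNIV sP] sI])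
           (simp add: laplacian_const_mult[OF sP])
    qed
  qed
  then show "real_polynomial_function (\<lambda>x. LINT y|sphere_measure. K x y * f y)"
    and "integrable sphere_measure (\<lambda>y. laplacian (\<lambda>x. K x y) x * f y)"
    and "laplacian (\<lambda>x. LINT y|sphere_measure. K x y * f y) x =
      (LINT y|sphere_measure. laplacian (\<lambda>x. K x y) x * f y)" by auto
qed

lemma separable_swap: "separable K \<Longrightarrow> separable (\<lambda>x y. K y x)"
proof (induction rule: separable.induct)
  case (separable_step K P Q)
  from separable.separable_step[OF this(4) this(3,2)] show ?case by (simp add: mult.commute)
qed (rule separable_0)

lemma separable_Fubini:
  fixes K :: "'a::euclidean_space \<Rightarrow> 'a \<Rightarrow> real"
  assumes "separable K" and f: "continuous_on (sphere 0 1) f" and g: "continuous_on (sphere 0 1) g"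
  shows "(LINT x|sphere_measure. (LINT y|sphere_measure. K x y * f y) * g x) =
    (LINT y|sphere_measure. (LINT x|sphere_measure. K x y * g x) * f y)"
  using assms(1)
proof induction
  case separable_0
  then show ?case by simp
next
  case (separable_step K P Q)
  have i: "integrable sphere_measure (\<lambda>y. q y * h y)"
    if "real_polynomial_function q" "continuous_on (sphere 0 1) h" for q h :: "'a \<Rightarrow> real"
    by (intro integrable_sphere continuous_on_mult polynomial_continuous_on that)
  have K: "real_polynomial_function (K x)" "real_polynomial_function (\<lambda>x. K x y)" for x y
    using separable_polynomial[OF separable_step(1)] by auto
  have K': "separable (\<lambda>x y. K y x)" by (rule separable_swap[OF separable_step(1)])
  let ?a = "LINT y|sphere_measure. Q y * f y" and ?b = "LINT x|sphere_measure. P x * g x"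
  let ?I = "\<lambda>x. LINT y|sphere_measure. K x y * f y" and ?J = "\<lambda>y. LINT x|sphere_measure. K x y * g x"
  have 1: "(LINT y|sphere_measure. (P x * Q y + K x y) * f y) = P x * ?a + ?I x" for x
    using i[OF separable_step(3) f] i[OF K(1) f, of x] by (simp add: distrib_right mult.assoc)
  have 2: "(LINT x|sphere_measure. (P x * Q y + K x y) * g x) = Q y * ?b + ?J y" for y
  proof -
    have "(P x * Q y + K x y) * g x = Q y * (P x * g x) + K x y * g x" for x by (simp add: algebra_simps)
    then show ?thesis using i[OF separable_step(2) g] i[OF K(2) g, of y] by simp
  qed
  have "(LINT x|sphere_measure. (P x * ?a + ?I x) * g x) =
      (LINT x|sphere_measure. ?a * (P x * g x) + ?I x * g x)"
    by (rule arg_cong[where f = "integral\<^sup>L _"]) (auto simp: algebra_simps)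
  also have "\<dots> = ?a * ?b + (LINT x|sphere_measure. ?I x * g x)"
    using i[OF separable_step(2) g] i[OF separable_integral(1)[OF separable_step(1) f] g] by simp
  also have "\<dots> = ?a * ?b + (LINT y|sphere_measure. ?J y * f y)"
    using separable_step.IH by simp
  also have "\<dots> = (LINT y|sphere_measure. ?b * (Q y * f y) + ?J y * f y)"
    using i[OF separable_step(3) f] i[OF separable_integral(1)[OF K' g] f] by simp
  also have "\<dots> = (LINT y|sphere_measure. (Q y * ?b + ?J y) * f y)"
    by (rule arg_cong[where f = "integral\<^sup>L _"]) (auto simp: algebra_simps)
  finally show ?case unfolding 1 2 .
qed

section \<open>Generating functions\<close>

text \<open>The Taylor coefficients of (1 - w)^(-l).\<close>

definition gegen_coeff :: "real \<Rightarrow> nat \<Rightarrow> real" where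
  "gegen_coeff l j = pochhammer l j / fact j"

lemma gegen_coeff_0 [simp]: "gegen_coeff l 0 = 1"
  by (simp add: gegen_coeff_def)

lemma gegen_coeff_Suc: "real (Suc j) * gegen_coeff l (Suc j) = (l + real j) * gegen_coeff l j"
  by (simp add: gegen_coeff_def pochhammer_Suc divide_simps)

text \<open>The ratio of consecutive coefficients is at most 1 + m / (j + 1), and by Bernoulli's
  inequality this is at most (1 + 1 / (j + 1))^m, the ratio of consecutive bounds.\<close>

lemma gegen_coeff_bounds:
  assumes "0 \<le> l" "l \<le> real m"
  shows "0 \<le> gegen_coeff l j" "gegen_coeff l j \<le> (real j + 1) ^ m"
proof -
  show *: "0 \<le> gegen_coeff l j" for j
    using assms by (simp add: gegen_coeff_def pochhammer_prod prod_nonneg)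
  show "gegen_coeff l j \<le> (real j + 1) ^ m"
  proof (induction j)
    case (Suc j)
    have b: "1 + real m / (real j + 1) \<le> (1 + 1 / (real j + 1)) ^ m"
      using Bernoulli_inequality[of "1 / (real j + 1)" m] order_trans[of "-1" 0 "1 / (real j + 1)"] by simp
    have "gegen_coeff l (Suc j) = (l + real j) / (real j + 1) * gegen_coeff l j"
      using gegen_coeff_Suc[of j l] by (simp add: field_simps)
    also have "\<dots> \<le> (real j + 1 + real m) / (real j + 1) * (real j + 1) ^ m"
      using assms Suc * by (intro mult_mono divide_right_mono) auto
    also have "(real j + 1 + real m) / (real j + 1) = 1 + real m / (real j + 1)"
      by (simp add: field_simps)
    also have "(1 + real m / (real j + 1)) * (real j + 1) ^ m \<le> (1 + 1 / (real j + 1)) ^ m * (real j + 1) ^ m"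
      using b by (intro mult_right_mono) auto
    also have "\<dots> = (real (Suc j) + 1) ^ m"
      by (simp add: power_mult_distrib[symmetric] field_simps)
    finally show ?case .
  qed simp
qed

text \<open>For z on the unit circle with real part x \<bullet> y, the quadratic 1 - 2 (x \<bullet>
  y) X + X^2 splits as (1 - z X) (1 - cnj z X). Hence its power - l is the product of two binomial
  series, and the right-hand side is the coefficient of degree k of that product. Working with
  formal series, the three-term recurrence is read off from a differential equation.\<close>

lemma gegen_fps:
  fixes x y :: "'a::euclidean_space"
  assumes x: "norm x = 1" and y: "norm y = 1"
    and z: "cmod z = 1" "Re z = x \<bullet> y"
  shows "complex_of_real (gegen l k x y) =
    (\<Sum>i\<le>k. complex_of_real (gegen_coeff l i) * z ^ i * (complex_of_real (gegen_coeff l (k - i)) * cnj z ^ (k - i)))"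
proof -
  let ?A = "\<lambda>w. Abs_fps (\<lambda>j. complex_of_real (gegen_coeff l j) * w ^ j)"
  let ?F = "?A z * ?A (cnj z)"
  let ?l = "fps_const (complex_of_real l)"
  \<comment> \<open>The differential equation of (1 - w X)^(-l).\<close>
  have d: "(1 - fps_const w * fps_X) * fps_deriv (?A w) = ?l * fps_const w * ?A w" for w
  proof (rule fps_ext)
    fix k
    have s: "complex_of_real (real (Suc j)) * complex_of_real (gegen_coeff l (Suc j)) =
        (complex_of_real l + of_nat j) * complex_of_real (gegen_coeff l j)" for j
      using arg_cong[OF gegen_coeff_Suc[of j l], of complex_of_real]
      by (simp only: of_real_mult of_real_add of_real_of_nat_eq)
    show "fps_nth ((1 - fps_const w * fps_X) * fps_deriv (?A w)) k = fps_nth (?l * fps_const w * ?A w) k"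
    proof (cases k)
      case 0
      then show ?thesis using s[of 0] by (simp add: algebra_simps)
    next
      case (Suc j)
      have "fps_nth ((1 - fps_const w * fps_X) * fps_deriv (?A w)) k =
        complex_of_real (real (Suc k)) * complex_of_real (gegen_coeff l (Suc k)) * w ^ Suc k
        - of_nat k * complex_of_real (gegen_coeff l k) * w ^ Suc k"
        by (simp add: Suc algebra_simps)
      also have "\<dots> = complex_of_real l * w * (complex_of_real (gegen_coeff l k) * w ^ k)"
        unfolding s by (simp add: algebra_simps)
      finally show ?thesis by simp
    qed
  qed
  let ?T = "fps_const (complex_of_real (x \<bullet> y))"
  have zz: "fps_const z * fps_const (cnj z) = 1" "fps_const z + fps_const (cnj z) = 2 * ?T"
  proof -
    have "z * cnj z = 1" using z(1) by (simp add: complex_norm_square[symmetric])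
    then show "fps_const z * fps_const (cnj z) = 1" by simp
    have "z + cnj z = 2 * complex_of_real (x \<bullet> y)" using z(2) by (simp add: complex_add_cnj)
    then show "fps_const z + fps_const (cnj z) = 2 * ?T" by (simp add: numeral_fps_const)
  qed
  have D: "(1 - 2 * ?T * fps_X + fps_X\<^sup>2) * fps_deriv ?F = ?l * (2 * ?T - 2 * fps_X) * ?F"
  proof -
    have e: "(1 - fps_const z * fps_X) * (1 - fps_const (cnj z) * fps_X) = 1 - 2 * ?T * fps_X + fps_X\<^sup>2"
    proof -
      have "(1 - fps_const z * fps_X) * (1 - fps_const (cnj z) * fps_X) =
        1 - (fps_const z + fps_const (cnj z)) * fps_X + (fps_const z * fps_const (cnj z)) * fps_X\<^sup>2"
        by (simp only: power2_eq_square ring_distribs) (simp add: algebra_simps)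
      then show ?thesis by (simp only: zz mult_1_left)
    qed
    have "(1 - 2 * ?T * fps_X + fps_X\<^sup>2) * fps_deriv ?F =
        ((1 - fps_const z * fps_X) * fps_deriv (?A z)) * ((1 - fps_const (cnj z) * fps_X) * ?A (cnj z))
      + ((1 - fps_const z * fps_X) * ?A z) * ((1 - fps_const (cnj z) * fps_X) * fps_deriv (?A (cnj z)))"
      unfolding e[symmetric] fps_deriv_mult by (simp only: algebra_simps)
    also have "\<dots> = ?l * ((fps_const z + fps_const (cnj z)) - 2 * (fps_const z * fps_const (cnj z)) * fps_X) * ?F"
    proof -
      have r: "(m * u * A) * ((1 - v * X) * B) + ((1 - u * X) * A) * (m * v * B) =
          m * ((u + v) - 2 * (u * v) * X) * (A * B)" for m u v A B X :: "complex fps"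
        by (simp add: algebra_simps)
      show ?thesis unfolding d by (rule r)
    qed
    also have "\<dots> = ?l * (2 * ?T - 2 * fps_X) * ?F" by (simp only: zz mult_1_right)
    finally show ?thesis .
  qed
  \<comment> \<open>Comparison of the coefficients of degree k + 1 in \<open>D\<close> gives the
    recurrence of \<open>gegen\<close> on unit vectors.\<close>
  have rec: "of_nat (Suc (Suc k)) * fps_nth ?F (Suc (Suc k)) =
      2 * (of_nat k + 1 + complex_of_real l) * (complex_of_real (x \<bullet> y) * fps_nth ?F (Suc k))
      - (of_nat k + 2 * complex_of_real l) * fps_nth ?F k" for k
  proof -
    let ?c = "complex_of_real (x \<bullet> y)"
    define F where "F = ?F"
    define G where "G = fps_deriv F"
    have D': "G + fps_const (-2 * ?c) * (fps_X * G) + fps_X * (fps_X * G) =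
        fps_const (2 * complex_of_real l * ?c) * F + fps_const (-2 * complex_of_real l) * (fps_X * F)"
    proof -
      have n: "fps_const (-2 * ?c) = - (2 * ?T)" "fps_const (2 * complex_of_real l * ?c) = ?l * (2 * ?T)"
        "fps_const (-2 * complex_of_real l) = - (2 * ?l)"
        by (simp_all add: numeral_fps_const)
      show ?thesis unfolding n using D[folded F_def, folded G_def]
        by (simp add: algebra_simps power2_eq_square)
    qed
    have "fps_nth (G + fps_const (-2 * ?c) * (fps_X * G) + fps_X * (fps_X * G)) (Suc k) =
      fps_nth (fps_const (2 * complex_of_real l * ?c) * F + fps_const (-2 * complex_of_real l) * (fps_X * F)) (Suc k)"
      by (simp only: D')
    then have "of_nat (Suc (Suc k)) * fps_nth F (Suc (Suc k)) - 2 * ?c * (of_nat (Suc k) * fps_nth F (Suc k)) + of_nat k * fps_nth F k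
      = 2 * complex_of_real l * ?c * fps_nth F (Suc k) - 2 * complex_of_real l * fps_nth F k"
      by (cases k) (simp_all add: G_def)
    then show ?thesis unfolding F_def[symmetric] by (simp add: algebra_simps)
  qed
  have F01: "fps_nth ?F 0 = 1" "fps_nth ?F (Suc 0) = 2 * complex_of_real l * complex_of_real (x \<bullet> y)"
  proof -
    show "fps_nth ?F 0 = 1" by simp
    have "gegen_coeff l (Suc 0) = l" using gegen_coeff_Suc[of 0 l] by simp
    then have "fps_nth ?F (Suc 0) = complex_of_real l * (z + cnj z)"
      by (simp add: fps_mult_nth algebra_simps)
    then show "fps_nth ?F (Suc 0) = 2 * complex_of_real l * complex_of_real (x \<bullet> y)"
      using z(2) by (simp add: complex_add_cnj)
  qed
  have xy: "x \<bullet> x = 1" "y \<bullet> y = 1" using x y by (simp_all add: power2_norm_eq_inner[symmetric])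
  have "complex_of_real (gegen l k x y) = fps_nth ?F k"
  proof (induction k rule: less_induct)
    case (less k)
    consider "k = 0" | "k = Suc 0" | j where "k = Suc (Suc j)" by (metis not0_implies_Suc)
    then show ?case
    proof cases
      case 3
      have "(of_nat (Suc (Suc j)) :: complex) \<noteq> 0" by (simp only: of_nat_eq_0_iff)
      moreover have "of_nat (Suc (Suc j)) * complex_of_real (gegen l k x y) = of_nat (Suc (Suc j)) * fps_nth ?F k"
      proof -
        have "real (Suc (Suc j)) * gegen l k x y =
            2 * (real j + 1 + l) * ((x \<bullet> y) * gegen l (Suc j) x y) - (real j + 2 * l) * gegen l j x y"
          by (simp add: 3 xy field_simps)
        from arg_cong[OF this, of complex_of_real]
        have "of_nat (Suc (Suc j)) * complex_of_real (gegen l k x y) =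
           2 * (of_nat j + 1 + complex_of_real l) * (complex_of_real (x \<bullet> y) * complex_of_real (gegen l (Suc j) x y))
           - (of_nat j + 2 * complex_of_real l) * complex_of_real (gegen l j x y)"
          by (simp only: of_real_mult of_real_add of_real_diff of_real_of_nat_eq of_real_1 of_real_numeral)
        also have "\<dots> = of_nat (Suc (Suc j)) * fps_nth ?F k"
          using less[of j] less[of "Suc j"] rec[of j] 3 by simp
        finally show ?thesis .
      qed
      ultimately show ?thesis by (simp only: mult_cancel_left) simp
    qed (use F01 in simp_all)
  qed
  then show ?thesis by (simp add: fps_mult_nth atLeast0AtMost)
qed

text \<open>Termwise differentiation preserves the radius of convergence, and \<open>diffs\<close>
  of the sequence n^m is (n + 1)^(m + 1). A shift of the index then leads back from powers of n + 1
  to powers of n, so both forms are carried through the induction.\<close>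

lemma summable_poly_power:
  fixes r :: real
  assumes "\<bar>r\<bar> < 1"
  shows "summable (\<lambda>k. (real k + 1) ^ m * r ^ k)"
proof -
  have "\<forall>r::real. \<bar>r\<bar> < 1 \<longrightarrow> summable (\<lambda>k. real k ^ m * r ^ k) \<and> summable (\<lambda>k. (real k + 1) ^ m * r ^ k)"
  proof (induction m)
    case 0
    then show ?case by (simp add: summable_geometric)
  next
    case (Suc m)
    show ?case
    proof (intro allI impI)
      fix r :: real assume r: "\<bar>r\<bar> < 1"
      have "summable (\<lambda>n. diffs (\<lambda>n. real n ^ m) n * r ^ n)"
        by (rule termdiff_converges[of r 1]) (use Suc r in auto)
      then have 1: "summable (\<lambda>k. (real k + 1) ^ Suc m * r ^ k)"
        by (simp add: diffs_def add.commute)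
      then have "summable (\<lambda>k. r * ((real k + 1) ^ Suc m * r ^ k))" by (rule summable_mult)
      then have "summable (\<lambda>k. real (Suc k) ^ Suc m * r ^ Suc k)" by (simp add: ac_simps)
      then have "summable (\<lambda>k. real k ^ Suc m * r ^ k)" by (subst (asm) summable_Suc_iff)
      with 1 show "summable (\<lambda>k. real k ^ Suc m * r ^ k) \<and> summable (\<lambda>k. (real k + 1) ^ Suc m * r ^ k)" by blast
    qed
  qed
  then show ?thesis using assms by blast
qed

text \<open>The operator r d/dr applied termwise; the polynomial bound on the coefficients gives a
  radius of convergence of at least 1. Used to pass from the exponent - l of the generating function
  to - l - 1 and then to - l - 2.\<close>

lemma sums_real_mult_coeff:
  fixes c :: "nat \<Rightarrow> real"
  assumes bd: "\<And>k. \<bar>c k\<bar> \<le> C * (real k + 1) ^ m"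
    and f: "\<And>s. 0 < s \<Longrightarrow> s < 1 \<Longrightarrow> (\<lambda>k. c k * s ^ k) sums f s"
    and r: "0 < r" "r < 1" and d: "DERIV f r :> f'"
  shows "(\<lambda>k. real k * c k * r ^ k) sums (r * f')"
proof -
  have sm: "summable (\<lambda>k. c k * s ^ k)" if "\<bar>s\<bar> < 1" for s
  proof (rule summable_comparison_test')
    have "\<bar>\<bar>s\<bar>\<bar> < 1" using that by simp
    from summable_mult[OF summable_poly_power[OF this, of m], of C]
    show "summable (\<lambda>k. C * ((real k + 1) ^ m * \<bar>s\<bar> ^ k))" .
    show "norm (c k * s ^ k) \<le> C * ((real k + 1) ^ m * \<bar>s\<bar> ^ k)" if "0 \<le> k" for k
      using mult_right_mono[OF bd[of k], of "\<bar>s\<bar> ^ k"] by (simp add: abs_mult power_abs mult.assoc)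
  qed
  have "summable (\<lambda>k. c k * ((1 + r) / 2) ^ k)" using r by (intro sm) auto
  then have "DERIV (\<lambda>s. \<Sum>k. c k * s ^ k) r :> (\<Sum>k. diffs c k * r ^ k)"
    by (rule termdiffs_strong) (use r in auto)
  moreover have "\<forall>\<^sub>F s in nhds r. (\<Sum>k. c k * s ^ k) = f s"
    using eventually_nhds_in_open[of "{0<..<1}" r] r
    by (auto elim!: eventually_mono simp: sums_unique[OF f, symmetric])
  ultimately have "DERIV f r :> (\<Sum>k. diffs c k * r ^ k)"
    by (subst (asm) DERIV_cong_ev[OF refl _ refl]) auto
  then have e: "(\<Sum>k. diffs c k * r ^ k) = f'" using d DERIV_unique by blast
  have "summable (\<lambda>k. diffs c k * r ^ k)"
    by (rule termdiff_converges[of r 1]) (use r sm in auto)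
  then have "(\<lambda>k. diffs c k * r ^ k) sums f'" using e summable_sums by metis
  then have "(\<lambda>k. r * (diffs c k * r ^ k)) sums (r * f')" by (rule sums_mult)
  then have "(\<lambda>k. real (Suc k) * c (Suc k) * r ^ Suc k) sums (r * f')"
    by (simp add: diffs_def ac_simps)
  then show ?thesis using sums_Suc_iff[of "\<lambda>k. real k * c k * r ^ k" "r * f'"] by simp
qed

lemma gegen_binomial_sums:
  assumes "cmod w < 1"
  shows "(\<lambda>j. complex_of_real (gegen_coeff l j) * w ^ j) sums ((1 - w) powr (- complex_of_real l))"
proof -
  have "(\<lambda>n. ((- complex_of_real l) gchoose n) * (- w) ^ n) sums (1 + (- w)) powr (- complex_of_real l)"
    using assms by (intro gen_binomial_complex) simp
  moreover have "((- complex_of_real l) gchoose n) * (- w) ^ n = complex_of_real (gegen_coeff l n) * w ^ n" for n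
  proof -
    have "(- w) ^ n = (- 1) ^ n * w ^ n" by (rule power_minus)
    moreover have "(- 1 :: complex) ^ n * (- 1) ^ n = 1" by (simp add: power_mult_distrib[symmetric])
    ultimately show ?thesis
      by (simp add: gbinomial_pochhammer gegen_coeff_def pochhammer_of_real) 
  qed
  ultimately show ?thesis by simp
qed

text \<open>For unit vectors this is the squared distance between x and r y.\<close>

definition ndist :: "real \<Rightarrow> 'a::euclidean_space \<Rightarrow> 'a \<Rightarrow> real" where
  "ndist r x y = 1 + r\<^sup>2 - 2 * r * (x \<bullet> y)"

lemma unit_inner_bound: "norm x = 1 \<Longrightarrow> norm y = 1 \<Longrightarrow> \<bar>x \<bullet> y\<bar> \<le> 1"
  using Cauchy_Schwarz_ineq2[of x y] by simp

lemma ndist_ge: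
  assumes "norm x = 1" "norm y = 1" "0 < r"
  shows "(1 - r)\<^sup>2 \<le> ndist r x y"
proof -
  have "2 * r * (x \<bullet> y) \<le> 2 * r * 1"
    using unit_inner_bound[OF assms(1,2)] assms(3) by (intro mult_left_mono) auto
  then show ?thesis by (simp add: ndist_def power2_eq_square algebra_simps)
qed

lemma ndist_pos:
  assumes "norm x = 1" "norm y = 1" "0 < r" "r < 1"
  shows "0 < ndist r x y"
  using ndist_ge[OF assms(1-3)] assms(4) by (smt (verit) zero_less_power2)

lemma unit_complex_exists:
  assumes "norm x = 1" "norm y = 1"
  obtains z where "cmod z = 1" "Re z = x \<bullet> y"
proof
  let ?z = "Complex (x \<bullet> y) (sqrt (1 - (x \<bullet> y)\<^sup>2))"
  have "(x \<bullet> y)\<^sup>2 \<le> 1" using unit_inner_bound[OF assms] by (simp add: abs_square_le_1)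
  then show "cmod ?z = 1" by (simp add: cmod_def)
  show "Re ?z = x \<bullet> y" by simp
qed

text \<open>\<open>gegen_fps\<close> has k + 1 summands, each a product of two coefficients bounded
  by (k + 1)^m, times a number of modulus 1.\<close>

lemma gegen_bound:
  assumes x: "norm x = 1" and y: "norm y = 1" and l: "0 \<le> l" "l \<le> real m"
  shows "\<bar>gegen l k x y\<bar> \<le> (real k + 1) ^ (2 * m + 1)"
proof -
  obtain z where z: "cmod z = 1" "Re z = x \<bullet> y" using unit_complex_exists[OF x y] by blast
  have "\<bar>gegen l k x y\<bar> = cmod (complex_of_real (gegen l k x y))" by simp
  also have "\<dots> \<le> (\<Sum>i\<le>k. cmod (complex_of_real (gegen_coeff l i) * z ^ i * (complex_of_real (gegen_coeff l (k - i)) * cnj z ^ (k - i))))"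
    unfolding gegen_fps[OF x y z] by (rule norm_sum)
  also have "\<dots> \<le> (\<Sum>i\<le>k. (real k + 1) ^ m * (real k + 1) ^ m)"
  proof (rule sum_mono)
    fix i assume i: "i \<in> {..k}"
    have "gegen_coeff l i \<le> (real i + 1) ^ m" "(real i + 1) ^ m \<le> (real k + 1) ^ m"
      "gegen_coeff l (k - i) \<le> (real (k - i) + 1) ^ m" "(real (k - i) + 1) ^ m \<le> (real k + 1) ^ m"
      using gegen_coeff_bounds[OF l] i by (auto intro!: power_mono simp del: of_nat_diff)
    then have "gegen_coeff l i * gegen_coeff l (k - i) \<le> (real k + 1) ^ m * (real k + 1) ^ m"
      using gegen_coeff_bounds(1)[OF l] by (intro mult_mono) (auto intro: order_trans)
    then show "cmod (complex_of_real (gegen_coeff l i) * z ^ i * (complex_of_real (gegen_coeff l (k - i)) * cnj z ^ (k - i)))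
        \<le> (real k + 1) ^ m * (real k + 1) ^ m"
      using gegen_coeff_bounds(1)[OF l] by (simp add: norm_mult norm_power z)
  qed
  also have "\<dots> = (real k + 1) ^ (2 * m + 1)" by (simp add: power_add mult_2)
  finally show ?thesis .
qed

text \<open>Off the cut the principal logarithms of w and of its conjugate are themselves conjugate,
  so the phases cancel in the product.\<close>

lemma powr_cnj_mult:
  assumes "w \<notin> \<real>\<^sub>\<le>\<^sub>0"
  shows "w powr (- complex_of_real l) * cnj w powr (- complex_of_real l) = complex_of_real ((cmod w)\<^sup>2 powr (- l))"
proof -
  have w: "w \<noteq> 0" using assms by auto
  have "w powr (- complex_of_real l) * cnj w powr (- complex_of_real l) = exp (- complex_of_real l * (Ln w + cnj (Ln w)))"
    using w assms by (simp add: powr_def exp_add[symmetric] cnj_Ln algebra_simps)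
  also have "Ln w + cnj (Ln w) = complex_of_real (2 * ln (cmod w))"
    using w by (simp add: complex_add_cnj)
  also have "exp (- complex_of_real l * complex_of_real (2 * ln (cmod w))) = complex_of_real (exp (- l * (2 * ln (cmod w))))"
    by (metis exp_of_real of_real_minus of_real_mult)
  also have "exp (- l * (2 * ln (cmod w))) = (cmod w)\<^sup>2 powr (- l)"
    using w by (simp add: powr_def ln_realpow)
  finally show ?thesis .
qed

text \<open>The Cauchy product of the binomial series at r z and at its conjugate, with z as in
  \<open>gegen_fps\<close>. The modulus of r z is below 1, so 1 - r z has positive real part and the
  principal branches apply; its squared modulus is \<open>ndist r x y\<close>.\<close>

lemma gegen_sums:
  assumes x: "norm x = 1" and y: "norm y = 1" and l: "0 < l" and r: "0 < r" "r < 1"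
  shows "(\<lambda>k. gegen l k x y * r ^ k) sums (ndist r x y powr (- l))"
proof -
  obtain m where m: "l \<le> real m" using real_arch_simple by blast
  obtain z where z: "cmod z = 1" "Re z = x \<bullet> y" using unit_complex_exists[OF x y] by blast
  let ?a = "\<lambda>w j. complex_of_real (gegen_coeff l j) * w ^ j"
  have sm: "summable (\<lambda>j. norm (?a w j))" if "cmod w < 1" for w
  proof (rule summable_comparison_test')
    show "summable (\<lambda>k. (real k + 1) ^ m * cmod w ^ k)" using that by (intro summable_poly_power) auto
    show "norm (norm (?a w j)) \<le> (real j + 1) ^ m * cmod w ^ j" if "0 \<le> j" for j
      using gegen_coeff_bounds[OF less_imp_le[OF l] m, of j] by (simp add: norm_mult norm_power mult_right_mono)
  qed
  let ?w = "complex_of_real r * z"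
  have w: "cmod ?w < 1" "cmod (cnj ?w) < 1" using r z by (simp_all add: norm_mult)
  have "(\<lambda>k. \<Sum>i\<le>k. ?a ?w i * ?a (cnj ?w) (k - i)) sums ((\<Sum>k. ?a ?w k) * (\<Sum>k. ?a (cnj ?w) k))"
    by (rule Cauchy_product_sums[OF sm[OF w(1)] sm[OF w(2)]])
  also have "(\<Sum>k. ?a ?w k) * (\<Sum>k. ?a (cnj ?w) k) =
      (1 - ?w) powr (- complex_of_real l) * (1 - cnj ?w) powr (- complex_of_real l)"
    using gegen_binomial_sums[OF w(1), of l] gegen_binomial_sums[OF w(2), of l]
    by (simp only: sums_unique[symmetric])
  also have "\<dots> = complex_of_real ((cmod (1 - ?w))\<^sup>2 powr (- l))"
  proof -
    have "Re (1 - ?w) > 0" using w(1) abs_Re_le_cmod[of ?w] by simp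
    then have "1 - ?w \<notin> \<real>\<^sub>\<le>\<^sub>0" by (auto simp: complex_nonpos_Reals_iff)
    from powr_cnj_mult[OF this, of l] show ?thesis by simp
  qed
  also have "(cmod (1 - ?w))\<^sup>2 = ndist r x y"
  proof -
    have "(cmod (1 - ?w))\<^sup>2 = 1 - 2 * r * Re z + r\<^sup>2 * ((Re z)\<^sup>2 + (Im z)\<^sup>2)"
      by (simp only: cmod_power2) (simp add: power2_eq_square algebra_simps)
    also have "(Re z)\<^sup>2 + (Im z)\<^sup>2 = 1" using z(1) cmod_power2[of z] by simp
    finally show ?thesis using z(2) by (simp add: ndist_def)
  qed
  also have "(\<lambda>k. \<Sum>i\<le>k. ?a ?w i * ?a (cnj ?w) (k - i)) = (\<lambda>k. complex_of_real (gegen l k x y * r ^ k))"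
  proof
    fix k
    have "?a ?w i * ?a (cnj ?w) (k - i) =
        (complex_of_real (gegen_coeff l i) * z ^ i * (complex_of_real (gegen_coeff l (k - i)) * cnj z ^ (k - i)))
        * complex_of_real r ^ k" if "i \<le> k" for i
    proof -
      have "complex_of_real r ^ k = complex_of_real r ^ i * complex_of_real r ^ (k - i)"
        using that by (simp add: power_add[symmetric])
      then show ?thesis by (simp add: power_mult_distrib)
    qed
    then show "(\<Sum>i\<le>k. ?a ?w i * ?a (cnj ?w) (k - i)) = complex_of_real (gegen l k x y * r ^ k)"
      by (subst of_real_mult, subst gegen_fps[OF x y z, of l k], subst sum_distrib_right)
         (auto intro!: sum.cong)
  qed
  finally show ?thesis by (simp only: sums_of_real_iff)
qed

lemma DERIV_ndist_powr:
  assumes "norm x = 1" "norm y = 1" "0 < r" "r < 1"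
  shows "DERIV (\<lambda>r. ndist r x y powr a) r :> a * ndist r x y powr (a - 1) * (2 * r - 2 * (x \<bullet> y))"
proof -
  have "DERIV (\<lambda>r. ndist r x y) r :> 2 * r - 2 * (x \<bullet> y)"
    unfolding ndist_def by (auto intro!: derivative_eq_intros)
  from DERIV_fun_powr[OF this ndist_pos[OF assms], of a] show ?thesis by simp
qed

lemma zonal_bound:
  assumes "0 < l"
  obtains C q where "0 < C" "\<And>k x y. norm x = 1 \<Longrightarrow> norm y = 1 \<Longrightarrow> \<bar>zonal l k x y\<bar> \<le> C * (real k + 1) ^ q"
proof -
  obtain m where m: "l \<le> real m" using real_arch_simple by blast
  have "\<bar>zonal l k x y\<bar> \<le> (1 + 1 / l) * (real k + 1) ^ (2 * m + 2)"
    if "norm x = 1" "norm y = 1" for k and x y :: 'a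
  proof -
    have "(real k + l) / l \<le> (1 + 1 / l) * (real k + 1)"
      using assms by (simp add: field_simps)
    then have "(real k + l) / l * \<bar>gegen l k x y\<bar> \<le> (1 + 1 / l) * (real k + 1) * (real k + 1) ^ (2 * m + 1)"
      using gegen_bound[OF that less_imp_le[OF assms] m, of k] assms by (intro mult_mono) auto
    then show ?thesis using assms by (simp add: zonal_def abs_mult mult.assoc)
  qed
  then show ?thesis using assms by (intro that[of "1 + 1 / l" "2 * m + 2"]) (auto simp: add_pos_pos)
qed

text \<open>Applies 1 + (r / l) d/dr to the generating function. The numerator collapses because D -
  r D' = 1 - r^2, where D is \<open>ndist r x y\<close> and D' its derivative in r.\<close>

lemma poisson_sums:
  assumes x: "norm x = 1" and y: "norm y = 1" and l: "0 < l" and r: "0 < r" "r < 1"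
  shows "(\<lambda>k. zonal l k x y * r ^ k) sums ((1 - r\<^sup>2) * ndist r x y powr (- l - 1))"
proof -
  let ?D = "ndist r x y"
  obtain m where m: "l \<le> real m" using real_arch_simple by blast
  have "\<bar>gegen l k x y\<bar> \<le> 1 * (real k + 1) ^ (2 * m + 1)" for k
    using gegen_bound[OF x y less_imp_le[OF l] m, of k] by simp
  then have "(\<lambda>k. real k * gegen l k x y * r ^ k) sums (r * (- l * ?D powr (- l - 1) * (2 * r - 2 * (x \<bullet> y))))"
    using gegen_sums[OF x y l] r DERIV_ndist_powr[OF x y r, of "-l"] by (rule sums_real_mult_coeff)
  from sums_add[OF gegen_sums[OF x y l r] sums_divide[OF this, of l]]
  have "(\<lambda>k. gegen l k x y * r ^ k + real k * gegen l k x y * r ^ k / l) sums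
      (?D powr (- l) + r * (- l * ?D powr (- l - 1) * (2 * r - 2 * (x \<bullet> y))) / l)" .
  moreover have "gegen l k x y * r ^ k + real k * gegen l k x y * r ^ k / l = zonal l k x y * r ^ k" for k
    using l by (simp add: zonal_def field_simps)
  moreover have "?D powr (- l) = ?D powr (- l - 1) * ?D"
    using ndist_pos[OF x y r] powr_add[of ?D "- l - 1" 1] by simp
  then have "?D powr (- l) + r * (- l * ?D powr (- l - 1) * (2 * r - 2 * (x \<bullet> y))) / l =
      ?D powr (- l - 1) * (?D - r * (2 * r - 2 * (x \<bullet> y)))"
    using l by (simp add: field_simps)
  moreover have "?D - r * (2 * r - 2 * (x \<bullet> y)) = 1 - r\<^sup>2"
    by (simp add: ndist_def power2_eq_square algebra_simps)
  ultimately show ?thesis by (simp add: mult.commute)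
qed

section \<open>The kernel of exponent - l - 2 and its multipliers\<close>

text \<open>Let f be the Poisson kernel, Q = 1 - r^2 and D = \<open>ndist r x y\<close>.
  Differentiating f expresses r f' through D^(-l-2) and f; solving gives (l + 1) Q^3 D^(-l-2) = Q r
  f' + ((l + 1) Q + 2 r^2) f. In the zonal expansion r d/dr multiplies the coefficient of degree k
  by k, which is this formula.\<close>

definition kmult :: "real \<Rightarrow> nat \<Rightarrow> real \<Rightarrow> real" where
  "kmult l k r = r ^ k * ((l + 1 + real k) * (1 - r\<^sup>2) + 2 * r\<^sup>2) / ((l + 1) * (1 - r\<^sup>2) ^ 3)"

lemma kernel_sums:
  fixes x y :: "'a::euclidean_space"
  assumes x: "norm x = 1" and y: "norm y = 1" and l: "0 < l" and r: "0 < r" "r < 1"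
  shows "(\<lambda>k. kmult l k r * zonal l k x y) sums (ndist r x y powr (- l - 2))"
proof -
  let ?D = "ndist r x y"
  obtain C q where C: "\<And>k x y. norm (x::'a) = 1 \<Longrightarrow> norm y = 1 \<Longrightarrow> \<bar>zonal l k x y\<bar> \<le> C * (real k + 1) ^ q"
    using zonal_bound[OF l] by metis
  let ?f' = "(1 - r\<^sup>2) * ((- l - 1) * ?D powr (- l - 2) * (2 * r - 2 * (x \<bullet> y))) + (- 2 * r) * ?D powr (- l - 1)"
  have "DERIV (\<lambda>r. (1 - r\<^sup>2) * ndist r x y powr (- l - 1)) r :> ?f'"
  proof -
    have "DERIV (\<lambda>r::real. 1 - r\<^sup>2) r :> - 2 * r" by (auto intro!: derivative_eq_intros)
    from DERIV_mult[OF this DERIV_ndist_powr[OF x y r, of "- l - 1"]] show ?thesis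
      by (rule DERIV_cong) (simp add: algebra_simps)
  qed
  then have 1: "(\<lambda>k. real k * zonal l k x y * r ^ k) sums (r * ?f')"
    using C[OF x y] poisson_sums[OF x y l] r by (intro sums_real_mult_coeff) auto
  note 2 = poisson_sums[OF x y l r]
  have q: "0 < 1 - r\<^sup>2" using r by (simp add: power_less_one_iff)
  let ?a = "1 / ((l + 1) * (1 - r\<^sup>2)\<^sup>2)" and ?b = "((l + 1) * (1 - r\<^sup>2) + 2 * r\<^sup>2) / ((l + 1) * (1 - r\<^sup>2) ^ 3)"
  have "(\<lambda>k. ?a * (real k * zonal l k x y * r ^ k) + ?b * (zonal l k x y * r ^ k)) sums
    (?a * (r * ?f') + ?b * ((1 - r\<^sup>2) * ?D powr (- l - 1)))"
    by (intro sums_add sums_mult 1 2)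
  moreover have "?a * (real k * zonal l k x y * r ^ k) + ?b * (zonal l k x y * r ^ k) = kmult l k r * zonal l k x y" for k
  proof -
    have a: "?a = (1 - r\<^sup>2) / ((l + 1) * (1 - r\<^sup>2) ^ 3)"
      using q by (simp add: power2_eq_square power3_eq_cube)
    show ?thesis unfolding a kmult_def by (simp add: add_divide_distrib[symmetric]) (simp add: algebra_simps)
  qed
  moreover have "?a * (r * ?f') + ?b * ((1 - r\<^sup>2) * ?D powr (- l - 1)) = ?D powr (- l - 2)"
  proof -
    define P where "P = ?D powr (- l - 2)"
    define Q where "Q = 1 - r\<^sup>2"
    have D1: "?D powr (- l - 1) = P * ?D"
    proof -
      have "- l - 1 = (- l - 2) + 1" by simp
      then show ?thesis
        using ndist_pos[OF x y r] powr_add[of ?D "- l - 2" 1] by (simp only: P_def powr_one)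
    qed
    \<comment> \<open>Removes the inner product from the derivative, leaving only the two powers of
      D that occur in the claim.\<close>
    have e: "r * (2 * r - 2 * (x \<bullet> y)) = ?D - Q"
      by (simp add: ndist_def Q_def power2_eq_square algebra_simps)
    have "r * (Q * ((- l - 1) * P * (2 * r - 2 * (x \<bullet> y))) + (- 2 * r) * (P * ?D)) =
        Q * (- l - 1) * P * (r * (2 * r - 2 * (x \<bullet> y))) - 2 * r\<^sup>2 * P * ?D"
      by (simp add: algebra_simps power2_eq_square)
    also have "\<dots> = (l + 1) * Q\<^sup>2 * P - ((l + 1) * Q + 2 * r\<^sup>2) * (P * ?D)"
      unfolding e by (simp add: algebra_simps power2_eq_square)
    finally have f: "r * (Q * ((- l - 1) * P * (2 * r - 2 * (x \<bullet> y))) + (- 2 * r) * (P * ?D)) =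
       (l + 1) * Q\<^sup>2 * P - ((l + 1) * Q + 2 * r\<^sup>2) * (P * ?D)" .
    have "Q > 0" "l + 1 > 0" using q l by (auto simp: Q_def)
    then have "1 / ((l + 1) * Q\<^sup>2) * ((l + 1) * Q\<^sup>2 * P - ((l + 1) * Q + 2 * r\<^sup>2) * (P * ?D))
       + ((l + 1) * Q + 2 * r\<^sup>2) / ((l + 1) * Q ^ 3) * (Q * (P * ?D)) = P"
      by (simp add: divide_simps power2_eq_square power3_eq_cube)
    then show ?thesis unfolding D1 P_def[symmetric] Q_def[symmetric] f .
  qed
  ultimately show ?thesis by simp
qed

text \<open>For consecutive degrees the difference of the brackets, the later one multiplied by r,
  factors as (1 - r) ((l + k) (1 - r^2) + (1 - r)). The resulting sign of
  \<open>kmult l 0 r - kmult l k r\<close> makes the integrals over r monotone and lets partial sums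
  be compared with full sums.\<close>

lemma kmult_antimono:
  assumes l: "0 < l" and r: "0 < r" "r < 1" and jk: "j \<le> k"
  shows "kmult l k r \<le> kmult l j r"
proof -
  have "kmult l (Suc k) r \<le> kmult l k r" for k
  proof -
    have q: "0 < 1 - r\<^sup>2" using r by (simp add: power_less_one_iff)
    have "((l + 1 + real k) * (1 - r\<^sup>2) + 2 * r\<^sup>2) - r * ((l + 1 + real (Suc k)) * (1 - r\<^sup>2) + 2 * r\<^sup>2)
        = (1 - r) * ((l + real k) * (1 - r\<^sup>2) + (1 - r))"
      by (simp add: power2_eq_square algebra_simps)
    moreover have "0 \<le> (1 - r) * ((l + real k) * (1 - r\<^sup>2) + (1 - r))"
      using r l q by (intro mult_nonneg_nonneg add_nonneg_nonneg) auto
    ultimately have "r * ((l + 1 + real (Suc k)) * (1 - r\<^sup>2) + 2 * r\<^sup>2) \<le> (l + 1 + real k) * (1 - r\<^sup>2) + 2 * r\<^sup>2"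
      by linarith
    from mult_left_mono[OF this, of "r ^ k"] r l q show ?thesis
      unfolding kmult_def by (intro divide_right_mono) (auto simp: ac_simps)
  qed
  then show ?thesis using jk lift_Suc_antimono_le[of "\<lambda>k. kmult l k r"] by blast
qed

lemma kmult_pos: "0 < l \<Longrightarrow> 0 < r \<Longrightarrow> r < 1 \<Longrightarrow> 0 < kmult l k r"
  unfolding kmult_def
  by (intro divide_pos_pos mult_pos_pos add_pos_nonneg zero_less_power) (auto simp: power_less_one_iff)


section \<open>Projection to spherical harmonics\<close>

text \<open>An explicit integral formula for the projection that \<open>harmonic_component\<close>
  defines by a description; \<open>harmonic_component_eq\<close> identifies the two for continuous
  f. The parameter l is tied to the dimension by DIM = 2 l + 2 wherever harmonicity matters.\<close>

definition zproj :: "real \<Rightarrow> nat \<Rightarrow> ('a::euclidean_space \<Rightarrow> real) \<Rightarrow> 'a \<Rightarrow> real" where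
  "zproj l k f x = (LINT y|sphere_measure. zonal l k x y * f y) / sphere_area TYPE('a)"

lemma zonal_continuous: "continuous_on A (zonal l k x)"
  by (rule polynomial_continuous_on[OF separable_polynomial(1)[OF separable_zonal]])

lemma zproj_polynomial: "continuous_on (sphere 0 1) f \<Longrightarrow> real_polynomial_function (zproj l k f)"
  unfolding zproj_def[abs_def]
  by (intro real_polynomial_function_divide separable_integral(1)[OF separable_zonal])

lemma zproj_continuous: "continuous_on (sphere 0 1) f \<Longrightarrow> continuous_on A (zproj l k f)"
  by (rule polynomial_continuous_on[OF zproj_polynomial])

lemma zproj_spherical_harmonic:
  fixes f :: "'a::euclidean_space \<Rightarrow> real"
  assumes f: "continuous_on (sphere 0 1) f" and N: "real DIM('a) = 2 * l + 2"
  shows "zproj l k f \<in> spherical_harmonics k"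
proof -
  let ?I = "\<lambda>x. LINT y|sphere_measure. zonal l k x y * f y"
  have e: "zproj l k f = (\<lambda>x. (1 / sphere_area TYPE('a)) * ?I x)"
    by (simp add: zproj_def fun_eq_iff)
  have s: "smooth_on ?I UNIV"
    by (rule smooth_on_polynomial[OF separable_integral(1)[OF separable_zonal f]])
  have "laplacian ?I x = 0" for x
    unfolding separable_integral(3)[OF separable_zonal f]
    by (simp add: spherical_harmonicsD(3)[OF zonal_spherical_harmonic[OF N]])
  then have "laplacian (zproj l k f) x = 0" for x
    unfolding e laplacian_const_mult[OF s] by simp
  moreover have "zproj l k f (t *\<^sub>R x) = t ^ k * zproj l k f x" for t x
    by (simp add: zproj_def spherical_harmonicsD(2)[OF zonal_spherical_harmonic[OF N]] mult.assoc)
  ultimately show ?thesis using zproj_polynomial[OF f] by (simp add: spherical_harmonics_def)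
qed

lemma zproj_diff:
  assumes "continuous_on (sphere 0 1) f" "continuous_on (sphere 0 1) g"
  shows "zproj l k (\<lambda>x. f x - g x) x = zproj l k f x - zproj l k g x"
  using assms unfolding zproj_def right_diff_distrib
  by (subst Bochner_Integration.integral_diff)
     (auto intro!: integrable_sphere continuous_on_mult zonal_continuous simp: diff_divide_distrib)

lemma zproj_symmetric:
  assumes "continuous_on (sphere 0 1) f" "continuous_on (sphere 0 1) g"
  shows "(LINT x|sphere_measure. zproj l k f x * g x) = (LINT x|sphere_measure. f x * zproj l k g x)"
proof -
  have "(LINT x|sphere_measure. (LINT y|sphere_measure. zonal l k x y * f y) * g x) =
      (LINT y|sphere_measure. f y * (LINT x|sphere_measure. zonal l k y x * g x))"
    using separable_Fubini[OF separable_zonal assms, of l k]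
    by (simp add: zonal_commute[of l k _ "_"] mult.commute)
  then show ?thesis by (simp add: zproj_def)
qed

lemma zproj_bound:
  fixes f :: "'a::euclidean_space \<Rightarrow> real"
  assumes f: "continuous_on (sphere 0 1) f" and B: "\<And>x. norm x = 1 \<Longrightarrow> \<bar>f x\<bar> \<le> B"
    and Z: "\<And>y. norm y = 1 \<Longrightarrow> \<bar>zonal l k x y\<bar> \<le> Z"
  shows "\<bar>zproj l k f x\<bar> \<le> Z * B"
proof -
  have i: "integrable sphere_measure (\<lambda>y. zonal l k x y * f y)"
    by (intro integrable_sphere continuous_on_mult zonal_continuous f)
  have "\<bar>LINT y|sphere_measure. zonal l k x y * f y\<bar> \<le> (LINT y|sphere_measure. \<bar>zonal l k x y * f y\<bar>)"
    by simp
  also have "\<dots> \<le> (LINT y|(sphere_measure::'a measure). Z * B)"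
  proof (rule integral_mono)
    fix y :: 'a assume "y \<in> space sphere_measure"
    then have y: "norm y = 1" by simp
    show "\<bar>zonal l k x y * f y\<bar> \<le> Z * B"
      unfolding abs_mult using Z[OF y] B[OF y] by (intro mult_mono) auto
  qed (use i in auto)
  also have "\<dots> = Z * B * sphere_area TYPE('a)" by (simp add: sphere_area_def)
  finally show ?thesis
    using sphere_area_pos[where 'a = 'a] by (simp add: zproj_def divide_simps)
qed

text \<open>The majorants b do not depend on x and g is bounded, so summation and integration may be
  exchanged. Integrability of the product F g is part of the conclusion because F is known only as a
  pointwise sum.\<close>

lemma sphere_series_integral:
  fixes g :: "'a::euclidean_space \<Rightarrow> real"
  assumes u: "\<And>k. continuous_on (sphere 0 1) (u k)" and g: "continuous_on (sphere 0 1) g"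
    and b: "\<And>k x. norm x = 1 \<Longrightarrow> \<bar>u k x\<bar> \<le> b k" "summable b"
    and F: "\<And>x. norm x = 1 \<Longrightarrow> (\<lambda>k. u k x) sums F x"
  shows "integrable sphere_measure (\<lambda>x. F x * g x)"
    and "(\<lambda>k. LINT x|sphere_measure. u k x * g x) sums (LINT x|sphere_measure. F x * g x)"
proof -
  obtain A where A: "0 < A" "\<And>x. norm x = 1 \<Longrightarrow> \<bar>g x\<bar> \<le> A"
    using continuous_on_sphere_bounded[OF g] by blast
  let ?f = "\<lambda>k x. u k x * g x"
  have i: "integrable sphere_measure (?f k)" for k
    by (intro integrable_sphere continuous_on_mult u g)
  have le: "norm (?f k x) \<le> A * b k" if x: "norm x = 1" for k x
  proof -
    have "\<bar>u k x\<bar> * \<bar>g x\<bar> \<le> b k * A"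
      using A(2)[OF x] b(1)[OF x, of k] by (intro mult_mono) (auto intro: order_trans[OF abs_ge_zero])
    then show ?thesis by (simp add: abs_mult mult.commute)
  qed
  have ae: "AE y in sphere_measure. summable (\<lambda>k. norm (?f k y))"
  proof (rule AE_I2)
    fix y :: 'a assume "y \<in> space sphere_measure"
    then have "norm y = 1" by simp
    then show "summable (\<lambda>k. norm (?f k y))"
      by (intro summable_comparison_test'[OF summable_mult[OF b(2), of A]]) (use le in auto)
  qed
  have s: "summable (\<lambda>k. LINT y|sphere_measure. norm (?f k y))"
  proof (rule summable_comparison_test'[OF summable_mult[OF b(2), of "A * sphere_area TYPE('a)"]])
    fix k :: nat
    have "(LINT y|sphere_measure. norm (?f k y)) \<le> (LINT y|(sphere_measure::'a measure). A * b k)"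
      by (rule integral_mono) (use i le in auto)
    then show "norm (LINT y|sphere_measure. norm (?f k y)) \<le> A * sphere_area TYPE('a) * b k"
      by (simp add: ac_simps sphere_area_def)
  qed
  have eq: "(\<Sum>k. ?f k y) = F y * g y" if "norm y = 1" for y
    using sums_unique[OF sums_mult2[OF F[OF that], of "g y"]] by simp
  have "integrable sphere_measure (\<lambda>y. \<Sum>k. ?f k y)" by (rule integrable_suminf[OF i ae s])
  also have "integrable sphere_measure (\<lambda>y. \<Sum>k. ?f k y) \<longleftrightarrow> integrable sphere_measure (\<lambda>y. F y * g y)"
    by (rule Bochner_Integration.integrable_cong) (use eq in auto)
  finally show "integrable sphere_measure (\<lambda>x. F x * g x)" .
  have "(\<lambda>k. integral\<^sup>L sphere_measure (?f k)) sums (LINT y|sphere_measure. (\<Sum>k. ?f k y))"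
    by (rule sums_integral[OF i ae s])
  also have "(LINT y|sphere_measure. (\<Sum>k. ?f k y)) = (LINT y|sphere_measure. F y * g y)"
    by (rule integral_sphere_cong) (rule eq)
  finally show "(\<lambda>k. LINT x|sphere_measure. u k x * g x) sums (LINT x|sphere_measure. F x * g x)" .
qed

text \<open>Serves both kernels: the Poisson kernel with coefficients r^k and the kernel of exponent
  - l - 2 with coefficients \<open>kmult l k r\<close>.\<close>

lemma zonal_series_integral:
  fixes f :: "'a::euclidean_space \<Rightarrow> real"
  assumes f: "continuous_on (sphere 0 1) f"
    and Z: "\<And>k y. norm y = 1 \<Longrightarrow> \<bar>zonal l k x y\<bar> \<le> C * (real k + 1) ^ q" "0 \<le> C"
    and c: "summable (\<lambda>k. \<bar>c k\<bar> * (real k + 1) ^ q)"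
    and K: "\<And>y. norm y = 1 \<Longrightarrow> (\<lambda>k. c k * zonal l k x y) sums K y"
  shows "integrable sphere_measure (\<lambda>y. K y * f y)"
    and "(\<lambda>k. c k * zproj l k f x) sums ((LINT y|sphere_measure. K y * f y) / sphere_area TYPE('a))"
proof -
  have u: "continuous_on (sphere 0 1) (\<lambda>y. c k * zonal l k x y)" for k
    by (intro continuous_on_mult continuous_on_const zonal_continuous)
  have b: "\<bar>c k * zonal l k x y\<bar> \<le> C * (\<bar>c k\<bar> * (real k + 1) ^ q)" if "norm y = 1" for k y
    using mult_left_mono[OF Z(1)[OF that], of "\<bar>c k\<bar>" k] by (simp add: abs_mult ac_simps)
  note S = sphere_series_integral[OF u f b summable_mult[OF c] K]
  show "integrable sphere_measure (\<lambda>y. K y * f y)" by (rule S(1))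
  from sums_divide[OF S(2), of "sphere_area TYPE('a)"]
  show "(\<lambda>k. c k * zproj l k f x) sums ((LINT y|sphere_measure. K y * f y) / sphere_area TYPE('a))"
    by (simp add: zproj_def mult.assoc)
qed

lemma zproj_series_integral:
  fixes f g :: "'a::euclidean_space \<Rightarrow> real"
  assumes l: "0 < l" and f: "continuous_on (sphere 0 1) f" and g: "continuous_on (sphere 0 1) g"
    and c: "\<And>q. summable (\<lambda>k. \<bar>c k\<bar> * (real k + 1) ^ q)"
    and F: "\<And>x. norm x = 1 \<Longrightarrow> (\<lambda>k. c k * zproj l k f x) sums F x"
  shows "integrable sphere_measure (\<lambda>x. F x * g x)"
    and "(\<lambda>k. c k * (LINT x|sphere_measure. zproj l k f x * g x)) sums (LINT x|sphere_measure. F x * g x)"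
proof -
  obtain B where B: "0 < B" "\<And>x. norm x = 1 \<Longrightarrow> \<bar>f x\<bar> \<le> B"
    using continuous_on_sphere_bounded[OF f] by blast
  obtain C q where C: "0 < C" "\<And>k x y. norm (x::'a) = 1 \<Longrightarrow> norm y = 1 \<Longrightarrow> \<bar>zonal l k x y\<bar> \<le> C * (real k + 1) ^ q"
    using zonal_bound[OF l] by metis
  have u: "continuous_on (sphere 0 1) (\<lambda>x. c k * zproj l k f x)" for k
    by (intro continuous_on_mult continuous_on_const zproj_continuous f)
  have b: "\<bar>c k * zproj l k f x\<bar> \<le> C * B * (\<bar>c k\<bar> * (real k + 1) ^ q)" if x: "norm x = 1" for k x
  proof -
    have "\<bar>zproj l k f x\<bar> \<le> C * (real k + 1) ^ q * B"
      by (rule zproj_bound[OF f B(2) C(2)[OF x]])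
    from mult_left_mono[OF this, of "\<bar>c k\<bar>"] show ?thesis by (simp add: abs_mult ac_simps)
  qed
  note S = sphere_series_integral[OF u g b summable_mult[OF c] F]
  show "integrable sphere_measure (\<lambda>x. F x * g x)" by (rule S(1))
  from S(2) show "(\<lambda>k. c k * (LINT x|sphere_measure. zproj l k f x * g x)) sums (LINT x|sphere_measure. F x * g x)"
    by (simp add: mult.assoc)
qed

lemma summable_abs_power_poly: "0 < r \<Longrightarrow> r < 1 \<Longrightarrow> summable (\<lambda>k. \<bar>r ^ k\<bar> * (real k + 1) ^ q)" for r :: real
  using summable_poly_power[of r q] by (simp add: mult.commute)

lemma zproj_const_1:
  fixes x :: "'a::euclidean_space"
  assumes N: "real DIM('a) = 2 * l + 2" and l: "0 < l"
  shows "zproj l k (\<lambda>_. 1) x = (if k = 0 then 1 else 0)"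
proof (cases "k = 0")
  case True
  then show ?thesis using l sphere_area_pos[where 'a='a] by (simp add: zproj_def zonal_def sphere_area_def)
next
  case False
  have "(\<lambda>_::'a. 1) \<in> spherical_harmonics 0"
    by (simp add: spherical_harmonics_def real_polynomial_function.intros(2) laplacian_eq_dd dd_const[abs_def])
  then have "(LINT y|sphere_measure. zonal l k y x * 1) = 0"
    using False l N
    by (intro spherical_harmonics_orthogonal[OF zonal_spherical_harmonic[OF N]]) auto
  then show ?thesis using False by (simp add: zproj_def zonal_commute[of l k x])
qed

section \<open>The Poisson kernel as an approximate identity\<close>

definition poisson :: "real \<Rightarrow> real \<Rightarrow> 'a::euclidean_space \<Rightarrow> 'a \<Rightarrow> real" where
  "poisson l r x y = (1 - r\<^sup>2) * ndist r x y powr (- l - 1)"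

lemma poisson_integral_sums:
  fixes f :: "'a::euclidean_space \<Rightarrow> real"
  assumes f: "continuous_on (sphere 0 1) f" and l: "0 < l" and r: "0 < r" "r < 1" and x: "norm x = 1"
  shows "integrable sphere_measure (\<lambda>y. poisson l r x y * f y)"
    and "(\<lambda>k. r ^ k * zproj l k f x) sums ((LINT y|sphere_measure. poisson l r x y * f y) / sphere_area TYPE('a))"
proof -
  obtain C q where C: "0 < C" "\<And>k x y. norm (x::'a) = 1 \<Longrightarrow> norm y = 1 \<Longrightarrow> \<bar>zonal l k x y\<bar> \<le> C * (real k + 1) ^ q"
    using zonal_bound[OF l] by metis
  have K: "(\<lambda>k. r ^ k * zonal l k x y) sums poisson l r x y" if "norm y = 1" for y
    using poisson_sums[OF x that l r] by (simp add: poisson_def mult.commute)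
  show "integrable sphere_measure (\<lambda>y. poisson l r x y * f y)"
    "(\<lambda>k. r ^ k * zproj l k f x) sums ((LINT y|sphere_measure. poisson l r x y * f y) / sphere_area TYPE('a))"
    by (rule zonal_series_integral[OF f C(2)[OF x] less_imp_le[OF C(1)] summable_abs_power_poly[OF r] K]; simp)+
qed

lemma poisson_nonneg: "0 \<le> r \<Longrightarrow> r < 1 \<Longrightarrow> 0 \<le> poisson l r x y"
  unfolding poisson_def by (intro mult_nonneg_nonneg) (auto simp: power_le_one)

text \<open>The constant 1 has only a component of degree 0, so the series of its Poisson integral
  has a single nonzero term.\<close>

lemma integral_poisson:
  fixes x :: "'a::euclidean_space"
  assumes N: "real DIM('a) = 2 * l + 2" and l: "0 < l" and r: "0 < r" "r < 1" and x: "norm x = 1"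
  shows "integrable sphere_measure (poisson l r x)" "(LINT y|sphere_measure. poisson l r x y) = sphere_area TYPE('a)"
proof -
  have c: "continuous_on (sphere 0 1) (\<lambda>_::'a. 1::real)" by simp
  show "integrable sphere_measure (poisson l r x)"
    using poisson_integral_sums(1)[OF c l r x] by simp
  have "(\<lambda>k. if k = 0 then 1 else 0) sums ((LINT y|sphere_measure. poisson l r x y * 1) / sphere_area TYPE('a))"
    using poisson_integral_sums(2)[OF c l r x] by (simp add: zproj_const_1[OF N l] if_distrib cong: if_cong)
  moreover have "(\<lambda>k::nat. if k = 0 then 1 else 0 :: real) sums 1"
    using sums_single[of 0 "\<lambda>_. 1::real"] by simp
  ultimately have "(LINT y|sphere_measure. poisson l r x y) / sphere_area TYPE('a) = 1"
    using sums_unique2 by fastforce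
  then show "(LINT y|sphere_measure. poisson l r x y) = sphere_area TYPE('a)"
    using sphere_area_pos[where 'a='a] by simp
qed

definition poisson_mean :: "real \<Rightarrow> real \<Rightarrow> ('a::euclidean_space \<Rightarrow> real) \<Rightarrow> 'a \<Rightarrow> real" where
  "poisson_mean l r f x = (LINT y|sphere_measure. poisson l r x y * f y) / sphere_area TYPE('a)"

lemma poisson_mean_bound:
  fixes f :: "'a::euclidean_space \<Rightarrow> real"
  assumes f: "continuous_on (sphere 0 1) f" and N: "real DIM('a) = 2 * l + 2" and l: "0 < l"
    and r: "0 < r" "r < 1" and x: "norm x = 1" and B: "\<And>x. norm x = 1 \<Longrightarrow> \<bar>f x\<bar> \<le> B"
  shows "\<bar>poisson_mean l r f x\<bar> \<le> B"
proof -
  have "\<bar>LINT y|sphere_measure. poisson l r x y * f y\<bar> \<le> (LINT y|sphere_measure. \<bar>poisson l r x y * f y\<bar>)"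
    by simp
  also have "\<dots> \<le> (LINT y|sphere_measure. poisson l r x y * B)"
  proof (rule integral_mono)
    fix y :: 'a assume "y \<in> space sphere_measure"
    then show "\<bar>poisson l r x y * f y\<bar> \<le> poisson l r x y * B"
      using B poisson_nonneg[of r l x y] r by (simp add: abs_mult mult_left_mono)
  qed (use poisson_integral_sums(1)[OF f l r x] integral_poisson(1)[OF N l r x] in auto)
  also have "\<dots> = sphere_area TYPE('a) * B"
    by (simp add: integral_poisson(2)[OF N l r x])
  finally show ?thesis
    using sphere_area_pos[where 'a='a] by (simp add: poisson_mean_def divide_simps mult.commute)
qed

lemma poisson_mean_tendsto:
  fixes f :: "'a::euclidean_space \<Rightarrow> real"
  assumes f: "continuous_on (sphere 0 1) f" and N: "real DIM('a) = 2 * l + 2" and l: "0 < l"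
    and x: "norm x = 1"
  shows "((\<lambda>r. poisson_mean l r f x) \<longlongrightarrow> f x) (at_left 1)"
proof (rule tendstoI)
  fix e :: real assume e: "0 < e"
  obtain B where B: "0 < B" "\<And>x. norm x = 1 \<Longrightarrow> \<bar>f x\<bar> \<le> B"
    using continuous_on_sphere_bounded[OF f] by blast
  obtain d where d: "0 < d" "\<And>y. norm y = 1 \<Longrightarrow> dist y x < d \<Longrightarrow> dist (f y) (f x) < e / 2"
  proof -
    have "\<exists>d>0. \<forall>y\<in>sphere 0 1. dist y x < d \<longrightarrow> dist (f y) (f x) < e / 2"
      using f x e unfolding continuous_on_iff by (metis half_gt_zero mem_sphere_0)
    then show ?thesis using that by auto
  qed
  \<comment> \<open>Bounds the contribution of the points y at distance at least d from x. There
    \<open>ndist r x y\<close>, which equals (1 - r)^2 + r |x - y|^2, is at least r d^2, while f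
    varies by at most 2 B. The factor 1 - r^2 sends the bound to 0.\<close>
  let ?M = "\<lambda>r. 2 * B * ((1 - r\<^sup>2) * (r * d\<^sup>2) powr (- l - 1))"
  have lim: "(?M \<longlongrightarrow> 2 * B * ((1 - 1\<^sup>2) * (1 * d\<^sup>2) powr (- l - 1))) (at_left 1)"
    using d(1) by (intro tendsto_intros) auto
  have "\<forall>\<^sub>F r in at_left 1. ?M r < e / 2"
    using e lim by (intro order_tendstoD(2)[OF lim]) auto
  moreover have "\<forall>\<^sub>F r in at_left (1::real). 0 < r \<and> r < 1"
    using eventually_at_left_real[of 0 "1::real"] by (auto elim!: eventually_mono)
  ultimately show "\<forall>\<^sub>F r in at_left 1. dist (poisson_mean l r f x) (f x) < e"
  proof eventually_elim
    case (elim r)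
    then have r: "0 < r" "r < 1" by auto
    note P = poisson_nonneg[OF less_imp_le[OF r(1)] r(2), of l x]
    have bd: "poisson l r x y * \<bar>f y - f x\<bar> \<le> poisson l r x y * (e / 2) + ?M r" if y: "norm y = 1" for y
    proof (cases "dist y x < d")
      case True
      have "poisson l r x y * \<bar>f y - f x\<bar> \<le> poisson l r x y * (e / 2)"
        using d(2)[OF y True] P[of y] by (intro mult_left_mono) (auto simp: dist_real_def)
      moreover have "0 \<le> ?M r"
        using B r by (intro mult_nonneg_nonneg) (auto simp: power_le_one)
      ultimately show ?thesis by linarith
    next
      case False
      have "(norm (x - y))\<^sup>2 = 2 - 2 * (x \<bullet> y)"
        using x y by (simp add: power2_norm_eq_inner inner_diff inner_commute)
           (simp add: power2_norm_eq_inner[symmetric])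
      then have "r * (norm (x - y))\<^sup>2 = r * (2 - 2 * (x \<bullet> y))" by (simp only:)
      then have "ndist r x y = (1 - r)\<^sup>2 + r * (norm (x - y))\<^sup>2"
        by (simp add: ndist_def power2_eq_square algebra_simps)
      moreover have "d\<^sup>2 \<le> (norm (x - y))\<^sup>2"
        using False d(1) by (intro power_mono) (auto simp: dist_norm norm_minus_commute)
      ultimately have D: "r * d\<^sup>2 \<le> ndist r x y"
        using r mult_left_mono[of "d\<^sup>2" "(norm (x - y))\<^sup>2" r] by (smt (verit) zero_le_power2)
      have "ndist r x y powr (- l - 1) \<le> (r * d\<^sup>2) powr (- l - 1)"
        using D r d(1) l by (intro powr_mono2') auto
      then have Pl: "poisson l r x y \<le> (1 - r\<^sup>2) * (r * d\<^sup>2) powr (- l - 1)"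
        unfolding poisson_def using r by (intro mult_left_mono) (auto simp: power_le_one)
      have "\<bar>f y - f x\<bar> \<le> 2 * B" using B(2)[OF x] B(2)[OF y] by linarith
      then have "poisson l r x y * \<bar>f y - f x\<bar> \<le> (1 - r\<^sup>2) * (r * d\<^sup>2) powr (- l - 1) * (2 * B)"
        using Pl P[of y] B r by (intro mult_mono) auto
      moreover have "0 \<le> poisson l r x y * (e / 2)" using P[of y] e by simp
      ultimately show ?thesis by (simp add: mult.commute)
    qed
    note ip = integral_poisson[OF N l r x]
    have i1: "integrable sphere_measure (\<lambda>y. poisson l r x y * (f y - f x))"
      by (rule poisson_integral_sums(1)[OF _ l r x]) (intro continuous_on_diff f continuous_on_const)
    have "poisson_mean l r f x - f x = (LINT y|sphere_measure. poisson l r x y * (f y - f x)) / sphere_area TYPE('a)"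
    proof -
      have "(LINT y|sphere_measure. poisson l r x y * (f y - f x)) =
          (LINT y|sphere_measure. poisson l r x y * f y) - f x * sphere_area TYPE('a)"
        unfolding right_diff_distrib
        using poisson_integral_sums(1)[OF f l r x] ip by (subst Bochner_Integration.integral_diff) auto
      then show ?thesis using sphere_area_pos[where 'a='a] by (simp add: poisson_mean_def divide_simps)
    qed
    also have "\<bar>\<dots>\<bar> \<le> (LINT y|sphere_measure. \<bar>poisson l r x y * (f y - f x)\<bar>) / sphere_area TYPE('a)"
      using sphere_area_pos[where 'a='a] by (simp add: abs_divide divide_right_mono)
    also have "\<dots> \<le> (LINT y|sphere_measure. poisson l r x y * (e / 2) + ?M r) / sphere_area TYPE('a)"
    proof (intro divide_right_mono integral_mono)
      fix y :: 'a assume "y \<in> space sphere_measure"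
      then have "norm y = 1" by simp
      from bd[OF this] show "\<bar>poisson l r x y * (f y - f x)\<bar> \<le> poisson l r x y * (e / 2) + ?M r"
        using P[of y] by (simp add: abs_mult)
    qed (use i1 ip sphere_area_pos[where 'a='a] in auto)
    also have "\<dots> = e / 2 + ?M r"
    proof -
      have "(LINT y|sphere_measure. poisson l r x y * (e / 2) + ?M r) = sphere_area TYPE('a) * (e / 2) + ?M r * sphere_area TYPE('a)"
        using ip by (subst Bochner_Integration.integral_add) (auto simp: sphere_area_def)
      then show ?thesis using sphere_area_pos[where 'a='a] by (simp add: field_simps)
    qed
    also have "\<dots> < e" using elim by simp
    finally show ?case by (simp add: dist_real_def)
  qed
qed

text \<open>Radii along a sequence, as dominated convergence requires; the summand 2 keeps them
  strictly between 0 and 1 for every j.\<close>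

lemma filterlim_at_left_1: "filterlim (\<lambda>j. 1 - 1 / real (j + 2)) (at_left (1::real)) sequentially"
  unfolding filterlim_at by (intro conjI always_eventually) (auto, real_asymp)

text \<open>By orthogonality the expansion of the Poisson mean of f reduces to r^k times the
  component of degree k. As r tends to 1 the mean tends to f.\<close>

lemma zproj_reproducing:
  fixes f :: "'a::euclidean_space \<Rightarrow> real"
  assumes f: "f \<in> spherical_harmonics k" and N: "real DIM('a) = 2 * l + 2" and l: "0 < l"
    and x: "norm x = 1"
  shows "zproj l j f x = (if j = k then f x else 0)"
proof -
  have fc: "continuous_on (sphere 0 1) f"
    by (rule polynomial_continuous_on[OF spherical_harmonicsD(1)[OF f]])
  have z: "zproj l j f x = 0" if "j \<noteq> k" for j
  proof -
    have "(LINT y|sphere_measure. zonal l j y x * f y) = 0"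
      using that l N by (intro spherical_harmonics_orthogonal[OF zonal_spherical_harmonic[OF N] f]) auto
    then show ?thesis by (simp add: zproj_def zonal_commute[of l j x])
  qed
  have e: "poisson_mean l r f x = r ^ k * zproj l k f x" if r: "0 < r" "r < 1" for r
  proof -
    have "(\<lambda>j. r ^ j * zproj l j f x) sums poisson_mean l r f x"
      using poisson_integral_sums(2)[OF fc l r x] by (simp add: poisson_mean_def)
    moreover have "(\<lambda>j. r ^ j * zproj l j f x) = (\<lambda>j. if j = k then r ^ j * zproj l j f x else 0)"
      using z by auto
    ultimately show ?thesis using sums_single[of k "\<lambda>j. r ^ j * zproj l j f x"] sums_unique2 by simp
  qed
  have "((\<lambda>r. r ^ k * zproj l k f x) \<longlongrightarrow> 1 ^ k * zproj l k f x) (at_left 1)"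
    by (intro tendsto_intros)
  moreover have "((\<lambda>r. r ^ k * zproj l k f x) \<longlongrightarrow> f x) (at_left 1)"
  proof (rule Lim_transform_eventually[OF poisson_mean_tendsto[OF fc N l x]])
    show "\<forall>\<^sub>F r in at_left 1. poisson_mean l r f x = r ^ k * zproj l k f x"
      using eventually_at_left_real[of 0 "1::real"] by (auto elim!: eventually_mono simp: e)
  qed
  ultimately have "zproj l k f x = f x"
    using tendsto_unique[of "at_left (1::real)"] by fastforce
  then show ?thesis using z by auto
qed

lemma spherical_harmonic_eqI:
  fixes f g :: "'a::euclidean_space \<Rightarrow> real"
  assumes "f \<in> spherical_harmonics k" "g \<in> spherical_harmonics k" "\<And>x. norm x = 1 \<Longrightarrow> f x = g x"
  shows "f = g"
proof
  fix x :: 'a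
  show "f x = g x"
  proof (cases "x = 0")
    case True
    \<comment> \<open>The value at the origin is 0^k times the value at a unit vector, which also
      covers k = 0, where 0^0 = 1.\<close>
    have "f (0 *\<^sub>R (SOME b. b \<in> Basis)) = g (0 *\<^sub>R (SOME b. b \<in> Basis))"
      unfolding spherical_harmonicsD(2)[OF assms(1)] spherical_harmonicsD(2)[OF assms(2)]
      using assms(3)[of "SOME b. b \<in> Basis"] by (simp add: SOME_Basis)
    then show ?thesis using True by simp
  next
    case False
    then have e: "norm x *\<^sub>R (x /\<^sub>R norm x) = x" by simp
    have "f (x /\<^sub>R norm x) = g (x /\<^sub>R norm x)" using False by (intro assms(3)) simp
    then show ?thesis
      using spherical_harmonicsD(2)[OF assms(1), of "norm x" "x /\<^sub>R norm x"]
        spherical_harmonicsD(2)[OF assms(2), of "norm x" "x /\<^sub>R norm x"] unfolding e by simp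
  qed
qed

text \<open>Existence follows from symmetry of the projection and the reproducing property. For
  uniqueness the orthogonality condition is tested with the zonal functions, which shows that h and
  f have the same projection at every point of the sphere, and the projection of h is h.\<close>

lemma harmonic_component_eq:
  fixes f :: "'a::euclidean_space \<Rightarrow> real"
  assumes f: "continuous_on (sphere 0 1) f" and N: "real DIM('a) = 2 * l + 2" and l: "0 < l"
  shows "harmonic_component k f = zproj l k f"
  unfolding harmonic_component_def
proof (rule the_equality)
  note c = polynomial_continuous_on[OF spherical_harmonicsD(1)]
  have i: "integrable sphere_measure (\<lambda>x. g x * z x)" if "continuous_on (sphere 0 1) g" "continuous_on (sphere 0 1) z"
    for g z :: "'a \<Rightarrow> real" by (intro integrable_sphere continuous_on_mult that)
  have "(LINT x|sphere_measure. (f x - zproj l k f x) * z x) = 0" if z: "z \<in> spherical_harmonics k" for z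
  proof -
    have "(LINT x|sphere_measure. zproj l k f x * z x) = (LINT x|sphere_measure. f x * zproj l k z x)"
      by (rule zproj_symmetric[OF f c[OF z]])
    also have "\<dots> = (LINT x|sphere_measure. f x * z x)"
      by (rule integral_sphere_cong) (simp add: zproj_reproducing[OF z N l])
    finally show ?thesis
      using i[OF f c[OF z]] i[OF zproj_continuous[OF f] c[OF z]] by (simp add: left_diff_distrib)
  qed
  then show "zproj l k f \<in> spherical_harmonics k \<and>
    (\<forall>z\<in>spherical_harmonics k. (LINT x|sphere_measure. (f x - zproj l k f x) * z x) = 0)"
    using zproj_spherical_harmonic[OF f N] by auto
  fix h assume h: "h \<in> spherical_harmonics k \<and>
    (\<forall>z\<in>spherical_harmonics k. (LINT x|sphere_measure. (f x - h x) * z x) = 0)"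
  show "h = zproj l k f"
  proof (rule spherical_harmonic_eqI[OF _ zproj_spherical_harmonic[OF f N]])
    fix x :: 'a assume x: "norm x = 1"
    have hc: "continuous_on (sphere 0 1) h" using h c by blast
    have "(LINT y|sphere_measure. (f y - h y) * zonal l k y x) = 0"
      using h zonal_spherical_harmonic[OF N, of k x] by (elim conjE) (drule (1) bspec)
    then have "zproj l k (\<lambda>y. f y - h y) x = 0"
      by (simp add: zproj_def zonal_commute[of l k x] mult.commute)
    then have "zproj l k f x = zproj l k h x" by (simp add: zproj_diff[OF f hc])
    also have "\<dots> = h x" using zproj_reproducing[of h k l x k] h N l x by simp
    finally show "h x = zproj l k f x" by simp
  qed (use h in blast)
qed

lemma integral_zproj_square:
  fixes f :: "'a::euclidean_space \<Rightarrow> real"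
  assumes f: "continuous_on (sphere 0 1) f" and N: "real DIM('a) = 2 * l + 2" and l: "0 < l"
  shows "(LINT x|sphere_measure. zproj l k f x * f x) = (LINT x|sphere_measure. (zproj l k f x)\<^sup>2)"
proof -
  have "(LINT x|sphere_measure. (zproj l k f x)\<^sup>2) = (LINT x|sphere_measure. zproj l k f x * zproj l k f x)"
    by (simp add: power2_eq_square)
  also have "\<dots> = (LINT x|sphere_measure. f x * zproj l k (zproj l k f) x)"
    by (rule zproj_symmetric[OF f zproj_continuous[OF f]])
  also have "\<dots> = (LINT x|sphere_measure. zproj l k f x * f x)"
    by (rule integral_sphere_cong)
       (simp add: zproj_reproducing[OF zproj_spherical_harmonic[OF f N] N l] mult.commute)
  finally show ?thesis by simp
qed

text \<open>The series is the integral of the Poisson mean of f against g. Poisson means obey the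
  same bound as f, so dominated convergence applies to the pointwise limit.\<close>

lemma poisson_mean_integral_tendsto:
  fixes f g :: "'a::euclidean_space \<Rightarrow> real"
  assumes f: "continuous_on (sphere 0 1) f" and g: "continuous_on (sphere 0 1) g"
    and N: "real DIM('a) = 2 * l + 2" and l: "0 < l"
  shows "((\<lambda>j. \<Sum>k. (1 - 1 / real (j + 2)) ^ k * (LINT x|sphere_measure. zproj l k f x * g x))
    \<longlongrightarrow> (LINT x|sphere_measure. f x * g x)) sequentially"
    and "0 < r \<Longrightarrow> r < 1 \<Longrightarrow> summable (\<lambda>k. r ^ k * (LINT x|sphere_measure. zproj l k f x * g x))"
proof -
  have S: "(\<lambda>k. r ^ k * (LINT x|sphere_measure. zproj l k f x * g x)) sums
      (LINT x|sphere_measure. poisson_mean l r f x * g x)"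
    "integrable sphere_measure (\<lambda>x. poisson_mean l r f x * g x)" if r: "0 < r" "r < 1" for r
  proof -
    have *: "(\<lambda>k. r ^ k * zproj l k f x) sums poisson_mean l r f x" if "norm x = 1" for x
      using poisson_integral_sums(2)[OF f l r that] by (simp add: poisson_mean_def)
    show "(\<lambda>k. r ^ k * (LINT x|sphere_measure. zproj l k f x * g x)) sums
      (LINT x|sphere_measure. poisson_mean l r f x * g x)"
      "integrable sphere_measure (\<lambda>x. poisson_mean l r f x * g x)"
      using zproj_series_integral[OF l f g summable_abs_power_poly[OF r] *] by auto
  qed
  show "0 < r \<Longrightarrow> r < 1 \<Longrightarrow> summable (\<lambda>k. r ^ k * (LINT x|sphere_measure. zproj l k f x * g x))"
    using S(1) sums_summable by blast
  let ?r = "\<lambda>j. 1 - 1 / real (j + 2)"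
  have r: "0 < ?r j" "?r j < 1" for j by (auto simp: field_simps)
  obtain B where B: "0 < B" "\<And>x. norm x = 1 \<Longrightarrow> \<bar>f x\<bar> \<le> B"
    using continuous_on_sphere_bounded[OF f] by blast
  obtain A where A: "0 < A" "\<And>x. norm x = 1 \<Longrightarrow> \<bar>g x\<bar> \<le> A"
    using continuous_on_sphere_bounded[OF g] by blast
  have "(\<lambda>j. LINT x|sphere_measure. poisson_mean l (?r j) f x * g x) \<longlonglongrightarrow> (LINT x|sphere_measure. f x * g x)"
  proof (rule integral_dominated_convergence[where w = "\<lambda>_. B * A"])
    show "(\<lambda>x. f x * g x) \<in> borel_measurable sphere_measure"
      by (intro borel_measurable_sphere continuous_on_mult f g)
    show "(\<lambda>x. poisson_mean l (?r j) f x * g x) \<in> borel_measurable sphere_measure" for j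
      by (rule borel_measurable_integrable[OF S(2)[OF r]])
    show "AE x in sphere_measure. (\<lambda>j. poisson_mean l (?r j) f x * g x) \<longlonglongrightarrow> f x * g x"
    proof (rule AE_I2)
      fix x :: 'a assume "x \<in> space sphere_measure"
      then have x: "norm x = 1" by simp
      show "(\<lambda>j. poisson_mean l (?r j) f x * g x) \<longlonglongrightarrow> f x * g x"
        by (intro tendsto_mult tendsto_const
            filterlim_compose[OF poisson_mean_tendsto[OF f N l x] filterlim_at_left_1])
    qed
    show "AE x in sphere_measure. norm (poisson_mean l (?r j) f x * g x) \<le> B * A" for j
    proof (rule AE_I2)
      fix x :: 'a assume "x \<in> space sphere_measure"
      then have x: "norm x = 1" by simp
      show "norm (poisson_mean l (?r j) f x * g x) \<le> B * A"
        using poisson_mean_bound[OF f N l r x B(2)] A(2)[OF x] B(1)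
        by (simp add: abs_mult mult_mono)
    qed
  qed simp
  then show "((\<lambda>j. \<Sum>k. (1 - 1 / real (j + 2)) ^ k * (LINT x|sphere_measure. zproj l k f x * g x))
    \<longlongrightarrow> (LINT x|sphere_measure. f x * g x)) sequentially"
    by (simp only: sums_unique[OF S(1)[OF r], symmetric])
qed

section \<open>Abel summation and Parseval's identity\<close>

text \<open>Poisson means provide only the Abel limits of an expansion. Once the terms are
  absolutely summable, Tannery's theorem identifies the Abel limit with the sum.\<close>

lemma abel_sums:
  fixes a :: "nat \<Rightarrow> real"
  assumes a: "summable (\<lambda>k. \<bar>a k\<bar>)" and L: "(\<lambda>j. \<Sum>k. (1 - 1 / real (j + 2)) ^ k * a k) \<longlonglongrightarrow> L"
  shows "a sums L"
proof -
  have "((\<lambda>j. \<Sum>k. (1 - 1 / real (j + 2)) ^ k * a k) \<longlongrightarrow> (\<Sum>k. a k)) sequentially"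
  proof (rule tannerys_theorem[where M = "\<lambda>k. \<bar>a k\<bar>", THEN conjunct2, THEN conjunct2])
    show "((\<lambda>j. (1 - 1 / real (j + 2)) ^ k * a k) \<longlongrightarrow> a k) sequentially" for k
    proof -
      have "(\<lambda>j. 1 - 1 / real (j + 2)) \<longlonglongrightarrow> 1" by real_asymp
      from tendsto_mult_right[OF tendsto_power[OF this, of k], of "a k"] show ?thesis by simp
    qed
    have "norm ((1 - 1 / real (j + 2)) ^ k * a k) \<le> \<bar>a k\<bar>" for j k
    proof -
      have "0 \<le> 1 - 1 / real (j + 2)" "1 - 1 / real (j + 2) \<le> 1" by (auto simp: field_simps)
      then have "(1 - 1 / real (j + 2)) ^ k \<le> 1" "0 \<le> (1 - 1 / real (j + 2)) ^ k"
        by (auto intro: power_le_one)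
      then show ?thesis by (simp add: abs_mult mult_left_le_one_le)
    qed
    then show "\<forall>\<^sub>F (k, j) in at_top \<times>\<^sub>F sequentially. norm ((1 - 1 / real (j + 2)) ^ k * a k) \<le> \<bar>a k\<bar>"
      by (intro always_eventually) auto
  qed (use a in auto)
  then have "(\<Sum>k. a k) = L" using L LIMSEQ_unique by blast
  moreover have "summable a" using a by (rule summable_rabs_cancel)
  ultimately show ?thesis using summable_sums by blast
qed

text \<open>The terms are nonnegative, so every partial sum is a limit of sums bounded by the Abel
  means. This gives summability, after which \<open>abel_sums\<close> yields the value.\<close>

lemma zproj_parseval:
  fixes f :: "'a::euclidean_space \<Rightarrow> real"
  assumes f: "continuous_on (sphere 0 1) f" and N: "real DIM('a) = 2 * l + 2" and l: "0 < l"
  shows "(\<lambda>k. LINT x|sphere_measure. (zproj l k f x)\<^sup>2) sums (LINT x|sphere_measure. (f x)\<^sup>2)"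
proof -
  let ?a = "\<lambda>k. LINT x|sphere_measure. (zproj l k f x)\<^sup>2"
  have a0: "0 \<le> ?a k" for k by simp
  note T = poisson_mean_integral_tendsto[OF f f N l, unfolded integral_zproj_square[OF f N l]]
  let ?r = "\<lambda>j. 1 - 1 / real (j + 2)"
  have r: "0 < ?r j" "?r j < 1" for j by (auto simp: field_simps)
  have T1: "(\<lambda>j. \<Sum>k. ?r j ^ k * ?a k) \<longlonglongrightarrow> (LINT x|sphere_measure. (f x)\<^sup>2)"
    using T(1) by (simp add: power2_eq_square)
  have "(\<Sum>k<n. ?a k) \<le> (LINT x|sphere_measure. (f x)\<^sup>2)" for n
  proof (rule LIMSEQ_le[OF _ T1])
    have "(\<lambda>j. ?r j) \<longlonglongrightarrow> 1" by real_asymp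
    then have "(\<lambda>j. \<Sum>k<n. ?r j ^ k * ?a k) \<longlonglongrightarrow> (\<Sum>k<n. 1 ^ k * ?a k)"
      by (intro tendsto_intros)
    then show "(\<lambda>j. \<Sum>k<n. ?r j ^ k * ?a k) \<longlonglongrightarrow> (\<Sum>k<n. ?a k)" by simp
    show "\<exists>N. \<forall>j\<ge>N. (\<Sum>k<n. ?r j ^ k * ?a k) \<le> (\<Sum>k. ?r j ^ k * ?a k)"
      using T(2)[OF r] a0 r less_imp_le[OF r(1)]
      by (intro exI allI impI sum_le_suminf) (auto intro!: mult_nonneg_nonneg zero_le_power simp del: of_nat_add)
  qed
  then have "summable ?a" using a0 by (intro summableI_nonneg_bounded) auto
  then show ?thesis using T1 a0 by (intro abel_sums) auto
qed

section \<open>Expansion of smooth functions\<close>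

lemma zproj_cong: "(\<And>y. norm y = 1 \<Longrightarrow> f y = g y) \<Longrightarrow> zproj l k f x = zproj l k g x"
  unfolding zproj_def by (intro arg_cong2[where f = "(/)"] integral_sphere_cong) auto

definition slap_eigenvalue :: "real \<Rightarrow> nat \<Rightarrow> real" where
  "slap_eigenvalue l k = 2 * real k * (real k + 2 * l)"

lemma zproj_slap:
  fixes G :: "'a::euclidean_space \<Rightarrow> real"
  assumes N: "real DIM('a) = 2 * l + 2" and U: "open U" "sphere 0 1 \<subseteq> U" "smooth_on G U"
  shows "zproj l k (slap G) x = - slap_eigenvalue l k * zproj l k G x"
proof -
  have z: "(\<lambda>y. zonal l k x y) \<in> spherical_harmonics k"
    using zonal_spherical_harmonic[OF N, of k x] by (simp add: zonal_commute[of l k x])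
  have "(LINT y|sphere_measure. zonal l k x y * slap G y) = (LINT y|sphere_measure. slap (\<lambda>y. zonal l k x y) y * G y)"
    by (rule integral_slap_symmetric[OF U(1,2) smooth_on_subset[OF spherical_harmonicsD(4)[OF z]] U(3), symmetric]) simp
  also have "\<dots> = (LINT y|sphere_measure. - slap_eigenvalue l k * (zonal l k x y * G y))"
    by (rule integral_sphere_cong) (simp add: slap_spherical_harmonic[OF z] N slap_eigenvalue_def)
  also have "\<dots> = - slap_eigenvalue l k * (LINT y|sphere_measure. zonal l k x y * G y)"
    by (rule integral_mult_right_zero)
  finally show ?thesis by (simp add: zproj_def)
qed

text \<open>Moving m powers of the symmetric operator \<open>slap\<close> onto f multiplies the
  component by the m-th power of the eigenvalue, while the size of the result stays controlled by
  the zonal bound. For k \<ge> 1 the eigenvalue is at least k + 1; degree 0, where it vanishes, is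
  estimated directly.\<close>

lemma zproj_rapid_decay:
  fixes f :: "'a::euclidean_space \<Rightarrow> real"
  assumes f: "smooth_on_sphere f" and N: "real DIM('a) = 2 * l + 2" and l: "0 < l"
  obtains C where "\<And>k x. norm x = 1 \<Longrightarrow> (real k + 1) ^ J * \<bar>zproj l k f x\<bar> \<le> C"
proof -
  obtain U F where U: "open U" "sphere 0 1 \<subseteq> U" "smooth_on F U" and F: "\<And>x. x \<in> sphere 0 1 \<Longrightarrow> F x = f x"
    using smooth_on_sphereE[OF f] by blast
  obtain C q where C: "0 < C" "\<And>k x y. norm (x::'a) = 1 \<Longrightarrow> norm y = 1 \<Longrightarrow> \<bar>zonal l k x y\<bar> \<le> C * (real k + 1) ^ q"
    using zonal_bound[OF l] by metis
  have sm: "smooth_on ((slap ^^ m) F) U" for m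
    by (induction m) (auto intro: smooth_on_slap U)
  have cont: "continuous_on (sphere 0 1) ((slap ^^ m) F)" for m
    using smooth_on_continuous[OF sm] U(2) continuous_on_subset by blast
  have it: "zproj l k ((slap ^^ m) F) x = (- slap_eigenvalue l k) ^ m * zproj l k F x" for k m x
    by (induction m) (simp_all add: zproj_slap[OF N U(1,2) sm])
  have fF: "zproj l k f x = zproj l k F x" for k x
    by (rule zproj_cong) (simp add: F)
  \<comment> \<open>J powers for the decay that is claimed, and q more to compensate the growth of
    the zonal kernel.\<close>
  let ?m = "J + q"
  obtain B where B: "0 < B" "\<And>x. norm x = 1 \<Longrightarrow> \<bar>(slap ^^ ?m) F x\<bar> \<le> B"
    using continuous_on_sphere_bounded[OF cont] by blast
  obtain B0 where B0: "0 < B0" "\<And>x. norm x = 1 \<Longrightarrow> \<bar>F x\<bar> \<le> B0"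
    using continuous_on_sphere_bounded[OF cont[of 0]] by auto
  have "(real k + 1) ^ J * \<bar>zproj l k f x\<bar> \<le> C * B + C * B0" if x: "norm x = 1" for k x
  proof (cases "k = 0")
    case True
    have "\<bar>zproj l k F x\<bar> \<le> C * (real k + 1) ^ q * B0"
      using cont[of 0] by (intro zproj_bound B0 C x) auto
    then show ?thesis using True B(1) C(1) by (simp add: fF add_increasing)
  next
    case False
    then have k: "1 \<le> real k" by simp
    have "real k + 1 \<le> 2 * real k * 1" using k by simp
    also have "\<dots> \<le> 2 * real k * (real k + 2 * l)" using k l by (intro mult_left_mono) auto
    finally have e: "real k + 1 \<le> slap_eigenvalue l k" by (simp add: slap_eigenvalue_def)
    have "(real k + 1) ^ ?m * \<bar>zproj l k F x\<bar> \<le> slap_eigenvalue l k ^ ?m * \<bar>zproj l k F x\<bar>"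
      using e by (intro mult_right_mono power_mono) auto
    also have "\<dots> = \<bar>zproj l k ((slap ^^ ?m) F) x\<bar>"
      using e by (simp add: it abs_mult power_abs)
    also have "\<dots> \<le> C * (real k + 1) ^ q * B"
      by (intro zproj_bound cont B C x)
    finally have "(real k + 1) ^ q * ((real k + 1) ^ J * \<bar>zproj l k F x\<bar>) \<le> (real k + 1) ^ q * (C * B)"
      by (simp add: power_add ac_simps)
    then have "(real k + 1) ^ J * \<bar>zproj l k F x\<bar> \<le> C * B"
      by (rule mult_left_le_imp_le) simp
    then show ?thesis using C(1) B0(1) by (simp add: fF add_increasing2)
  qed
  then show ?thesis by (rule that)
qed

lemma summable_inverse_square: "summable (\<lambda>k. C / (real k + 1)\<^sup>2)"
proof -
  have "summable (\<lambda>k. inverse (real k ^ 2))" by (rule inverse_power_summable) simp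
  then have "summable (\<lambda>k. inverse (real (Suc k) ^ 2))" by (subst summable_Suc_iff)
  from summable_mult[OF this, of C] show ?thesis by (simp add: field_simps)
qed

text \<open>Decay of order J + 2 beats coefficients of order J and leaves the summable majorant 1 /
  (k + 1)^2, uniformly in x.\<close>

lemma zproj_smooth_summable:
  fixes f :: "'a::euclidean_space \<Rightarrow> real"
  assumes f: "smooth_on_sphere f" and N: "real DIM('a) = 2 * l + 2" and l: "0 < l"
    and c: "\<And>k. \<bar>c k\<bar> \<le> L * (real k + 1) ^ J"
  obtains b where "\<And>k x. norm x = 1 \<Longrightarrow> \<bar>c k * zproj l k f x\<bar> \<le> b k" "summable b"
proof -
  obtain C where C: "\<And>k x. norm (x::'a) = 1 \<Longrightarrow> (real k + 1) ^ (J + 2) * \<bar>zproj l k f x\<bar> \<le> C"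
    using zproj_rapid_decay[OF f N l, of "J + 2"] by blast
  have L: "0 \<le> L" using c[of 0] by simp
  have "\<bar>c k * zproj l k f x\<bar> \<le> L * C / (real k + 1)\<^sup>2" if x: "norm x = 1" for k x
  proof -
    have "(real k + 1)\<^sup>2 * \<bar>c k * zproj l k f x\<bar> \<le> (real k + 1)\<^sup>2 * (L * (real k + 1) ^ J * \<bar>zproj l k f x\<bar>)"
      unfolding abs_mult using c[of k] by (intro mult_left_mono mult_right_mono) auto
    also have "\<dots> = L * ((real k + 1) ^ (J + 2) * \<bar>zproj l k f x\<bar>)"
      by (simp only: power_add) (simp add: ac_simps)
    also have "\<dots> \<le> L * C" using C[OF x] L by (intro mult_left_mono)
    finally show ?thesis by (simp add: divide_simps mult.commute)
  qed
  then show ?thesis using summable_inverse_square by (rule that)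
qed

lemma zproj_smooth_sums:
  fixes f :: "'a::euclidean_space \<Rightarrow> real"
  assumes f: "smooth_on_sphere f" and N: "real DIM('a) = 2 * l + 2" and l: "0 < l" and x: "norm x = 1"
  shows "(\<lambda>k. zproj l k f x) sums f x"
proof (rule abel_sums)
  note fc = smooth_on_sphere_continuous[OF f]
  obtain b where b: "\<And>k x. norm (x::'a) = 1 \<Longrightarrow> \<bar>1 * zproj l k f x\<bar> \<le> b k" "summable b"
    using zproj_smooth_summable[OF f N l, of "\<lambda>_. 1" 1 0] by auto
  show "summable (\<lambda>k. \<bar>zproj l k f x\<bar>)"
    by (rule summable_comparison_test'[OF b(2)]) (use b(1)[OF x] in auto)
  have r: "0 < 1 - 1 / real (j + 2)" "1 - 1 / real (j + 2) < 1" for j by (auto simp: field_simps)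
  have "(\<lambda>j. poisson_mean l (1 - 1 / real (j + 2)) f x) \<longlonglongrightarrow> f x"
    by (rule filterlim_compose[OF poisson_mean_tendsto[OF fc N l x] filterlim_at_left_1])
  moreover have "poisson_mean l (1 - 1 / real (j + 2)) f x = (\<Sum>k. (1 - 1 / real (j + 2)) ^ k * zproj l k f x)" for j
    unfolding poisson_mean_def by (rule sums_unique[OF poisson_integral_sums(2)[OF fc l r x]])
  ultimately show "(\<lambda>j. \<Sum>k. (1 - 1 / real (j + 2)) ^ k * zproj l k f x) \<longlonglongrightarrow> f x" by simp
qed

section \<open>Growth of the eigenvalues and termwise evaluation of the operator\<close>

lemma P_eigenvalue_Suc:
  assumes "\<sigma> < 1" "2 \<le> n" "0 < \<sigma>"
  shows "P_eigenvalue n \<sigma> (Suc k) = (real k + real n / 2 + \<sigma>) / (real k + real n / 2 - \<sigma>) * P_eigenvalue n \<sigma> k"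
proof -
  have "real k + real n / 2 - \<sigma> > 0" "real k + real n / 2 + \<sigma> > 0" using assms by auto
  then have "Gamma (real k + real n / 2 + \<sigma> + 1) = (real k + real n / 2 + \<sigma>) * Gamma (real k + real n / 2 + \<sigma>)"
    "Gamma (real k + real n / 2 - \<sigma> + 1) = (real k + real n / 2 - \<sigma>) * Gamma (real k + real n / 2 - \<sigma>)"
    by (auto intro!: Gamma_plus1 simp: nonpos_Ints_def)
  then show ?thesis by (simp add: P_eigenvalue_def algebra_simps)
qed

lemma P_eigenvalue_bounds:
  assumes "0 < \<sigma>" "\<sigma> < 1" "2 \<le> n"
  shows "0 < P_eigenvalue n \<sigma> k" "j \<le> k \<Longrightarrow> P_eigenvalue n \<sigma> j \<le> P_eigenvalue n \<sigma> k"
    "\<exists>J. \<forall>k. P_eigenvalue n \<sigma> k \<le> P_eigenvalue n \<sigma> 0 * (real k + 1) ^ J"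
proof -
  have pos: "real k + real n / 2 - \<sigma> > 0" "real k + real n / 2 + \<sigma> > 0" for k using assms by auto
  show p: "0 < P_eigenvalue n \<sigma> k" for k
    unfolding P_eigenvalue_def using pos by (intro divide_pos_pos Gamma_real_pos) 
  have "P_eigenvalue n \<sigma> k \<le> P_eigenvalue n \<sigma> (Suc k)" for k
  proof -
    have "1 \<le> (real k + real n / 2 + \<sigma>) / (real k + real n / 2 - \<sigma>)" using pos[of k] assms by simp
    from mult_right_mono[OF this, of "P_eigenvalue n \<sigma> k"] show ?thesis
      using p[of k] by (simp add: P_eigenvalue_Suc[OF assms(2,3,1)])
  qed
  then show "j \<le> k \<Longrightarrow> P_eigenvalue n \<sigma> j \<le> P_eigenvalue n \<sigma> k"
    by (rule lift_Suc_mono_le)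
  \<comment> \<open>Since n \<ge> 2, the denominator k + n/2 - \<sigma> is at least (1 - \<sigma>)
    (k + 1). So the ratio of consecutive eigenvalues is at most 1 + J / (k + 1) for this J, and
    Bernoulli's inequality compares it with the ratio of consecutive powers (k + 1)^J.\<close>
  obtain J :: nat where J: "2 / (1 - \<sigma>) \<le> real J" using real_arch_simple by blast
  have "P_eigenvalue n \<sigma> k \<le> P_eigenvalue n \<sigma> 0 * (real k + 1) ^ J" for k
  proof (induction k)
    case (Suc k)
    have "(1 - \<sigma>) * (real k + 1) \<le> real k + real n / 2 - \<sigma>"
    proof -
      have "0 \<le> \<sigma> * real k" "1 \<le> real n / 2" using assms by auto
      moreover have "(1 - \<sigma>) * (real k + 1) = real k - \<sigma> * real k + 1 - \<sigma>" by (simp add: algebra_simps)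
      ultimately show ?thesis by linarith
    qed
    then have "2 * \<sigma> / (real k + real n / 2 - \<sigma>) \<le> 2 / ((1 - \<sigma>) * (real k + 1))"
      using assms pos[of k] by (intro frac_le) auto
    also have "\<dots> = 2 / (1 - \<sigma>) / (real k + 1)" by simp
    also have "\<dots> \<le> real J / (real k + 1)" using J by (intro divide_right_mono) auto
    finally have "1 + 2 * \<sigma> / (real k + real n / 2 - \<sigma>) \<le> 1 + real J * (1 / (real k + 1))" by simp
    also have "\<dots> \<le> (1 + 1 / (real k + 1)) ^ J"
      using Bernoulli_inequality[of "1 / (real k + 1)" J] order_trans[of "-1" 0 "1 / (real k + 1)"] by simp
    also have "1 + 2 * \<sigma> / (real k + real n / 2 - \<sigma>) = (real k + real n / 2 + \<sigma>) / (real k + real n / 2 - \<sigma>)"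
      using pos[of k] by (simp add: field_simps)
    finally have "P_eigenvalue n \<sigma> (Suc k) \<le> (1 + 1 / (real k + 1)) ^ J * (P_eigenvalue n \<sigma> 0 * (real k + 1) ^ J)"
      unfolding P_eigenvalue_Suc[OF assms(2,3,1)] using Suc p[of k] by (intro mult_mono) auto
    also have "\<dots> = P_eigenvalue n \<sigma> 0 * ((1 + 1 / (real k + 1)) * (real k + 1)) ^ J"
      by (simp only: power_mult_distrib) (simp add: ac_simps)
    also have "(1 + 1 / (real k + 1)) * (real k + 1) = real (Suc k) + 1" by (simp add: field_simps)
    finally show ?case .
  qed simp
  then show "\<exists>J. \<forall>k. P_eigenvalue n \<sigma> k \<le> P_eigenvalue n \<sigma> 0 * (real k + 1) ^ J" by blast
qed

text \<open>The components of a smooth f decay faster than any power and the eigenvalues grow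
  polynomially, so everything may be integrated termwise. The partner g is only continuous: in the
  application it involves a power of |v|, which is not smooth at the zeros of v.\<close>

lemma P_sphere_integral:
  fixes f :: "'a::euclidean_space \<Rightarrow> real"
  assumes f: "smooth_on_sphere f" and N: "real DIM('a) = 2 * l + 2" and l: "0 < l"
    and g: "continuous_on (sphere 0 1) g" and \<sigma>: "0 < \<sigma>" "\<sigma> < 1" and n: "2 \<le> n"
  shows "integrable sphere_measure (\<lambda>x. P_sphere n \<sigma> f x * g x)"
    and "(\<lambda>k. P_eigenvalue n \<sigma> k * (LINT x|sphere_measure. zproj l k f x * g x)) sums
      (LINT x|sphere_measure. P_sphere n \<sigma> f x * g x)"
    and "summable (\<lambda>k. P_eigenvalue n \<sigma> k * \<bar>LINT x|sphere_measure. zproj l k f x * g x\<bar>)"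
proof -
  note fc = smooth_on_sphere_continuous[OF f]
  obtain J where J: "\<And>k. P_eigenvalue n \<sigma> k \<le> P_eigenvalue n \<sigma> 0 * (real k + 1) ^ J"
    using P_eigenvalue_bounds(3)[OF \<sigma> n] by blast
  note pos = P_eigenvalue_bounds(1)[OF \<sigma> n]
  have "\<bar>P_eigenvalue n \<sigma> k\<bar> \<le> P_eigenvalue n \<sigma> 0 * (real k + 1) ^ J" for k
    using J[of k] pos[of k] by simp
  then obtain b where b: "\<And>k x. norm (x::'a) = 1 \<Longrightarrow> \<bar>P_eigenvalue n \<sigma> k * zproj l k f x\<bar> \<le> b k" "summable b"
    using zproj_smooth_summable[OF f N l] by metis
  have u: "continuous_on (sphere 0 1) (\<lambda>x. P_eigenvalue n \<sigma> k * zproj l k f x)" for k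
    by (intro continuous_on_mult continuous_on_const zproj_continuous fc)
  have F: "(\<lambda>k. P_eigenvalue n \<sigma> k * zproj l k f x) sums P_sphere n \<sigma> f x" if x: "norm x = 1" for x
    unfolding P_sphere_def harmonic_component_eq[OF fc N l]
    by (rule summable_sums, rule summable_comparison_test'[OF b(2)]) (use b(1)[OF x] in auto)
  note S = sphere_series_integral[OF u g b F]
  show "integrable sphere_measure (\<lambda>x. P_sphere n \<sigma> f x * g x)" by (rule S(1))
  from S(2) show "(\<lambda>k. P_eigenvalue n \<sigma> k * (LINT x|sphere_measure. zproj l k f x * g x)) sums
      (LINT x|sphere_measure. P_sphere n \<sigma> f x * g x)" by (simp add: mult.assoc)
  obtain A where A: "0 < A" "\<And>x. norm x = 1 \<Longrightarrow> \<bar>g x\<bar> \<le> A"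
    using continuous_on_sphere_bounded[OF g] by blast
  have "P_eigenvalue n \<sigma> k * \<bar>LINT x|sphere_measure. zproj l k f x * g x\<bar> \<le> A * sphere_area TYPE('a) * b k" for k
  proof -
    have "P_eigenvalue n \<sigma> k * \<bar>LINT x|sphere_measure. zproj l k f x * g x\<bar> =
        \<bar>LINT x|sphere_measure. P_eigenvalue n \<sigma> k * zproj l k f x * g x\<bar>"
      using pos[of k] by (simp add: abs_mult mult.assoc)
    also have "\<dots> \<le> (LINT x|sphere_measure. \<bar>P_eigenvalue n \<sigma> k * zproj l k f x * g x\<bar>)" by simp
    also have "\<dots> \<le> (LINT x|(sphere_measure::'a measure). b k * A)"
    proof (rule integral_mono)
      show "integrable sphere_measure (\<lambda>x. \<bar>P_eigenvalue n \<sigma> k * zproj l k f x * g x\<bar>)"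
        using integrable_sphere[OF continuous_on_mult[OF u g], of k] by simp
      fix x :: 'a assume "x \<in> space sphere_measure"
      then have x: "norm x = 1" by simp
      show "\<bar>P_eigenvalue n \<sigma> k * zproj l k f x * g x\<bar> \<le> b k * A"
        unfolding abs_mult[of _ "g x"] using b(1)[OF x, of k] A(2)[OF x]
        by (intro mult_mono) (auto intro: order_trans[OF abs_ge_zero])
    qed simp
    finally show ?thesis by (simp add: ac_simps sphere_area_def)
  qed
  then show "summable (\<lambda>k. P_eigenvalue n \<sigma> k * \<bar>LINT x|sphere_measure. zproj l k f x * g x\<bar>)"
    using pos by (intro summable_comparison_test'[OF summable_mult[OF b(2), of "A * sphere_area TYPE('a)"]])
      (simp add: abs_mult less_imp_le)
qed

lemma zproj_smooth_integral_sums: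
  fixes f :: "'a::euclidean_space \<Rightarrow> real"
  assumes f: "smooth_on_sphere f" and N: "real DIM('a) = 2 * l + 2" and l: "0 < l"
    and g: "continuous_on (sphere 0 1) g"
  shows "(\<lambda>k. LINT x|sphere_measure. zproj l k f x * g x) sums (LINT x|sphere_measure. f x * g x)"
proof -
  note fc = smooth_on_sphere_continuous[OF f]
  obtain b where b: "\<And>k x. norm (x::'a) = 1 \<Longrightarrow> \<bar>1 * zproj l k f x\<bar> \<le> b k" "summable b"
    using zproj_smooth_summable[OF f N l, of "\<lambda>_. 1" 1 0] by auto
  show ?thesis
    by (rule sphere_series_integral(2)[OF zproj_continuous[OF fc] g _ b(2) zproj_smooth_sums[OF f N l]])
       (use b(1) in auto)
qed

section \<open>The eigenvalues as integrals of kernel multipliers\<close>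

text \<open>A remainder of order (1 - r)^2 with an explicit constant. It outweighs the singular
  factor (1 - r)^(-2s) for every s < 1.\<close>

lemma powr_Taylor_2:
  fixes c r :: real
  assumes "1 / 2 \<le> r" "r < 1"
  shows "\<bar>r powr c - 1 + c * (1 - r)\<bar> \<le> \<bar>c * (c - 1)\<bar> * (1 + (1 / 2) powr (c - 2)) * (1 - r)\<^sup>2"
proof -
  define D where "D m t = (if m = 0 then t powr c else if m = 1 then c * t powr (c - 1)
      else c * (c - 1) * t powr (c - 2))" for m :: nat and t :: real
  have "\<exists>t. (if r < 1 then r < t \<and> t < 1 else 1 < t \<and> t < r) \<and>
      r powr c = (\<Sum>m<2. D m 1 / fact m * (r - 1) ^ m) + D 2 t / fact 2 * (r - 1) ^ 2"
  proof (rule Taylor[where a = "1/2" and b = 1])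
    show "D 0 = (\<lambda>t. t powr c)" by (auto simp: D_def)
    show "\<forall>m t. m < 2 \<and> 1 / 2 \<le> t \<and> t \<le> 1 \<longrightarrow> DERIV (D m) t :> D (Suc m) t"
    proof (intro allI impI)
      fix m :: nat and t :: real assume m: "m < 2 \<and> 1 / 2 \<le> t \<and> t \<le> 1"
      then have t: "0 < t" by auto
      from m have "m = 0 \<or> m = 1" by auto
      then show "DERIV (D m) t :> D (Suc m) t"
      proof
        assume "m = 0"
        then show ?thesis using has_real_derivative_powr[OF t, of c] by (simp add: D_def[abs_def])
      next
        assume "m = 1"
        then show ?thesis using DERIV_cmult[OF has_real_derivative_powr[OF t, of "c - 1"], of c]
          by (simp add: D_def[abs_def] mult.assoc)
      qed
    qed
  qed (use assms in auto)
  then obtain t where t: "r < t" "t < 1"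
    and e: "r powr c = (\<Sum>m<2. D m 1 / fact m * (r - 1) ^ m) + D 2 t / fact 2 * (r - 1) ^ 2"
    using assms by auto
  have "r powr c - 1 + c * (1 - r) = c * (c - 1) * (t powr (c - 2) / 2) * (1 - r)\<^sup>2"
    unfolding e by (simp add: D_def numeral_2_eq_2 power2_commute algebra_simps)
  then have "\<bar>r powr c - 1 + c * (1 - r)\<bar> = \<bar>c * (c - 1) * (t powr (c - 2) / 2) * (1 - r)\<^sup>2\<bar>"
    by (simp only:)
  also have "\<dots> = \<bar>c * (c - 1)\<bar> * (t powr (c - 2) / 2) * (1 - r)\<^sup>2"
    by (simp add: abs_mult)
  \<comment> \<open>The intermediate point t lies between 1/2 and 1, so t^(c-2) is at most 1 or at
    most (1/2)^(c-2), depending on the sign of c - 2.\<close>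
  also have "t powr (c - 2) / 2 \<le> 1 + (1 / 2) powr (c - 2)"
  proof (cases "2 \<le> c")
    case True
    then have "t powr (c - 2) \<le> 1 powr (c - 2)" using t assms by (intro powr_mono2) auto
    then show ?thesis by (simp add: add_increasing2)
  next
    case False
    then have "t powr (c - 2) \<le> (1 / 2) powr (c - 2)" using t assms by (intro powr_mono2') auto
    moreover have "0 \<le> t powr (c - 2)" by simp
    ultimately show ?thesis by linarith
  qed
  finally show ?thesis by (simp add: mult_left_mono mult_right_mono)
qed

lemma powr_Taylor_2_tendsto:
  fixes c s :: real
  assumes "s < 1"
  shows "((\<lambda>r. (r powr c - 1 + c * (1 - r)) * (1 - r) powr (- 2 * s)) \<longlongrightarrow> 0) (at_left 1)"
proof (rule Lim_null_comparison)
  let ?K = "\<bar>c * (c - 1)\<bar> * (1 + (1 / 2) powr (c - 2))"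
  have "\<forall>\<^sub>F r in at_left (1::real). 1 / 2 < r \<and> r < 1"
    using eventually_at_left_real[of "1/2" "1::real"] by (auto elim!: eventually_mono)
  then show "\<forall>\<^sub>F r in at_left 1. norm ((r powr c - 1 + c * (1 - r)) * (1 - r) powr (- 2 * s)) \<le> ?K * (1 - r) powr (2 - 2 * s)"
  proof eventually_elim
    case (elim r)
    have "(1 - r) powr (2 - 2 * s) = (1 - r)\<^sup>2 * (1 - r) powr (- 2 * s)"
      using elim powr_add[of "1 - r" 2 "- 2 * s"] by simp
    then show ?case
      using powr_Taylor_2[of r c] elim by (simp add: abs_mult mult_right_mono mult.assoc[symmetric])
  qed
  show "((\<lambda>r. ?K * (1 - r) powr (2 - 2 * s)) \<longlongrightarrow> 0) (at_left 1)"
    using assms by (intro tendsto_mult_right_zero) real_asymp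
qed

text \<open>
  Obtained from \<open>kmult l k * kweight l s\<close> by integrating by parts until the remaining integrand is
  that of a Beta integral which converges for all \<open>s < 1\<close>.
\<close>

definition kint_primitive :: "real \<Rightarrow> real \<Rightarrow> real \<Rightarrow> real" where
  "kint_primitive s x r = r powr x * (1 - r) powr (- 2 * s) / (1 + r)
     + (1 - 2 * s) / (4 * s) * (r powr x * (1 - r) powr (- 2 * s))
     + (x - 2 * s) / (4 * s) * (r powr x * (1 - r) powr (1 - 2 * s))"

lemma kint_primitive_at_0:
  assumes "0 < s" "s < 1" "0 < x"
  shows "(kint_primitive s x \<longlongrightarrow> 0) (at_right 0)"
proof -
  have "((\<lambda>r. r powr x * (1 - r) powr (- 2 * s) / (1 + r)) \<longlongrightarrow> 0) (at_right 0)"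
    "((\<lambda>r. r powr x * (1 - r) powr (- 2 * s)) \<longlongrightarrow> 0) (at_right 0)"
    "((\<lambda>r. r powr x * (1 - r) powr (1 - 2 * s)) \<longlongrightarrow> 0) (at_right 0)"
    using assms by real_asymp+
  then have "((\<lambda>r. r powr x * (1 - r) powr (- 2 * s) / (1 + r)
     + (1 - 2 * s) / (4 * s) * (r powr x * (1 - r) powr (- 2 * s))
     + (x - 2 * s) / (4 * s) * (r powr x * (1 - r) powr (1 - 2 * s))) \<longlongrightarrow>
     0 + (1 - 2 * s) / (4 * s) * 0 + (x - 2 * s) / (4 * s) * 0) (at_right 0)"
    by (intro tendsto_add tendsto_mult tendsto_const)
  then show ?thesis by (simp add: kint_primitive_def[abs_def])
qed

text \<open>Each primitive diverges at 1 like (1 - r)^(-2s) / (4 s). The divergent part does not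
  depend on the exponent of r, and the rest, made of a second-order Taylor remainder and a term in
  (1 - r)^(2-2s), tends to 0.\<close>

lemma kint_primitive_at_1:
  assumes s: "0 < s" "s < 1"
  shows "((\<lambda>r. kint_primitive s a r - kint_primitive s b r) \<longlongrightarrow> 0) (at_left 1)"
proof -
  define A where "A c r = (r powr c - 1 + c * (1 - r)) * (1 - r) powr (- 2 * s)" for c r :: real
  define R where "R c r = A c r * (1 / (4 * s) + (1 - r) / (2 * (1 + r)) + (c - 2 * s) / (4 * s) * (1 - r))
      - (c / (2 * (1 + r)) + c * (c - 2 * s) / (4 * s)) * (1 - r) powr (2 - 2 * s)" for c r :: real
  have A: "(A c \<longlongrightarrow> 0) (at_left 1)" for c
    unfolding A_def[abs_def] by (rule powr_Taylor_2_tendsto[OF s(2)])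
  have q: "((\<lambda>r. (1 - r) powr (2 - 2 * s)) \<longlongrightarrow> 0) (at_left 1)" using s by real_asymp
  have "(R c \<longlongrightarrow> 0 * (1 / (4 * s) + (1 - 1) / (2 * (1 + 1)) + (c - 2 * s) / (4 * s) * (1 - 1))
      - (c / (2 * (1 + 1)) + c * (c - 2 * s) / (4 * s)) * 0) (at_left 1)" for c
    unfolding R_def[abs_def] by (intro tendsto_intros A q) auto
  then have R: "(R c \<longlongrightarrow> 0) (at_left 1)" for c by simp
  have "kint_primitive s a r - kint_primitive s b r = R a r - R b r" if r: "0 < r" "r < 1" for r
  proof -
    define p where "p = (1 - r) powr (- 2 * s)"
    have p1: "(1 - r) powr (1 - 2 * s) = (1 - r) * p" "(1 - r) powr (2 - 2 * s) = (1 - r)\<^sup>2 * p"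
      using r powr_add[of "1 - r" 1 "- 2 * s"] powr_add[of "1 - r" 2 "- 2 * s"] by (simp_all add: p_def)
    \<comment> \<open>Substituting the expansion r^c = 1 - c (1 - r) + remainder: the two parts
      linear in c have been arranged so that what is left outside \<open>R\<close> is free of
      c.\<close>
    have "kint_primitive s c r = R c r + p * ((1 / (1 + r) + (1 - 2 * s) / (4 * s)) - (1 - r) / 2)" for c
    proof -
      define z where "z = r powr c"
      have ne: "s \<noteq> 0" "1 + r \<noteq> 0" using s r by auto
      have "kint_primitive s c r = p * (z / (1 + r) + (1 - 2 * s) / (4 * s) * z + (c - 2 * s) / (4 * s) * (z * (1 - r)))"
        unfolding kint_primitive_def p1 p_def[symmetric] z_def[symmetric] by (simp add: algebra_simps)
      moreover have "R c r = p * ((z - 1 + c * (1 - r)) * (1 / (4 * s) + (1 - r) / (2 * (1 + r)) + (c - 2 * s) / (4 * s) * (1 - r))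
          - (c / (2 * (1 + r)) + c * (c - 2 * s) / (4 * s)) * (1 - r)\<^sup>2)"
      proof -
        have "a * p * X - Y * (q * p) = p * (a * X - Y * q)" for a X Y q :: real
          by (simp add: algebra_simps)
        then show ?thesis unfolding R_def A_def p1 p_def[symmetric] z_def[symmetric] .
      qed
      moreover have "z / (1 + r) + (1 - 2 * s) / (4 * s) * z + (c - 2 * s) / (4 * s) * (z * (1 - r)) =
        ((z - 1 + c * (1 - r)) * (1 / (4 * s) + (1 - r) / (2 * (1 + r)) + (c - 2 * s) / (4 * s) * (1 - r))
          - (c / (2 * (1 + r)) + c * (c - 2 * s) / (4 * s)) * (1 - r)\<^sup>2)
        + ((1 / (1 + r) + (1 - 2 * s) / (4 * s)) - (1 - r) / 2)"
        using ne by (simp add: divide_simps) (simp add: algebra_simps power2_eq_square)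
      ultimately show ?thesis by (simp only: distrib_left)
    qed
    then show ?thesis by simp
  qed
  then have "\<forall>\<^sub>F r in at_left 1. R a r - R b r = kint_primitive s a r - kint_primitive s b r"
    using eventually_at_left_real[of 0 "1::real"] by (auto elim!: eventually_mono)
  with tendsto_diff[OF R R] show ?thesis by (auto intro: Lim_transform_eventually)
qed

text \<open>With n = 2 l + 1, the power of r completes r^k to r^(x-1) for x = k + n/2 + s, the
  numerator argument in the eigenvalue. After division by (1 - r^2)^3 the power of 1 - r becomes (1
  - r)^(-1-2s), that of the formal integral B(x, -2s). The factor 1 + r lowers the remaining
  denominator to (1 + r)^2, for which the primitive is elementary up to a Beta integrand.\<close>

definition kweight :: "real \<Rightarrow> real \<Rightarrow> real \<Rightarrow> real" where
  "kweight l s r = r powr (l - 1 / 2 + s) * (1 - r) powr (2 - 2 * s) * (1 + r)"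

lemma DERIV_kint_primitive:
  fixes l s r :: real and k :: nat
  defines "x \<equiv> real k + l + 1 / 2 + s"
  assumes s: "0 < s" "s < 1" and l: "0 < l" and r: "0 < r" "r < 1"
  shows "DERIV (kint_primitive s x) r :> (l + 1) * (kmult l k r * kweight l s r)
    + (x - 2 * s) * (x + 1 - 2 * s) / (4 * s) * (r powr (x - 1) * (1 - r) powr (1 - 2 * s))"
proof -
  \<comment> \<open>All terms are multiples of r^(x-1) (1 - r)^(-2s-1). With these powers split off,
    the claim is an identity between rational functions of r.\<close>
  define p where "p = (1 - r) powr (- 2 * s - 1)"
  define z where "z = r powr (x - 1)"
  have q: "0 < 1 - r" using r by simp
  have p1: "(1 - r) powr (- 2 * s) = (1 - r) * p" "(1 - r) powr (1 - 2 * s) = (1 - r)\<^sup>2 * p"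
    "(1 - r) powr (2 - 2 * s) = (1 - r) ^ 3 * p"
    using r powr_add[of "1 - r" 1 "- 2 * s - 1"] powr_add[of "1 - r" 2 "- 2 * s - 1"]
      powr_add[of "1 - r" 3 "- 2 * s - 1"] by (simp_all add: p_def)
  have z1: "r powr x = r * z" using r powr_add[of r 1 "x - 1"] by (simp add: z_def)
  have dr: "DERIV (\<lambda>r. r powr x) r :> x * z"
    using has_real_derivative_powr[OF r(1), of x] by (simp add: z_def)
  have dq: "DERIV (\<lambda>r. (1 - r) powr c) r :> - c * (1 - r) powr (c - 1)" for c
  proof -
    have "DERIV (\<lambda>r::real. 1 - r) r :> -1" by (auto intro!: derivative_eq_intros)
    from DERIV_fun_powr[OF this q, of c] show ?thesis by simp
  qed
  have dq1: "DERIV (\<lambda>r. (1 - r) powr (- 2 * s)) r :> 2 * s * p"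
    using dq[of "- 2 * s"] by (simp add: p_def)
  have dq2: "DERIV (\<lambda>r. (1 - r) powr (1 - 2 * s)) r :> - (1 - 2 * s) * ((1 - r) * p)"
    using dq[of "1 - 2 * s"] by (simp add: p1[symmetric])
  have d1: "DERIV (\<lambda>r. r powr x * (1 - r) powr (- 2 * s)) r :> x * z * ((1 - r) * p) + 2 * s * p * (r * z)"
    using DERIV_mult[OF dr dq1] by (simp only: p1 z1)
  have d2: "DERIV (\<lambda>r. r powr x * (1 - r) powr (1 - 2 * s)) r :>
      x * z * ((1 - r)\<^sup>2 * p) + - (1 - 2 * s) * ((1 - r) * p) * (r * z)"
    using DERIV_mult[OF dr dq2] by (simp only: p1 z1)
  have d3: "DERIV (\<lambda>r. r powr x * (1 - r) powr (- 2 * s) / (1 + r)) r :>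
      ((x * z * ((1 - r) * p) + 2 * s * p * (r * z)) * (1 + r) - r * z * ((1 - r) * p) * 1) / ((1 + r) * (1 + r))"
  proof -
    have "DERIV (\<lambda>r::real. 1 + r) r :> 1" by (auto intro!: derivative_eq_intros)
    moreover have "1 + r \<noteq> 0" using r by simp
    ultimately show ?thesis using DERIV_divide[OF d1] by (simp only: p1 z1)
  qed
  have W: "DERIV (kint_primitive s x) r :>
     ((x * z * ((1 - r) * p) + 2 * s * p * (r * z)) * (1 + r) - r * z * ((1 - r) * p) * 1) / ((1 + r) * (1 + r))
     + (1 - 2 * s) / (4 * s) * (x * z * ((1 - r) * p) + 2 * s * p * (r * z))
     + (x - 2 * s) / (4 * s) * (x * z * ((1 - r)\<^sup>2 * p) + - (1 - 2 * s) * ((1 - r) * p) * (r * z))"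
    unfolding kint_primitive_def[abs_def] by (intro DERIV_add DERIV_cmult d1 d2 d3)
  have zk: "r ^ k * r powr (l - 1 / 2 + s) = z"
    using r powr_add[of r "real k" "l - 1 / 2 + s"] by (simp add: powr_realpow z_def x_def algebra_simps)
  have km: "(l + 1) * (kmult l k r * kweight l s r) =
      z * p * ((l + 1 + real k) * (1 - r\<^sup>2) + 2 * r\<^sup>2) / ((1 + r) * (1 + r))"
  proof -
    have f: "1 - r\<^sup>2 = (1 - r) * (1 + r)" by (simp add: power2_eq_square algebra_simps)
    have "(l + 1) * (kmult l k r * kweight l s r) = (r ^ k * r powr (l - 1 / 2 + s)) *
       (((l + 1 + real k) * (1 - r\<^sup>2) + 2 * r\<^sup>2) * ((1 - r) ^ 3 * p) * (1 + r) / ((1 - r) ^ 3 * (1 + r) ^ 3))"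
      unfolding kmult_def kweight_def p1 using l q r
      by (simp add: f power_mult_distrib divide_simps) 
    also have "\<dots> = z * p * ((l + 1 + real k) * (1 - r\<^sup>2) + 2 * r\<^sup>2) / ((1 + r) * (1 + r))"
      unfolding zk using q r by (simp add: divide_simps power3_eq_cube)
    finally show ?thesis .
  qed
  show ?thesis
  proof (rule DERIV_cong[OF W])
    have ne: "s \<noteq> 0" "1 + r \<noteq> 0" using s r by auto
    have l1: "l + 1 + real k = x + 1 / 2 - s" by (simp add: x_def)
    show "((x * z * ((1 - r) * p) + 2 * s * p * (r * z)) * (1 + r) - r * z * ((1 - r) * p) * 1) / ((1 + r) * (1 + r))
     + (1 - 2 * s) / (4 * s) * (x * z * ((1 - r) * p) + 2 * s * p * (r * z))
     + (x - 2 * s) / (4 * s) * (x * z * ((1 - r)\<^sup>2 * p) + - (1 - 2 * s) * ((1 - r) * p) * (r * z)) =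
     (l + 1) * (kmult l k r * kweight l s r)
    + (x - 2 * s) * (x + 1 - 2 * s) / (4 * s) * (r powr (x - 1) * (1 - r) powr (1 - 2 * s))"
      unfolding km p1 z_def[symmetric] l1 using ne
      by (simp add: divide_simps) (simp add: algebra_simps power2_eq_square)
  qed
qed

section \<open>Evaluation of the integrals over r\<close>

text \<open>The incomplete Beta integral. In the application b = 2 - 2 s, so the integrand is
  unbounded at 1 when s > 1/2 and the limit there is taken by continuity of the indefinite
  integral.\<close>

lemma Beta_primitive:
  fixes a b :: real
  assumes a: "1 \<le> a" and b: "0 < b"
  obtains B where "\<And>r. 0 < r \<Longrightarrow> r < 1 \<Longrightarrow> DERIV B r :> r powr (a - 1) * (1 - r) powr (b - 1)"
    "(B \<longlongrightarrow> 0) (at_right 0)" "(B \<longlongrightarrow> Beta a b) (at_left 1)"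
proof
  let ?f = "\<lambda>t. t powr (a - 1) * (1 - t) powr (b - 1)"
  let ?B = "\<lambda>r. integral {0..r} ?f"
  have I: "(?f has_integral Beta a b) {0..1}" using a b by (intro has_integral_Beta_real) auto
  then have int: "?f integrable_on {0..1}" by blast
  show "DERIV ?B r :> ?f r" if r: "0 < r" "r < 1" for r
  proof -
    have "isCont ?f r" using r by (intro continuous_intros) auto
    then have c: "continuous (at r within {0..1} - {}) ?f" by (simp add: continuous_at_imp_continuous_at_within)
    have "(?B has_vector_derivative ?f r) (at r within {0..1} - {})"
      by (rule integral_has_vector_derivative_continuous_at[OF int _ _ c]) (use r in auto)
    then have "(?B has_real_derivative ?f r) (at r within {0..1})"
      by (simp add: has_real_derivative_iff_has_vector_derivative)
    moreover have "at r within {0..1} = at r" using r by (intro at_within_interior) auto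
    ultimately show ?thesis by simp
  qed
  have cont: "continuous_on {0..1} ?B" by (rule indefinite_integral_continuous_1[OF int])
  have "(?B \<longlongrightarrow> ?B 0) (at 0 within {0..1})" "(?B \<longlongrightarrow> ?B 1) (at 1 within {0..1})"
    using bspec[OF iffD1[OF continuous_on cont], of 0] bspec[OF iffD1[OF continuous_on cont], of 1] by simp_all
  moreover have "at (0::real) within {0..1} = at_right 0" "at (1::real) within {0..1} = at_left 1"
    by (auto intro!: at_within_Icc_at_right at_within_Icc_at_left)
  ultimately show "(?B \<longlongrightarrow> 0) (at_right 0)" "(?B \<longlongrightarrow> Beta a b) (at_left 1)"
    using integral_unique[OF I] by auto
qed

text \<open>Each of the two summands behaves like (1 - r)^(-1-2s) at 1 and is not integrable by
  itself. The difference has the primitive \<open>?V\<close>, whose limits exist at both ends, and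
  it is nonnegative, so the fundamental theorem on the open interval gives integrability together
  with the value.\<close>

lemma integral_kmult_difference:
  fixes l s :: real and k n :: nat
  assumes n: "2 \<le> n" "2 * l + 1 = real n" and s: "0 < s" "s < 1"
  shows "set_integrable lborel {0<..<1} (\<lambda>r. (kmult l 0 r - kmult l k r) * kweight l s r)"
    and "(LINT r:{0<..<1}|lborel. (kmult l 0 r - kmult l k r) * kweight l s r) =
      Gamma (2 - 2 * s) / (4 * s * (l + 1)) * (P_eigenvalue n s k - P_eigenvalue n s 0)"
proof -
  have l: "0 < l" using n by auto
  let ?x = "\<lambda>k. real k + l + 1 / 2 + s"
  let ?c = "\<lambda>k. (?x k - 2 * s) * (?x k + 1 - 2 * s) / (4 * s)"
  have x1: "1 \<le> ?x k" for k using n s by auto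
  have b: "0 < 2 - 2 * s" using s by simp
  have "\<exists>B. (\<forall>r. 0 < r \<longrightarrow> r < 1 \<longrightarrow> DERIV B r :> r powr (?x k - 1) * (1 - r) powr (2 - 2 * s - 1)) \<and>
      (B \<longlongrightarrow> 0) (at_right 0) \<and> (B \<longlongrightarrow> Beta (?x k) (2 - 2 * s)) (at_left 1)" for k
    using Beta_primitive[OF x1[of k] b] by blast
  then obtain B where B: "\<And>k r. 0 < r \<Longrightarrow> r < 1 \<Longrightarrow> DERIV (B k) r :> r powr (?x k - 1) * (1 - r) powr (2 - 2 * s - 1)"
    "\<And>k. (B k \<longlongrightarrow> 0) (at_right 0)" "\<And>k. (B k \<longlongrightarrow> Beta (?x k) (2 - 2 * s)) (at_left 1)"
    by metis
  \<comment> \<open>Two steps of the functional equation of Gamma: the factors (x - 2s) (x + 1 - 2s)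
    left by the integration by parts cancel against Gamma (x + 2 - 2s) and leave Gamma (x - 2s) in
    the denominator.\<close>
  have cB: "?c k * Beta (?x k) (2 - 2 * s) = Gamma (2 - 2 * s) / (4 * s) * P_eigenvalue n s k" for k
  proof -
    have y: "?x k - 2 * s > 0" using n s by auto
    have "?x k + (2 - 2 * s) = (?x k - 2 * s + 1) + 1" by simp
    then have "Gamma (?x k + (2 - 2 * s)) = (?x k - 2 * s + 1) * ((?x k - 2 * s) * Gamma (?x k - 2 * s))"
      using y Gamma_plus1[of "?x k - 2 * s + 1"] Gamma_plus1[of "?x k - 2 * s"]
      by (simp add: nonpos_Ints_def)
    moreover have g: "Gamma (?x k - 2 * s) > 0" using y by (rule Gamma_real_pos)
    moreover have "u * (u + 1) / (4 * s) * (A * G / ((u + 1) * (u * D))) = G / (4 * s) * (A / D)"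
      if "u > 0" "D > 0" for u A G D :: real
      using that s by (simp add: divide_simps)
    note this[OF y g, of "Gamma (?x k)" "Gamma (2 - 2 * s)"]
    moreover have "?x k = real k + real n / 2 + s" "?x k - 2 * s = real k + real n / 2 - s" using n by auto
    moreover have "?x k + 1 - 2 * s = ?x k - 2 * s + 1" by simp
    ultimately show ?thesis
      unfolding Beta_def P_eigenvalue_def by (simp only:)
  qed
  let ?V = "\<lambda>r. ((kint_primitive s (?x 0) r - kint_primitive s (?x k) r) - (?c 0 * B 0 r - ?c k * B k r)) / (l + 1)"
  let ?f = "\<lambda>r. (kmult l 0 r - kmult l k r) * kweight l s r"
  have dV: "DERIV ?V r :> ?f r" if r: "0 < r" "r < 1" for r
  proof -
    have e: "2 - 2 * s - 1 = 1 - 2 * s" by simp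
    have "DERIV ?V r :> ((((l + 1) * (kmult l 0 r * kweight l s r)
        + ?c 0 * (r powr (?x 0 - 1) * (1 - r) powr (1 - 2 * s)))
      - ((l + 1) * (kmult l k r * kweight l s r) + ?c k * (r powr (?x k - 1) * (1 - r) powr (1 - 2 * s))))
      - (?c 0 * (r powr (?x 0 - 1) * (1 - r) powr (2 - 2 * s - 1)) - ?c k * (r powr (?x k - 1) * (1 - r) powr (2 - 2 * s - 1)))) / (l + 1)"
      by (intro DERIV_cdivide DERIV_diff DERIV_cmult B(1) r DERIV_kint_primitive s l)
    then show ?thesis
      by (rule DERIV_cong) (use l in \<open>simp only: e, simp add: divide_simps, simp add: algebra_simps\<close>)
  qed
  have cont: "isCont ?f r" if r: "0 < r" "r < 1" for r
  proof -
    have "1 - r\<^sup>2 \<noteq> 0" using r by (simp add: power2_eq_1_iff)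
    then show ?thesis using r l unfolding kmult_def kweight_def by (intro continuous_intros) auto
  qed
  have nn: "0 \<le> ?f r" if r: "0 < r" "r < 1" for r
    using kmult_antimono[OF l r, of 0 k] r unfolding kweight_def by (intro mult_nonneg_nonneg) auto
  have lim0: "(?V \<longlongrightarrow> ((0 - 0) - (?c 0 * 0 - ?c k * 0)) / (l + 1)) (at_right 0)"
  proof -
    have xp: "0 < ?x k" for k using n s by auto
    have "l + 1 \<noteq> 0" using l by simp
    then show ?thesis
      by (intro tendsto_divide tendsto_diff tendsto_mult tendsto_const B(2) kint_primitive_at_0 s xp)
  qed
  have lim1: "(?V \<longlongrightarrow> (0 - (?c 0 * Beta (?x 0) (2 - 2 * s) - ?c k * Beta (?x k) (2 - 2 * s))) / (l + 1)) (at_left 1)"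
    using l by (intro tendsto_divide tendsto_diff[of "\<lambda>r. kint_primitive s (?x 0) r - kint_primitive s (?x k) r"]
        tendsto_diff[of "\<lambda>r. ?c 0 * B 0 r"] tendsto_mult tendsto_const B(3) kint_primitive_at_1 s) auto
  have ei: "einterval 0 1 = {0<..<1::real}" by (auto simp: einterval_def zero_ereal_def one_ereal_def)
  have cond: "((?V \<circ> real_of_ereal) \<longlongrightarrow> ((0 - 0) - (?c 0 * 0 - ?c k * 0)) / (l + 1)) (at_right 0)"
    "((?V \<circ> real_of_ereal) \<longlongrightarrow> (0 - (?c 0 * Beta (?x 0) (2 - 2 * s) - ?c k * Beta (?x k) (2 - 2 * s))) / (l + 1)) (at_left 1)"
    using lim0 lim1 unfolding zero_ereal_def one_ereal_def ereal_tendsto_simps by simp_all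
  have "set_integrable lborel (einterval 0 1) ?f" "(LBINT r=0..1. ?f r) =
      (0 - (?c 0 * Beta (?x 0) (2 - 2 * s) - ?c k * Beta (?x k) (2 - 2 * s))) / (l + 1) - ((0 - 0) - (?c 0 * 0 - ?c k * 0)) / (l + 1)"
    by (rule interval_integral_FTC_nonneg[OF _ _ _ _ cond];
        (use dV cont nn in \<open>auto simp: zero_ereal_def one_ereal_def\<close>))+
  then show "set_integrable lborel {0<..<1} ?f"
    "(LINT r:{0<..<1}|lborel. ?f r) =
      Gamma (2 - 2 * s) / (4 * s * (l + 1)) * (P_eigenvalue n s k - P_eigenvalue n s 0)"
    unfolding ei interval_lebesgue_integral_def cB by (simp_all add: right_diff_distrib diff_divide_distrib)
qed

section \<open>Stroock--Varopoulos inequalities\<close>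

text \<open>Convexity of sinh on the nonnegative half-line, where sinh vanishes at 0.\<close>

lemma sinh_mult_le:
  fixes t z :: real
  assumes t: "0 \<le> t" "t \<le> 1" and z: "0 \<le> z"
  shows "sinh (t * z) \<le> t * sinh z"
proof -
  have "(\<lambda>z. t * sinh z - sinh (t * z)) 0 \<le> (\<lambda>z. t * sinh z - sinh (t * z)) z"
  proof (rule DERIV_nonneg_imp_nondecreasing[OF z])
    fix x :: real assume x: "0 \<le> x" "x \<le> z"
    have "DERIV (\<lambda>z. t * sinh z - sinh (t * z)) x :> t * cosh x - cosh (t * x) * t"
      by (auto intro!: derivative_eq_intros)
    moreover have "0 \<le> t * cosh x - cosh (t * x) * t"
    proof -
      have "cosh (t * x) \<le> cosh x"
        using t x by (subst cosh_real_nonneg_le_iff) (auto simp: mult_left_le_one_le)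
      from mult_left_mono[OF this t(1)] show ?thesis by (simp add: mult.commute)
    qed
    ultimately show "\<exists>y. DERIV (\<lambda>z. t * sinh z - sinh (t * z)) x :> y \<and> 0 \<le> y" by blast
  qed
  then show ?thesis by simp
qed

lemma sinh_mult_square_le:
  fixes t z :: real
  assumes t: "0 \<le> t" "t \<le> 1"
  shows "(sinh (t * z))\<^sup>2 \<le> t\<^sup>2 * (sinh z)\<^sup>2"
proof -
  have "(sinh (t * \<bar>z\<bar>))\<^sup>2 \<le> (t * sinh \<bar>z\<bar>)\<^sup>2"
    using sinh_mult_le[OF t, of "\<bar>z\<bar>"] t by (intro power_mono) auto
  then show ?thesis by (cases "0 \<le> z") (auto simp: power_mult_distrib)
qed

lemma cosh_eq_sinh_half: "cosh x = 1 + 2 * (sinh (x / 2))\<^sup>2" for x :: real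
  using cosh_double[of "x / 2"] hyperbolic_pythagoras[of "x / 2"] by simp

text \<open>The two coefficients add up to 1. Writing cosh as 1 plus twice the squared sinh of half
  the argument therefore reduces the claim to \<open>sinh_mult_square_le\<close> with t = (p - 2) /
  p, whose square is the second coefficient.\<close>

lemma cosh_interpolation:
  fixes p c :: real
  assumes p: "2 \<le> p"
  shows "cosh ((p - 2) * c) \<le> 4 * (p - 1) / p\<^sup>2 + (p - 2)\<^sup>2 / p\<^sup>2 * cosh (p * c)"
proof -
  have "(sinh ((p - 2) / p * (p * c / 2)))\<^sup>2 \<le> ((p - 2) / p)\<^sup>2 * (sinh (p * c / 2))\<^sup>2"
    using p by (intro sinh_mult_square_le) auto
  moreover have "(p - 2) / p * (p * c / 2) = (p - 2) * c / 2" using p by simp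
  ultimately have "1 + 2 * (sinh ((p - 2) * c / 2))\<^sup>2 \<le> 1 + 2 * ((p - 2)\<^sup>2 / p\<^sup>2 * (sinh (p * c / 2))\<^sup>2)"
    by (simp add: power_divide)
  also have "1 = 4 * (p - 1) / p\<^sup>2 + (p - 2)\<^sup>2 / p\<^sup>2"
    using p by (simp add: divide_simps) (simp add: power2_eq_square algebra_simps)
  finally show ?thesis
    unfolding cosh_eq_sinh_half[of "(p - 2) * c"] cosh_eq_sinh_half[of "p * c"]
    using \<open>1 = 4 * (p - 1) / p\<^sup>2 + (p - 2)\<^sup>2 / p\<^sup>2\<close> by (simp add: algebra_simps)
qed

text \<open>With a = exp (m + c) and b = exp (m - c) both sides contain the factor exp (p m) by
  homogeneity, and what remains is \<open>cosh_interpolation\<close> in c.\<close>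

lemma stroock_varopoulos_pos:
  fixes a b p :: real
  assumes p: "2 \<le> p" and a: "0 < a" and b: "0 < b"
  shows "a * b powr (p - 1) + b * a powr (p - 1) \<le>
    2 * (4 * (p - 1) / p\<^sup>2) * (a powr (p / 2) * b powr (p / 2)) + (p - 2)\<^sup>2 / p\<^sup>2 * (a powr p + b powr p)"
proof -
  define c where "c = (ln a - ln b) / 2"
  define m where "m = (ln a + ln b) / 2"
  have ab: "a = exp (m + c)" "b = exp (m - c)" using a b by (simp_all add: m_def c_def field_simps)
  have e: "exp (m + c) powr t = exp (t * (m + c))" "exp (m - c) powr t = exp (t * (m - c))" for t
    by (simp_all add: powr_def)
  have 1: "a * b powr (p - 1) + b * a powr (p - 1) = exp (p * m) * (2 * cosh ((p - 2) * c))"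
    unfolding ab e cosh_def by (simp add: exp_add[symmetric] distrib_left algebra_simps)
  have 2: "a powr (p / 2) * b powr (p / 2) = exp (p * m)"
  proof -
    have "p / 2 * (m + c) + p / 2 * (m - c) = p * m" by (simp add: field_simps)
    then show ?thesis unfolding ab e by (simp add: exp_add[symmetric])
  qed
  have 3: "a powr p + b powr p = exp (p * m) * (2 * cosh (p * c))"
    unfolding ab e cosh_def by (simp add: exp_add[symmetric] distrib_left algebra_simps)
  show ?thesis
    unfolding 1 2 3 using mult_left_mono[OF cosh_interpolation[OF p, of c], of "2 * exp (p * m)"]
    by (simp add: algebra_simps)
qed

lemma abs_powr_mult_self:
  fixes b :: real
  shows "\<bar>b\<bar> powr (p - 2) * \<bar>b\<bar> = \<bar>b\<bar> powr (p - 1)"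
  using powr_add[of "\<bar>b\<bar>" "p - 2" 1] by (cases "b = 0") auto

text \<open>Let \<phi>(t) = |t|^(p-2) t, A = 4 (p - 1) / p^2 and B = (p - 2)^2 / p^2. The customary
  form is (a - b) (\<phi>(a) - \<phi>(b)) \<ge> A (|a|^(p/2) - |b|^(p/2))^2. Since A + B = 1,
  collecting the diagonal terms on the right gives this version, which contains only products of
  values at two points and so can be integrated against a kernel.\<close>

lemma stroock_varopoulos:
  fixes a b p :: real
  assumes p: "2 \<le> p"
  shows "a * (\<bar>b\<bar> powr (p - 2) * b) + \<bar>a\<bar> powr (p - 2) * a * b \<le>
    2 * (4 * (p - 1) / p\<^sup>2) * (\<bar>a\<bar> powr (p / 2) * \<bar>b\<bar> powr (p / 2))
    + (p - 2)\<^sup>2 / p\<^sup>2 * (\<bar>a\<bar> powr p + \<bar>b\<bar> powr p)"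
proof (cases "a = 0 \<or> b = 0")
  case True
  have "0 \<le> 2 * (4 * (p - 1) / p\<^sup>2) * (\<bar>a\<bar> powr (p / 2) * \<bar>b\<bar> powr (p / 2))
    + (p - 2)\<^sup>2 / p\<^sup>2 * (\<bar>a\<bar> powr p + \<bar>b\<bar> powr p)"
    using p by (intro add_nonneg_nonneg mult_nonneg_nonneg divide_nonneg_nonneg) auto
  then show ?thesis using True by auto
next
  case False
  have "a * (\<bar>b\<bar> powr (p - 2) * b) \<le> \<bar>a * (\<bar>b\<bar> powr (p - 2) * b)\<bar>" by (rule abs_ge_self)
  also have "\<dots> = \<bar>a\<bar> * \<bar>b\<bar> powr (p - 1)" by (simp add: abs_mult abs_powr_mult_self)
  finally have 1: "a * (\<bar>b\<bar> powr (p - 2) * b) \<le> \<bar>a\<bar> * \<bar>b\<bar> powr (p - 1)" .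
  have "\<bar>a\<bar> powr (p - 2) * a * b \<le> \<bar>\<bar>a\<bar> powr (p - 2) * a * b\<bar>" by (rule abs_ge_self)
  also have "\<dots> = \<bar>b\<bar> * \<bar>a\<bar> powr (p - 1)" by (simp add: abs_mult abs_powr_mult_self)
  finally have "\<bar>a\<bar> powr (p - 2) * a * b \<le> \<bar>b\<bar> * \<bar>a\<bar> powr (p - 1)" .
  with 1 show ?thesis
    using stroock_varopoulos_pos[OF p, of "\<bar>a\<bar>" "\<bar>b\<bar>"] False by simp
qed

text \<open>The mixed term is estimated by the arithmetic mean of |a|^p and |b|^p, and the
  coefficients then add up to 1. This is the two-point form of the second inequality of the
  theorem.\<close>

lemma stroock_varopoulos_coarse:
  fixes a b p :: real
  assumes p: "2 \<le> p"
  shows "a * (\<bar>b\<bar> powr (p - 2) * b) + \<bar>a\<bar> powr (p - 2) * a * b \<le> \<bar>a\<bar> powr p + \<bar>b\<bar> powr p"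
proof -
  have sq: "(\<bar>z\<bar> powr (p / 2))\<^sup>2 = \<bar>z\<bar> powr p" for z :: real
    by (simp add: power2_eq_square powr_add[symmetric])
  have "2 * (\<bar>a\<bar> powr (p / 2) * \<bar>b\<bar> powr (p / 2)) \<le> \<bar>a\<bar> powr p + \<bar>b\<bar> powr p"
    using sum_squares_bound[of "\<bar>a\<bar> powr (p / 2)" "\<bar>b\<bar> powr (p / 2)"] by (simp add: sq)
  then have "4 * (p - 1) / p\<^sup>2 * (2 * (\<bar>a\<bar> powr (p / 2) * \<bar>b\<bar> powr (p / 2))) \<le> 4 * (p - 1) / p\<^sup>2 * (\<bar>a\<bar> powr p + \<bar>b\<bar> powr p)"
    using p by (intro mult_left_mono) auto
  moreover have "4 * (p - 1) / p\<^sup>2 = 1 - (p - 2)\<^sup>2 / p\<^sup>2"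
    using p by (simp add: divide_simps) (simp add: power2_eq_square algebra_simps)
  then have "4 * (p - 1) / p\<^sup>2 * (\<bar>a\<bar> powr p + \<bar>b\<bar> powr p) =
      (\<bar>a\<bar> powr p + \<bar>b\<bar> powr p) - (p - 2)\<^sup>2 / p\<^sup>2 * (\<bar>a\<bar> powr p + \<bar>b\<bar> powr p)"
    by (simp add: left_diff_distrib)
  moreover have "2 * (4 * (p - 1) / p\<^sup>2) * (\<bar>a\<bar> powr (p / 2) * \<bar>b\<bar> powr (p / 2)) =
      4 * (p - 1) / p\<^sup>2 * (2 * (\<bar>a\<bar> powr (p / 2) * \<bar>b\<bar> powr (p / 2)))"
    by simp
  ultimately show ?thesis using stroock_varopoulos[OF p, of a b] by linarith
qed

section \<open>From the two-point inequality to the quadratic form\<close>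

definition kmean :: "real \<Rightarrow> real \<Rightarrow> ('a::euclidean_space \<Rightarrow> real) \<Rightarrow> 'a \<Rightarrow> real" where
  "kmean l r f x = (LINT y|sphere_measure. ndist r x y powr (- l - 2) * f y) / sphere_area TYPE('a)"

lemma summable_kmult_poly:
  assumes l: "0 < l" and r: "0 < r" "r < 1"
  shows "summable (\<lambda>k. \<bar>kmult l k r\<bar> * (real k + 1) ^ q)"
proof -
  have Q: "0 < 1 - r\<^sup>2" "r\<^sup>2 < 1" using r by (auto simp: power_less_one_iff)
  have "\<bar>kmult l k r\<bar> * (real k + 1) ^ q \<le> (l + 3) / ((l + 1) * (1 - r\<^sup>2) ^ 3) * ((real k + 1) ^ Suc q * r ^ k)" for k
  proof -
    have "(l + 1 + real k) * (1 - r\<^sup>2) \<le> (l + 1 + real k) * 1" using l Q by (intro mult_left_mono) auto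
    moreover have "l + 3 + real k \<le> (l + 3) * (real k + 1)" using l by (simp add: algebra_simps)
    moreover have "(l + 1 + real k) * 1 + 2 = l + 3 + real k" by simp
    ultimately have "(l + 1 + real k) * (1 - r\<^sup>2) + 2 * r\<^sup>2 \<le> (l + 3) * (real k + 1)"
      using Q by argo
    then have "kmult l k r \<le> r ^ k * ((l + 3) * (real k + 1)) / ((l + 1) * (1 - r\<^sup>2) ^ 3)"
      unfolding kmult_def using l Q r by (intro divide_right_mono mult_left_mono) auto
    from mult_right_mono[OF this, of "(real k + 1) ^ q"] kmult_pos[OF l r, of k] show ?thesis
      by (simp add: ac_simps)
  qed
  then show ?thesis
    by (intro summable_comparison_test'[OF summable_mult[OF summable_poly_power[of r "Suc q"], of "(l + 3) / ((l + 1) * (1 - r\<^sup>2) ^ 3)"]])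
       (use r in \<open>auto simp: abs_mult\<close>)
qed

lemma kmean_sums:
  fixes f g :: "'a::euclidean_space \<Rightarrow> real"
  assumes l: "0 < l" and r: "0 < r" "r < 1" and f: "continuous_on (sphere 0 1) f"
  shows "norm x = 1 \<Longrightarrow> integrable sphere_measure (\<lambda>y. ndist r x y powr (- l - 2) * f y)"
    and "continuous_on (sphere 0 1) g \<Longrightarrow> integrable sphere_measure (\<lambda>x. kmean l r f x * g x)"
    and "continuous_on (sphere 0 1) g \<Longrightarrow> (\<lambda>k. kmult l k r * (LINT x|sphere_measure. zproj l k f x * g x)) sums
      (LINT x|sphere_measure. kmean l r f x * g x)"
proof -
  obtain C q where C: "0 < C" "\<And>k x y. norm (x::'a) = 1 \<Longrightarrow> norm y = 1 \<Longrightarrow> \<bar>zonal l k x y\<bar> \<le> C * (real k + 1) ^ q"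
    using zonal_bound[OF l] by metis
  have S: "integrable sphere_measure (\<lambda>y. ndist r x y powr (- l - 2) * f y)"
    "(\<lambda>k. kmult l k r * zproj l k f x) sums kmean l r f x" if x: "norm x = 1" for x
    unfolding kmean_def
    using zonal_series_integral[OF f C(2)[OF x] less_imp_le[OF C(1)] summable_kmult_poly[OF l r] kernel_sums[OF x _ l r]]
    by auto
  then show "norm x = 1 \<Longrightarrow> integrable sphere_measure (\<lambda>y. ndist r x y powr (- l - 2) * f y)" by blast
  assume g: "continuous_on (sphere 0 1) g"
  show "integrable sphere_measure (\<lambda>x. kmean l r f x * g x)"
    "(\<lambda>k. kmult l k r * (LINT x|sphere_measure. zproj l k f x * g x)) sums
      (LINT x|sphere_measure. kmean l r f x * g x)"
    by (rule zproj_series_integral[OF l f g summable_kmult_poly[OF l r] S(2)]; assumption)+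
qed

text \<open>Both integrals expand into the same series, because each projection is
  symmetric.\<close>

lemma kmean_symmetric:
  assumes l: "0 < l" and r: "0 < r" "r < 1" and f: "continuous_on (sphere 0 1) f" and g: "continuous_on (sphere 0 1) g"
  shows "(LINT x|sphere_measure. kmean l r f x * g x) = (LINT x|sphere_measure. kmean l r g x * f x)"
proof -
  have "(LINT x|sphere_measure. zproj l k f x * g x) = (LINT x|sphere_measure. zproj l k g x * f x)" for k
    using zproj_symmetric[OF f g, of l k] by (simp add: mult.commute)
  then have "(\<lambda>k. kmult l k r * (LINT x|sphere_measure. zproj l k f x * g x)) sums
      (LINT x|sphere_measure. kmean l r g x * f x)"
    using kmean_sums(3)[OF l r g f] by simp
  with kmean_sums(3)[OF l r f g] show ?thesis by (rule sums_unique2)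
qed

text \<open>The two-point inequality is multiplied by the positive kernel and integrated over y and
  then over x. Symmetry of the kernel pairs the terms up, which accounts for the factor 2 in front
  of A in the hypothesis.\<close>

lemma kmean_form_le:
  fixes f h w u q :: "'a::euclidean_space \<Rightarrow> real"
  assumes l: "0 < l" and r: "0 < r" "r < 1"
    and c: "continuous_on (sphere 0 1) f" "continuous_on (sphere 0 1) h" "continuous_on (sphere 0 1) w"
      "continuous_on (sphere 0 1) u" "continuous_on (sphere 0 1) q"
    and le: "\<And>x y. norm x = 1 \<Longrightarrow> norm y = 1 \<Longrightarrow>
      f x * h y + h x * f y \<le> 2 * A * (w x * w y) + B * (u x * q y + q x * u y)"
  shows "(LINT x|sphere_measure. kmean l r f x * h x) \<le>
    A * (LINT x|sphere_measure. kmean l r w x * w x) + B * (LINT x|sphere_measure. kmean l r u x * q x)"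
proof -
  let ?K = "\<lambda>x y. ndist r x y powr (- l - 2)"
  let ?T = "kmean l r"
  have pt: "0 \<le> 2 * A * (?T w x * w x) + B * (?T q x * u x + ?T u x * q x) - (?T h x * f x + ?T f x * h x)"
    if x: "norm x = 1" for x
  proof -
    note i = kmean_sums(1)[OF l r _ x]
    let ?g = "\<lambda>y. 2 * A * w x * (?K x y * w y) + B * u x * (?K x y * q y) + B * q x * (?K x y * u y)
        - f x * (?K x y * h y) - h x * (?K x y * f y)"
    have "0 \<le> (LINT y|sphere_measure. ?g y)"
    proof (rule integral_nonneg_AE, rule AE_I2)
      fix y :: 'a assume "y \<in> space sphere_measure"
      then have "norm y = 1" by simp
      from mult_left_mono[OF le[OF x this], of "?K x y"]
      show "0 \<le> ?g y" by (simp add: algebra_simps)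
    qed
    also have "(LINT y|sphere_measure. ?g y) =
        2 * A * w x * (LINT y|sphere_measure. ?K x y * w y) + B * u x * (LINT y|sphere_measure. ?K x y * q y)
        + B * q x * (LINT y|sphere_measure. ?K x y * u y)
        - f x * (LINT y|sphere_measure. ?K x y * h y) - h x * (LINT y|sphere_measure. ?K x y * f y)"
      using c i by simp
    finally have "0 \<le> \<dots> / sphere_area TYPE('a)"
      using sphere_area_pos[where 'a='a] by (intro divide_nonneg_pos)
    then show ?thesis
      by (simp add: kmean_def add_divide_distrib diff_divide_distrib algebra_simps)
  qed
  note j = kmean_sums(2)[OF l r]
  let ?g = "\<lambda>x. 2 * A * (?T w x * w x) + B * (?T q x * u x + ?T u x * q x) - (?T h x * f x + ?T f x * h x)"
  have "0 \<le> (LINT x|sphere_measure. ?g x)"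
    by (rule integral_nonneg_AE, rule AE_I2) (use pt in auto)
  also have "(LINT x|sphere_measure. ?g x) = 2 * A * (LINT x|sphere_measure. ?T w x * w x)
     + B * ((LINT x|sphere_measure. ?T q x * u x) + (LINT x|sphere_measure. ?T u x * q x))
     - ((LINT x|sphere_measure. ?T h x * f x) + (LINT x|sphere_measure. ?T f x * h x))"
  proof -
    note i = j[OF c(3,3)] j[OF c(5,4)] j[OF c(4,5)] j[OF c(2,1)] j[OF c(1,2)]
    note k = integrable_mult_right[OF i(1), of "2 * A"] Bochner_Integration.integrable_add[OF i(2,3)]
      Bochner_Integration.integrable_add[OF i(4,5)]
    show ?thesis
      unfolding Bochner_Integration.integral_diff[OF Bochner_Integration.integrable_add[OF k(1) integrable_mult_right[OF k(2)]] k(3)]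
        Bochner_Integration.integral_add[OF k(1) integrable_mult_right[OF k(2)]]
        Bochner_Integration.integral_add[OF i(2,3)] Bochner_Integration.integral_add[OF i(4,5)]
        integral_mult_right_zero ..
  qed
  finally show ?thesis
    using kmean_symmetric[OF l r c(5,4)] kmean_symmetric[OF l r c(2,1)] by (simp add: algebra_simps)
qed

text \<open>A common form of both inequalities: f and u are smooth, so their series converge
  absolutely, whereas w is merely continuous and enters through partial sums of nonnegative terms.
  The identity \<open>diag\<close> links the two sides in degree 0, where the multiplier differences
  carry no information.\<close>

lemma P_form_partial_le:
  fixes f h w u q :: "'a::euclidean_space \<Rightarrow> real"
  assumes N: "DIM('a) = n + 1" and n: "2 \<le> n" and s: "0 < s" "s < 1"
    and f: "smooth_on_sphere f" and u: "smooth_on_sphere u"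
    and h: "continuous_on (sphere 0 1) h" and w: "continuous_on (sphere 0 1) w"
    and q: "continuous_on (sphere 0 1) q" and A: "0 \<le> A"
    and le: "\<And>x y. norm x = 1 \<Longrightarrow> norm y = 1 \<Longrightarrow>
      f x * h y + h x * f y \<le> 2 * A * (w x * w y) + B * (u x * q y + q x * u y)"
    and diag: "\<And>x. norm x = 1 \<Longrightarrow> f x * h x = A * (w x)\<^sup>2 + B * (u x * q x)"
  defines "l \<equiv> (real n - 1) / 2"
  shows "A * (\<Sum>k<m. P_eigenvalue n s k * (LINT x|sphere_measure. (zproj l k w x)\<^sup>2)) \<le>
    (LINT x|sphere_measure. P_sphere n s f x * h x) - B * (LINT x|sphere_measure. P_sphere n s u x * q x)"
proof -
  have N': "real DIM('a) = 2 * l + 2" and l: "0 < l" and nl: "2 * l + 1 = real n"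
    using N n by (simp_all add: l_def field_simps)
  note fc = smooth_on_sphere_continuous[OF f] and uc = smooth_on_sphere_continuous[OF u]
  let ?lam = "P_eigenvalue n s"
  note lam = P_eigenvalue_bounds[OF s n]
  define a where "a F G k = (LINT x|sphere_measure. zproj l k F x * G x)" for F G :: "'a \<Rightarrow> real" and k
  define b where "b k = (LINT x|sphere_measure. (zproj l k w x)\<^sup>2)" for k
  define c where "c k = a f h k - B * a u q k" for k
  have aw: "a w w = b" by (auto simp: a_def b_def integral_zproj_square[OF w N' l])
  have b0: "0 \<le> b k" for k by (simp add: b_def)
  have bs: "b sums (LINT x|sphere_measure. (w x)\<^sup>2)"
    unfolding b_def by (rule zproj_parseval[OF w N' l])
  \<comment> \<open>The undamped series, evaluated through \<open>diag\<close>. Compared with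
    Parseval's identity for w, it makes the terms carrying \<open>kmult l 0 r\<close>
    cancel.\<close>
  have cs: "c sums (A * (LINT x|sphere_measure. (w x)\<^sup>2))"
  proof -
    have "c sums ((LINT x|sphere_measure. f x * h x) - B * (LINT x|sphere_measure. u x * q x))"
      unfolding c_def a_def
      by (intro sums_diff sums_mult zproj_smooth_integral_sums f u N' l h q)
    also have "(LINT x|sphere_measure. f x * h x) = (LINT x|sphere_measure. A * (w x)\<^sup>2 + B * (u x * q x))"
      by (rule integral_sphere_cong) (rule diag)
    also have "\<dots> = A * (LINT x|sphere_measure. (w x)\<^sup>2) + B * (LINT x|sphere_measure. u x * q x)"
    proof -
      have "integrable sphere_measure (\<lambda>x. (w x)\<^sup>2)" "integrable sphere_measure (\<lambda>x. u x * q x)"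
        by (intro integrable_sphere continuous_on_mult continuous_on_power w uc q)+
      then show ?thesis by simp
    qed
    finally show ?thesis by simp
  qed
  note Pf = P_sphere_integral[OF f N' l h s n] and Pu = P_sphere_integral[OF u N' l q s n]
  define R where "R = (LINT x|sphere_measure. P_sphere n s f x * h x) - B * (LINT x|sphere_measure. P_sphere n s u x * q x)"
  have lamc: "(\<lambda>k. ?lam k * c k) sums R"
    using sums_diff[OF Pf(2) sums_mult[OF Pu(2), of B]]
    by (simp add: R_def c_def a_def algebra_simps)
  have abslamc: "summable (\<lambda>k. ?lam k * \<bar>c k\<bar>)"
  proof (rule summable_comparison_test'[OF summable_add[OF Pf(3) summable_mult[OF Pu(3), of "\<bar>B\<bar>"]]])
    fix k :: nat
    have "\<bar>c k\<bar> \<le> \<bar>a f h k\<bar> + \<bar>B\<bar> * \<bar>a u q k\<bar>"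
      unfolding c_def by (metis abs_mult abs_triangle_ineq4)
    from mult_left_mono[OF this less_imp_le[OF lam(1)[of k]]]
    show "norm (?lam k * \<bar>c k\<bar>) \<le> ?lam k * \<bar>LINT x|sphere_measure. zproj l k f x * h x\<bar>
        + \<bar>B\<bar> * (?lam k * \<bar>LINT x|sphere_measure. zproj l k u x * q x\<bar>)"
      using lam(1)[of k] by (simp add: a_def abs_mult algebra_simps)
  qed
  have absc: "summable (\<lambda>k. \<bar>c k\<bar>)"
  proof (rule summable_comparison_test'[OF summable_mult[OF abslamc, of "1 / ?lam 0"]])
    fix k :: nat
    have "?lam 0 * \<bar>c k\<bar> \<le> ?lam k * \<bar>c k\<bar>" using lam(2)[of 0 k] by (intro mult_right_mono) auto
    then show "norm \<bar>c k\<bar> \<le> 1 / ?lam 0 * (?lam k * \<bar>c k\<bar>)"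
      using lam(1)[of 0] by (simp add: field_simps)
  qed
  define d where "d k r = kmult l 0 r - kmult l k r" for k r
  have d0: "0 \<le> d k r" "d k r \<le> kmult l 0 r" if "0 < r" "r < 1" for k r
    using kmult_antimono[OF l that, of 0 k] kmult_pos[OF l that, of k] by (auto simp: d_def)
  have dc: "summable (\<lambda>k. d k r * \<bar>c k\<bar>)" if r: "0 < r" "r < 1" for r
    by (rule summable_comparison_test'[OF summable_mult[OF absc, of "kmult l 0 r"]])
       (use d0[OF r] in \<open>auto simp: abs_mult intro!: mult_right_mono\<close>)
  \<comment> \<open>\<open>kmult l 0 r\<close> times the diagonal identity, minus the kernel
    inequality. On the side of w the summands \<open>d k r * b k\<close> are nonnegative, so all but
    the first m may be dropped.\<close>
  have key: "A * (\<Sum>k<m. d k r * b k) \<le> (\<Sum>k. d k r * c k)" if r: "0 < r" "r < 1" for r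
  proof -
    have F: "(\<lambda>k. kmult l k r * a F G k) sums (LINT x|sphere_measure. kmean l r F x * G x)"
      if "continuous_on (sphere 0 1) F" "continuous_on (sphere 0 1) G" for F G
      unfolding a_def by (rule kmean_sums(3)[OF l r that])
    let ?I = "\<lambda>F G. LINT x|sphere_measure. kmean l r F x * G x"
    have cI: "(\<lambda>k. kmult l k r * c k) sums (?I f h - B * ?I u q)"
      using sums_diff[OF F[OF fc h] sums_mult[OF F[OF uc q], of B]]
      by (simp add: c_def algebra_simps)
    have "(\<lambda>k. kmult l 0 r * c k - kmult l k r * c k) sums
        (kmult l 0 r * (A * (LINT x|sphere_measure. (w x)\<^sup>2)) - (?I f h - B * ?I u q))"
      by (intro sums_diff sums_mult cs cI)
    then have s1: "(\<Sum>k. d k r * c k) = kmult l 0 r * (A * (LINT x|sphere_measure. (w x)\<^sup>2)) - (?I f h - B * ?I u q)"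
      unfolding d_def left_diff_distrib by (rule sums_unique[symmetric])
    have "(\<lambda>k. kmult l 0 r * b k - kmult l k r * b k) sums
        (kmult l 0 r * (LINT x|sphere_measure. (w x)\<^sup>2) - ?I w w)"
      using F[OF w w] unfolding aw by (intro sums_diff sums_mult bs)
    then have s2: "(\<lambda>k. d k r * b k) sums (kmult l 0 r * (LINT x|sphere_measure. (w x)\<^sup>2) - ?I w w)"
      by (simp add: d_def left_diff_distrib)
    have "(\<Sum>k<m. d k r * b k) \<le> (\<Sum>k. d k r * b k)"
      by (rule sum_le_suminf[OF sums_summable[OF s2]]) (use d0[OF r] b0 in auto)
    also have "\<dots> = kmult l 0 r * (LINT x|sphere_measure. (w x)\<^sup>2) - ?I w w" using s2 by (rule sums_unique[symmetric])
    finally have "A * (\<Sum>k<m. d k r * b k) \<le> A * (kmult l 0 r * (LINT x|sphere_measure. (w x)\<^sup>2) - ?I w w)"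
      using A by (rule mult_left_mono)
    moreover have "?I f h \<le> A * ?I w w + B * ?I u q"
      by (rule kmean_form_le[OF l r fc h w uc q le])
    ultimately show ?thesis unfolding s1 by (simp add: algebra_simps)
  qed
  define \<kappa> where "\<kappa> = Gamma (2 - 2 * s) / (4 * s * (l + 1))"
  have \<kappa>: "0 < \<kappa>" unfolding \<kappa>_def using s l by (intro divide_pos_pos Gamma_real_pos) auto
  define g where "g k r = indicator {0<..<1} r * (d k r * kweight l s r)" for k r
  have gi: "integrable lborel (g k)" "(LINT r|lborel. g k r) = \<kappa> * (?lam k - ?lam 0)" for k
    using integral_kmult_difference[OF n nl s, of k]
    unfolding set_integrable_def set_lebesgue_integral_def g_def[abs_def] d_def \<kappa>_def by simp_all
  have kw: "0 \<le> kweight l s r" if "0 < r" "r < 1" for r using that by (simp add: kweight_def)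
  have g0: "0 \<le> g k r" for k r using d0 kw by (auto simp: g_def indicator_def)
  have gc: "summable (\<lambda>k. norm (g k r * c k))" for r
  proof (cases "0 < r \<and> r < 1")
    case True
    then show ?thesis using summable_mult[OF dc, of r "kweight l s r"] d0[of r] kw[of r]
      by (simp add: g_def abs_mult ac_simps)
  qed (simp add: g_def)
  \<comment> \<open>As \<open>g k\<close> is nonnegative, the integral of the norm is \<kappa> times
    the eigenvalue gap times |c k|. Summability of these numbers justifies exchanging the sum over k
    with the integral over r.\<close>
  have gs: "summable (\<lambda>k. LINT r|lborel. norm (g k r * c k))"
  proof -
    have "(LINT r|lborel. norm (g k r * c k)) = \<kappa> * (?lam k * \<bar>c k\<bar>) - \<kappa> * ?lam 0 * \<bar>c k\<bar>" for k
      using g0 by (simp add: abs_mult gi algebra_simps)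
    then show ?thesis using abslamc absc by (simp add: summable_diff summable_mult)
  qed
  have gci: "integrable lborel (\<lambda>r. g k r * c k)" for k using gi by simp
  have "A * (\<Sum>k<m. \<kappa> * (?lam k - ?lam 0) * b k) = (LINT r|lborel. A * (\<Sum>k<m. g k r * b k))"
    using gi by (simp add: Bochner_Integration.integral_sum)
  also have "\<dots> \<le> (LINT r|lborel. (\<Sum>k. g k r * c k))"
  proof (rule integral_mono)
    show "integrable lborel (\<lambda>r. A * (\<Sum>k<m. g k r * b k))" using gi by simp
    show "integrable lborel (\<lambda>r. \<Sum>k. g k r * c k)"
      by (rule integrable_suminf[OF gci _ gs]) (use gc in auto)
    fix r :: real
    show "A * (\<Sum>k<m. g k r * b k) \<le> (\<Sum>k. g k r * c k)"
    proof (cases "0 < r \<and> r < 1")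
      case True
      then have r: "0 < r" "r < 1" by auto
      have sdc: "summable (\<lambda>k. d k r * c k)"
        by (rule summable_rabs_cancel) (use dc[OF r] d0[OF r] in \<open>simp add: abs_mult\<close>)
      have e: "g k r = kweight l s r * d k r" for k using r by (simp add: g_def mult.commute)
      have "A * (\<Sum>k<m. g k r * b k) = kweight l s r * (A * (\<Sum>k<m. d k r * b k))"
        by (simp add: e sum_distrib_left ac_simps)
      also have "\<dots> \<le> kweight l s r * (\<Sum>k. d k r * c k)"
        using key[OF r] kw[OF r] by (rule mult_left_mono)
      also have "\<dots> = (\<Sum>k. g k r * c k)"
        using suminf_mult[OF sdc, of "kweight l s r"] by (simp add: e mult.assoc)
      finally show ?thesis .
    qed (simp add: g_def)
  qed
  also have "\<dots> = (\<Sum>k. LINT r|lborel. g k r * c k)"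
    by (rule integral_suminf[OF gci _ gs]) (use gc in auto)
  also have "\<dots> = (\<Sum>k. \<kappa> * (?lam k * c k - ?lam 0 * c k))"
    by (simp add: gi algebra_simps)
  also have "\<dots> = \<kappa> * (R - ?lam 0 * (A * (LINT x|sphere_measure. (w x)\<^sup>2)))"
    by (intro sums_unique[symmetric] sums_mult sums_diff lamc cs)
  finally have "\<kappa> * (A * (\<Sum>k<m. (?lam k - ?lam 0) * b k)) \<le> \<kappa> * (R - ?lam 0 * (A * (LINT x|sphere_measure. (w x)\<^sup>2)))"
    by (simp add: sum_distrib_left ac_simps)
  then have "A * (\<Sum>k<m. (?lam k - ?lam 0) * b k) \<le> R - ?lam 0 * (A * (LINT x|sphere_measure. (w x)\<^sup>2))"
    using \<kappa> by simp
  moreover have "A * (\<Sum>k<m. (?lam k - ?lam 0) * b k) = A * (\<Sum>k<m. ?lam k * b k) - ?lam 0 * (A * (\<Sum>k<m. b k))"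
  proof -
    have "(\<Sum>k<m. (?lam k - ?lam 0) * b k) = (\<Sum>k<m. ?lam k * b k) - ?lam 0 * (\<Sum>k<m. b k)"
      by (simp add: left_diff_distrib sum_subtractf sum_distrib_left)
    then show ?thesis by (simp add: right_diff_distrib)
  qed
  \<comment> \<open>Adding back the lowest eigenvalue: partial sums of \<open>b\<close> stay below
    the squared norm of w, and A and the eigenvalue are nonnegative, so the inequality keeps its
    direction.\<close>
  moreover have "?lam 0 * (A * (\<Sum>k<m. b k)) \<le> ?lam 0 * (A * (LINT x|sphere_measure. (w x)\<^sup>2))"
    using sum_le_suminf[OF sums_summable[OF bs], of "{..<m}"] b0 sums_unique[OF bs] A lam(1)[of 0]
    by (intro mult_left_mono) auto
  ultimately show ?thesis unfolding R_def[symmetric] b_def[symmetric] by linarith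
qed

section \<open>Return to the conformal metric\<close>

text \<open>The choice in \<open>conformal_factor\<close> requires a witness: the power \<rho>^((n -
  2 \<sigma>) / 4), whose exponent is inverse to 4 / (n - 2 \<sigma>). Agreement as functions needs
  to be checked only on the sphere, since \<open>round_metric\<close> vanishes elsewhere.\<close>

lemma conformal_factor_props:
  fixes g :: "'a::euclidean_space metric_tensor"
  assumes g: "g \<in> conformal_class" and n: "2 * \<sigma> < real n"
  shows "smooth_on_sphere (conformal_factor n \<sigma> g)" "\<And>x. norm x = 1 \<Longrightarrow> 0 < conformal_factor n \<sigma> g x"
proof -
  obtain \<rho> where \<rho>: "smooth_on_sphere \<rho>" "\<And>x::'a. x \<in> sphere 0 1 \<Longrightarrow> 0 < \<rho> x"
    and ge: "g = (\<lambda>x X Y. \<rho> x * round_metric x X Y)"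
    using g unfolding conformal_class_def by blast
  let ?u = "\<lambda>x. \<rho> x powr ((real n - 2 * \<sigma>) / 4)"
  have "?u x powr (4 / (real n - 2 * \<sigma>)) = \<rho> x" if "norm x = 1" for x
  proof -
    have "(real n - 2 * \<sigma>) / 4 * (4 / (real n - 2 * \<sigma>)) = 1" using n by simp
    then show ?thesis using \<rho>(2)[of x] that by (simp only: powr_powr) simp
  qed
  then have "g = (\<lambda>x X Y. ?u x powr (4 / (real n - 2 * \<sigma>)) * round_metric x X Y)"
    unfolding ge by (intro ext) (auto simp: round_metric_def)
  moreover have "smooth_on_sphere ?u" "\<forall>x\<in>sphere 0 1. 0 < ?u x"
    using \<rho> smooth_on_sphere_powr[OF \<rho>] less_imp_neq[OF \<rho>(2)] by auto
  ultimately have ex: "\<exists>u. smooth_on_sphere u \<and> (\<forall>x\<in>sphere 0 1. 0 < u x) \<and>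
      g = (\<lambda>x X Y. u x powr (4 / (real n - 2 * \<sigma>)) * round_metric x X Y)"
    by (intro exI[of _ ?u] conjI)
  have some: "smooth_on_sphere (conformal_factor n \<sigma> g) \<and> (\<forall>x\<in>sphere 0 1. 0 < conformal_factor n \<sigma> g x) \<and>
      g = (\<lambda>x X Y. conformal_factor n \<sigma> g x powr (4 / (real n - 2 * \<sigma>)) * round_metric x X Y)"
    unfolding conformal_factor_def by (rule someI_ex[OF ex])
  note some' = conjunct1[OF some] conjunct1[OF conjunct2[OF some]]
  from some' show "smooth_on_sphere (conformal_factor n \<sigma> g)" "\<And>x. norm x = 1 \<Longrightarrow> 0 < conformal_factor n \<sigma> g x"
    by auto
qed

text \<open>The density has the exponent 2 n / (n - 2 \<sigma>) and the operator contributes - (n +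
  2 \<sigma>) / (n - 2 \<sigma>). They add up to 1, so a single factor u remains over the round
  sphere.\<close>

lemma integral_vol_conf:
  fixes g :: "'a::euclidean_space metric_tensor"
  assumes n: "2 * \<sigma> < real n" and u: "continuous_on (sphere 0 1) (conformal_factor n \<sigma> g)"
    "\<And>x. norm x = 1 \<Longrightarrow> 0 < conformal_factor n \<sigma> g x"
    and F: "F \<in> borel_measurable sphere_measure"
    and G: "\<And>x. norm x = 1 \<Longrightarrow> G x = conformal_factor n \<sigma> g x powr (- ((real n + 2 * \<sigma>) / (real n - 2 * \<sigma>))) * F x"
  shows "(LINT x|vol_conf n \<sigma> g. G x) = (LINT x|sphere_measure. conformal_factor n \<sigma> g x * F x)"
proof -
  let ?u = "conformal_factor n \<sigma> g" and ?e = "2 * real n / (real n - 2 * \<sigma>)"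
    and ?d = "- ((real n + 2 * \<sigma>) / (real n - 2 * \<sigma>))"
  have mp: "(\<lambda>x. ?u x powr c) \<in> borel_measurable sphere_measure" for c
    by (intro borel_measurable_sphere continuous_on_powr u(1) continuous_on_const) (use u(2) in force)
  have m: "G \<in> borel_measurable sphere_measure"
  proof -
    have "(\<lambda>x. ?u x powr ?d * F x) \<in> borel_measurable sphere_measure"
      by (intro borel_measurable_times mp F)
    then show ?thesis using G by (subst measurable_cong[where g = "\<lambda>x. ?u x powr ?d * F x"]) auto
  qed
  have "(LINT x|vol_conf n \<sigma> g. G x) = (LINT x|sphere_measure. ?u x powr ?e * G x)"
    unfolding vol_conf_def by (rule integral_real_density[OF mp _ m]) simp
  also have "\<dots> = (LINT x|sphere_measure. ?u x * F x)"
  proof (rule integral_sphere_cong)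
    fix x :: 'a assume x: "norm x = 1"
    have "?e + ?d = (2 * real n - (real n + 2 * \<sigma>)) / (real n - 2 * \<sigma>)"
      by (simp only: diff_divide_distrib)
    also have "\<dots> = 1" using n by simp
    finally have "?e + ?d = 1" .
    then have "?u x powr ?e * ?u x powr ?d = ?u x"
      using u(2)[OF x] by (simp add: powr_add[symmetric])
    then show "?u x powr ?e * G x = ?u x * F x" unfolding G[OF x] by simp
  qed
  finally show ?thesis .
qed

lemma continuous_on_abs_powr:
  fixes v :: "'a::euclidean_space \<Rightarrow> real"
  assumes "continuous_on S v" "0 < p"
  shows "continuous_on S (\<lambda>x. \<bar>v x\<bar> powr p)"
  using assms by (intro continuous_on_powr' continuous_intros) auto

text \<open>For p = 2 the first factor jumps at the zeros of v, because \<open>0 powr 0\<close> is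
  0. The product is then v itself, so this case is treated separately.\<close>

lemma continuous_on_abs_powr_mult:
  fixes v :: "'a::euclidean_space \<Rightarrow> real"
  assumes v: "continuous_on S v" and p: "2 \<le> p"
  shows "continuous_on S (\<lambda>x. \<bar>v x\<bar> powr (p - 2) * v x)"
proof (cases "p = 2")
  case True
  have "(\<lambda>x. \<bar>v x\<bar> powr (p - 2) * v x) = v" using True by (auto simp: fun_eq_iff)
  with v show ?thesis by (simp only:)
next
  case False
  then show ?thesis using p by (intro continuous_on_mult continuous_on_abs_powr v) auto
qed

theorem proposition2p2:
  fixes n :: nat and \<sigma> p :: real
    and g :: "'a::euclidean_space metric_tensor" and v :: "'a \<Rightarrow> real"
  assumes "DIM('a) = n + 1" and "n \<ge> 2"
    and "0 < \<sigma>" and "\<sigma> < 1"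
    and "g \<in> conformal_class"
    and "p \<ge> 2"
    and "smooth_on_sphere v"
  shows "(LINT x|vol_conf n \<sigma> g. \<bar>v x\<bar> powr (p - 2) * v x * P_conf n \<sigma> g v x)
           \<ge> 4 * (p - 1) / p\<^sup>2 * P_conf_form n \<sigma> g (\<lambda>x. \<bar>v x\<bar> powr (p / 2))
             + (p - 2)\<^sup>2 / p\<^sup>2 * (LINT x|vol_conf n \<sigma> g. R_conf n \<sigma> g x * \<bar>v x\<bar> powr p)
         \<and> (LINT x|vol_conf n \<sigma> g.
            \<bar>v x\<bar> powr (p - 2) * v x * (P_conf n \<sigma> g v x - R_conf n \<sigma> g x * v x)) \<ge> 0"
proof -
  define u where "u = conformal_factor n \<sigma> g"
  define l where "l = (real n - 1) / 2"
  have N': "real DIM('a) = 2 * l + 2" and l: "0 < l"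
    using assms(1,2) by (simp_all add: l_def field_simps)
  have n\<sigma>: "2 * \<sigma> < real n" using assms by auto
  have u: "smooth_on_sphere u" "\<And>x. norm x = 1 \<Longrightarrow> 0 < u x"
    unfolding u_def using conformal_factor_props[OF assms(5) n\<sigma>] by auto
  note v = assms(7) and p = assms(6)
  note uc = smooth_on_sphere_continuous[OF u(1)] and vc = smooth_on_sphere_continuous[OF v]
  \<comment> \<open>The factor u is absorbed into \<open>f\<close>, \<open>h\<close>,
    \<open>w\<close> and \<open>q\<close>. Multiplying a two-point inequality for the values of v by
    u x * u y \<ge> 0 then gives exactly the hypothesis of \<open>P_form_partial_le\<close>.\<close>
  define \<phi> where "\<phi> x = \<bar>v x\<bar> powr (p - 2) * v x" for x
  define f where "f x = u x * v x" for x
  define h where "h x = u x * \<phi> x" for x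
  define w where "w x = u x * \<bar>v x\<bar> powr (p / 2)" for x
  define q where "q x = u x * \<bar>v x\<bar> powr p" for x
  let ?A = "4 * (p - 1) / p\<^sup>2" and ?B = "(p - 2)\<^sup>2 / p\<^sup>2"
  have fs: "smooth_on_sphere f" unfolding f_def[abs_def] by (rule smooth_on_sphere_mult[OF u(1) v])
  have \<phi>c: "continuous_on (sphere 0 1) \<phi>"
    unfolding \<phi>_def[abs_def] by (rule continuous_on_abs_powr_mult[OF vc p])
  have hc: "continuous_on (sphere 0 1) h"
    unfolding h_def[abs_def] by (intro continuous_on_mult uc \<phi>c)
  have wc: "continuous_on (sphere 0 1) w" and qc: "continuous_on (sphere 0 1) q"
    unfolding w_def[abs_def] q_def[abs_def]
    using p by (auto intro!: continuous_on_mult uc continuous_on_abs_powr vc)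
  have sq: "(\<bar>z\<bar> powr (p / 2))\<^sup>2 = \<bar>z\<bar> powr p" for z :: real
    by (simp add: power2_eq_square powr_add[symmetric])
  have \<phi>v: "\<phi> x * v x = \<bar>v x\<bar> powr p" for x
  proof -
    have "\<phi> x * v x = \<bar>v x\<bar> powr (p - 2) * \<bar>v x\<bar> * \<bar>v x\<bar>" by (simp add: \<phi>_def)
    also have "\<dots> = \<bar>v x\<bar> powr p"
      unfolding abs_powr_mult_self using powr_add[of "\<bar>v x\<bar>" "p - 1" 1] by (cases "v x = 0") auto
    finally show ?thesis .
  qed
  have fh: "f x * h x = u x * q x" and ww: "(w x)\<^sup>2 = u x * q x" for x
  proof -
    have "f x * h x = u x * u x * (\<phi> x * v x)" by (simp add: f_def h_def)
    then show "f x * h x = u x * q x" unfolding \<phi>v by (simp add: q_def)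
    show "(w x)\<^sup>2 = u x * q x" unfolding w_def power_mult_distrib sq by (simp add: q_def power2_eq_square)
  qed
  have AB: "?A + ?B = 1"
    using p by (simp add: divide_simps) (simp add: power2_eq_square algebra_simps)
  have P: "integrable sphere_measure (\<lambda>x. P_sphere n \<sigma> F x * G x)"
    if "smooth_on_sphere F" "continuous_on (sphere 0 1) G" for F G :: "'a \<Rightarrow> real"
    by (rule P_sphere_integral(1)[OF that(1) N' l that(2) assms(3,4,2)])
  have Pm: "P_sphere n \<sigma> F \<in> borel_measurable sphere_measure" if "smooth_on_sphere F" for F :: "'a \<Rightarrow> real"
    using borel_measurable_integrable[OF P[OF that continuous_on_const[of _ 1]]] by simp
  note m = borel_measurable_sphere
  have Pc: "P_conf n \<sigma> g v x = u x powr (- ((real n + 2 * \<sigma>) / (real n - 2 * \<sigma>))) * P_sphere n \<sigma> f x" for x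
    by (simp add: P_conf_def u_def f_def[abs_def])
  have Rc: "R_conf n \<sigma> g x = u x powr (- ((real n + 2 * \<sigma>) / (real n - 2 * \<sigma>))) * P_sphere n \<sigma> u x" for x
    by (simp add: R_conf_def P_conf_def u_def)
  note vol = integral_vol_conf[OF n\<sigma> uc[unfolded u_def] u(2)[unfolded u_def], folded u_def]
  have I1: "(LINT x|vol_conf n \<sigma> g. \<bar>v x\<bar> powr (p - 2) * v x * P_conf n \<sigma> g v x) =
      (LINT x|sphere_measure. P_sphere n \<sigma> f x * h x)"
  proof -
    have "(LINT x|vol_conf n \<sigma> g. \<bar>v x\<bar> powr (p - 2) * v x * P_conf n \<sigma> g v x) =
        (LINT x|sphere_measure. u x * (P_sphere n \<sigma> f x * \<phi> x))"
    proof (rule vol)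
      show "(\<lambda>x. P_sphere n \<sigma> f x * \<phi> x) \<in> borel_measurable sphere_measure"
        by (intro borel_measurable_times Pm fs m \<phi>c)
      show "\<bar>v x\<bar> powr (p - 2) * v x * P_conf n \<sigma> g v x =
          u x powr (- ((real n + 2 * \<sigma>) / (real n - 2 * \<sigma>))) * (P_sphere n \<sigma> f x * \<phi> x)" for x
        by (simp add: Pc \<phi>_def)
    qed
    then show ?thesis by (simp add: h_def ac_simps)
  qed
  have I2: "(LINT x|vol_conf n \<sigma> g. R_conf n \<sigma> g x * \<bar>v x\<bar> powr p) =
      (LINT x|sphere_measure. P_sphere n \<sigma> u x * q x)"
  proof -
    have "continuous_on (sphere 0 1) (\<lambda>x. \<bar>v x\<bar> powr p)" using p by (intro continuous_on_abs_powr vc) auto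
    then have "(LINT x|vol_conf n \<sigma> g. R_conf n \<sigma> g x * \<bar>v x\<bar> powr p) =
        (LINT x|sphere_measure. u x * (P_sphere n \<sigma> u x * \<bar>v x\<bar> powr p))"
      by (intro vol borel_measurable_times Pm u m) (simp_all add: Rc)
    then show ?thesis by (simp add: q_def ac_simps)
  qed
  have I3: "(LINT x|vol_conf n \<sigma> g. \<bar>v x\<bar> powr (p - 2) * v x * (P_conf n \<sigma> g v x - R_conf n \<sigma> g x * v x)) =
      (LINT x|sphere_measure. P_sphere n \<sigma> f x * h x) - (LINT x|sphere_measure. P_sphere n \<sigma> u x * q x)"
  proof -
    have "(LINT x|vol_conf n \<sigma> g. \<bar>v x\<bar> powr (p - 2) * v x * (P_conf n \<sigma> g v x - R_conf n \<sigma> g x * v x)) =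
      (LINT x|sphere_measure. u x * (\<phi> x * (P_sphere n \<sigma> f x - P_sphere n \<sigma> u x * v x)))"
    proof (rule vol)
      show "(\<lambda>x. \<phi> x * (P_sphere n \<sigma> f x - P_sphere n \<sigma> u x * v x)) \<in> borel_measurable sphere_measure"
        by (intro borel_measurable_times borel_measurable_diff Pm fs u m \<phi>c vc)
      show "\<bar>v x\<bar> powr (p - 2) * v x * (P_conf n \<sigma> g v x - R_conf n \<sigma> g x * v x) =
          u x powr (- ((real n + 2 * \<sigma>) / (real n - 2 * \<sigma>))) * (\<phi> x * (P_sphere n \<sigma> f x - P_sphere n \<sigma> u x * v x))" for x
        by (simp add: Pc Rc \<phi>_def algebra_simps)
    qed
    also have "\<dots> = (LINT x|sphere_measure. P_sphere n \<sigma> f x * h x - P_sphere n \<sigma> u x * q x)"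
    proof (rule integral_sphere_cong)
      fix x :: 'a
      have "u x * (\<phi> x * (P_sphere n \<sigma> f x - P_sphere n \<sigma> u x * v x)) =
          P_sphere n \<sigma> f x * h x - P_sphere n \<sigma> u x * (u x * (\<phi> x * v x))"
        by (simp add: h_def algebra_simps)
      then show "u x * (\<phi> x * (P_sphere n \<sigma> f x - P_sphere n \<sigma> u x * v x)) =
          P_sphere n \<sigma> f x * h x - P_sphere n \<sigma> u x * q x"
        unfolding \<phi>v q_def .
    qed
    also have "\<dots> = (LINT x|sphere_measure. P_sphere n \<sigma> f x * h x) - (LINT x|sphere_measure. P_sphere n \<sigma> u x * q x)"
      by (rule Bochner_Integration.integral_diff[OF P[OF fs hc] P[OF u(1) qc]])
    finally show ?thesis .
  qed
  have uu: "0 \<le> u x * u y" if "norm x = 1" "norm y = 1" for x y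
    using u(2)[OF that(1)] u(2)[OF that(2)] by simp
  have le1: "f x * h y + h x * f y \<le> 2 * ?A * (w x * w y) + ?B * (u x * q y + q x * u y)"
    if xy: "norm x = 1" "norm y = 1" for x y
  proof -
    define A B where "A = ?A" and "B = ?B"
    show ?thesis
      using mult_left_mono[OF stroock_varopoulos[OF p, of "v x" "v y"] uu[OF xy]]
      unfolding f_def h_def w_def q_def \<phi>_def A_def[symmetric] B_def[symmetric]
      by (simp add: algebra_simps)
  qed
  \<comment> \<open>The coarse inequality corresponds to the coefficients A = 0 and B = 1.\<close>
  have le2: "f x * h y + h x * f y \<le> 2 * 0 * (w x * w y) + 1 * (u x * q y + q x * u y)"
    if xy: "norm x = 1" "norm y = 1" for x y
    using mult_left_mono[OF stroock_varopoulos_coarse[OF p, of "v x" "v y"] uu[OF xy]]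
    unfolding f_def h_def q_def \<phi>_def by (simp add: algebra_simps)
  have d1: "f x * h x = ?A * (w x)\<^sup>2 + ?B * (u x * q x)" for x
    unfolding fh ww using AB by (metis distrib_right mult_1)
  have d2: "f x * h x = 0 * (w x)\<^sup>2 + 1 * (u x * q x)" for x
    by (simp add: fh)
  have A: "0 < ?A" using p by simp
  let ?a = "\<lambda>k. P_eigenvalue n \<sigma> k * (LINT x|sphere_measure. (zproj l k w x)\<^sup>2)"
  let ?R = "(LINT x|sphere_measure. P_sphere n \<sigma> f x * h x) - ?B * (LINT x|sphere_measure. P_sphere n \<sigma> u x * q x)"
  have partial: "?A * (\<Sum>k<m. ?a k) \<le> ?R" for m
    unfolding l_def
    by (rule P_form_partial_le[OF assms(1,2,3,4) fs u(1) hc wc qc less_imp_le[OF A] le1 d1])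
  have a0: "0 \<le> ?a k" for k
    using P_eigenvalue_bounds(1)[OF assms(3,4,2), of k] by simp
  have bd: "(\<Sum>k<m. ?a k) \<le> ?R / ?A" for m
    using partial[of m] A by (subst pos_le_divide_eq) (simp_all only: mult.commute)
  \<comment> \<open>This puts w in the form domain. It has to be established, because
    \<open>suminf\<close> of a divergent series is an unspecified number; the bound on the partial
    sums uses that \<open>?A\<close> is positive.\<close>
  have "summable ?a" using a0 bd by (rule summableI_nonneg_bounded)
  then have "(\<Sum>k. ?a k) \<le> ?R / ?A" by (rule suminf_le_const[OF _ bd])
  then have "?A * (\<Sum>k. ?a k) \<le> ?R"
    using A by (subst (asm) pos_le_divide_eq) (simp_all only: mult.commute)
  moreover have "P_conf_form n \<sigma> g (\<lambda>x. \<bar>v x\<bar> powr (p / 2)) = (\<Sum>k. ?a k)"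
    unfolding P_conf_form_def P_form_def u_def[symmetric] w_def[symmetric]
    by (simp add: harmonic_component_eq[OF wc N' l] eta_contract_eq)
  ultimately have 1: "4 * (p - 1) / p\<^sup>2 * P_conf_form n \<sigma> g (\<lambda>x. \<bar>v x\<bar> powr (p / 2))
       + ?B * (LINT x|sphere_measure. P_sphere n \<sigma> u x * q x) \<le> (LINT x|sphere_measure. P_sphere n \<sigma> f x * h x)"
    by simp
  \<comment> \<open>With coefficient 0 the form of w disappears, so the empty partial sum already
    yields the second inequality.\<close>
  have "0 * (\<Sum>k<0. P_eigenvalue n \<sigma> k * (LINT x|sphere_measure. (zproj ((real n - 1) / 2) k w x)\<^sup>2)) \<le>
      (LINT x|sphere_measure. P_sphere n \<sigma> f x * h x) - 1 * (LINT x|sphere_measure. P_sphere n \<sigma> u x * q x)"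
    by (rule P_form_partial_le[OF assms(1,2,3,4) fs u(1) hc wc qc order_refl le2 d2])
  with 1 show ?thesis unfolding I1 I2 I3 by simp
qed

end
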